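(* Consider the two-term model $\bm Y=\lambda_1\bm A_1\otimes\bm B_1+\lambda_2\bm A_2\otimes\bm B_2+\sigma2^{-(M+N)/2}\bm E$ with deterministic $\lambda_k,\bm A_k,\bm B_k$, along a sequence with $M+N\to\infty$. Assume: (A1) $\frac{m_0+n_0}{\ln\ln(MN)}\to\infty$, $\frac{m_0^\dagger+n_0^\dagger}{\ln\ln(MN)}\to\infty$; (A2) $\bm E$ has i.i.d. standard normal entries; (A4) there is $0<\xi<1$ with $$\max_{(m,n)\in\mathcal W_A}\cos\Theta(\mathcal R_{m,n}[\bm A_1\otimes\bm B_1],\mathcal R_{m,n}[\bm A_2\otimes\bm B_2])\le\xi,\quad \max_{(m,n)\in\mathcal W_B}\cos\Theta(\mathcal R_{m,n}[\bm A_1\otimes\bm B_1]',\mathcal R_{m,n}[\bm A_2\otimes\bm B_2]')\le\xi;$$ (A6) with $G=\lambda_1^2\psi_1^2-\lambda_2^2\phi_2^2-2\lambda_1\lambda_2\phi_1\phi_2\xi$, $$\frac{2^{M+N}}{2^{m_0+n_0}+2^{m_0^\dagger+n_0^\dagger}}\cdot\frac{G}{\sigma^2+\lambda_2^2}\to\infty,\qquad 2^{(M+N)/4}\frac{G}{(\lambda_1+\lambda_2)\sigma}\to\infty.$$ Let $\alpha=\ln\big(1+\frac{G}{\sigma^2+\lambda_2^2}\big)$. If $\kappa\ge 2\ln 2$ and $\kappa=o\big(\frac{2^{M+N}\alpha}{2^{m_0+n_0}+2^{M+N-m_0-n_0}}\big)$, then $$\min_{(m,n)\in\mathcal W}\mathbb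 E[\mathrm{IC}_\kappa(m,n)]-\mathbb E[\mathrm{IC}_\kappa(m_0,n_0)]\ge 2^{M+N}\alpha(1+o(1)),$$ and $\lim_{M+N\to\infty}P\big[\mathrm{IC}_\kappa(m_0,n_0)<\min_{(m,n)\in\mathcal W}\mathrm{IC}_\kappa(m,n)\big]=1$.
   Context: Two-term model: $\lambda_1\ge\lambda_2>0$, $\sigma>0$; $\bm A_k$ are $2^{m_0}\times 2^{n_0}$, $\bm B_k$ are $2^{M-m_0}\times2^{N-n_0}$, with $\mathrm{tr}(\bm A_k\bm A_l')=\mathrm{tr}(\bm B_k\bm B_l')=\delta_{kl}$ for $k,l\in\{1,2\}$. $m_0^\dagger=M-m_0$, $n_0^\dagger=N-n_0$. All quantities may depend on the sequence index. "$a_k\ge o(1)$" means $\max\{-a_k,0\}=o(1)$. Rearrangement: for a $2^a\times 2^b$ matrix $\bm C$ and $0\le m\le a,0\le n\le b$, view $\bm C$ as a $2^m\times 2^n$ array of $2^{a-m}\times 2^{b-n}$ blocks $\bm C_{i,j}$; $\mathcal R_{m,n}[\bm C]$ is the $2^{m+n}\times 2^{a+b-m-n}$ matrix with rows $\mathrm{vec}(\bm C_{i,j})'$ (row-major in $(i,j)$), $\mathrm{vec}$ stacking rows. Even for the two-term model, the one-term fit is used: for configuration $(m,n)$, $\hat{\bm Y}^{(m,n)}=\hat\lambda\hat{\bm A}\otimes\hat{\bm B}$ where $\hat\lambda=\|\mathcal R_{m,n}[\bm Y]\|_S$ and $\hat{\bm A}$ ($2^m\times2^n$), $\hat{\bm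 B}$ are obtained by un-vectorizing the leading left/right singular vectors of $\mathcal R_{m,n}[\bm Y]$; $\mathrm{IC}_\kappa(m,n)=2^{M+N}\ln\|\bm Y-\hat{\bm Y}^{(m,n)}\|_F^2+\kappa(2^{m+n}+2^{M+N-m-n})$. $\mathcal C=\{0,\dots,M\}\times\{0,\dots,N\}\setminus\{(0,0),(M,N)\}$, $\mathcal W=\mathcal C\setminus\{(m_0,n_0)\}$, $\mathcal W_A=\{(m,n)\in\mathcal W: m+n\ge (M-m)+(N-n)\}$, $\mathcal W_B=\{(m,n)\in\mathcal W: m+n<(M-m)+(N-n)\}$. $\phi_k=\max_{(m,n)\in\mathcal W}\|\mathcal R_{m,n}[\bm A_k\otimes\bm B_k]\|_S$, $\psi_k^2=1-\phi_k^2$. For matrices $\bm M_1,\bm M_2$ with the same number of rows, $\cos\Theta(\bm M_1,\bm M_2)=\sup\frac{u_1'\bm M_1'\bm M_2u_2}{\|\bm M_1u_1\|\|\bm M_2u_2\|}$ over $u_1,u_2$ with $\bm M_1u_1\ne0\ne\bm M_2u_2$ (smallest principal angle between column spaces). *)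

theory Defs
  imports "HOL-Probability.Probability" "HOL-Library.Landau_Symbols"
begin

text \<open>Real matrices are represented as functions nat => nat => real together with
explicit dimensions (entries outside the stated dimensions are irrelevant).
Vectors are functions nat => real with explicit length.\<close>

type_synonym rmat = "nat \<Rightarrow> nat \<Rightarrow> real"

definition kron :: "nat \<Rightarrow> nat \<Rightarrow> rmat \<Rightarrow> rmat \<Rightarrow> rmat" where
  "kron p q A B = (\<lambda>i j. A (i div p) (j div q) * B (i mod p) (j mod q))"

definition mtrans :: "rmat \<Rightarrow> rmat" where
  "mtrans C = (\<lambda>i j. C j i)"

definition vecr :: "nat \<Rightarrow> rmat \<Rightarrow> nat \<Rightarrow> real" where
  "vecr q D = (\<lambda>k. D (k div q) (k mod q))"

definition unvec :: "nat \<Rightarrow> (nat \<Rightarrow> real) \<Rightarrow> rmat" where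
  "unvec q u = (\<lambda>i j. u (i * q + j))"

text \<open>Rearrangement R_{m,n}[C] of a 2^a x 2^b matrix C: row number i*2^n+j
(row-major in the block index (i,j)) is vec(C_{i,j})', where C_{i,j} is the
2^(a-m) x 2^(b-n) block in block position (i,j).\<close>
definition rearr :: "nat \<Rightarrow> nat \<Rightarrow> nat \<Rightarrow> nat \<Rightarrow> rmat \<Rightarrow> rmat" where
  "rearr a b m n C = (\<lambda>r. vecr (2^(b-n))
      (\<lambda>s t. C ((r div 2^n) * 2^(a-m) + s) ((r mod 2^n) * 2^(b-n) + t)))"

definition mv :: "nat \<Rightarrow> rmat \<Rightarrow> (nat \<Rightarrow> real) \<Rightarrow> nat \<Rightarrow> real" where
  "mv c R x = (\<lambda>i. \<Sum>j<c. R i j * x j)"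

definition sqnorm :: "nat \<Rightarrow> (nat \<Rightarrow> real) \<Rightarrow> real" where
  "sqnorm d x = (\<Sum>i<d. (x i)^2)"

definition opnorm :: "nat \<Rightarrow> nat \<Rightarrow> rmat \<Rightarrow> real" where
  "opnorm r c R = Sup {sqrt (sqnorm r (mv c R x)) | x. sqnorm c x \<le> 1}"

definition lead_sv :: "nat \<Rightarrow> nat \<Rightarrow> rmat \<Rightarrow> (nat \<Rightarrow> real) \<times> (nat \<Rightarrow> real)" where
  "lead_sv r c R = (SOME (u, v). sqnorm r u = 1 \<and> sqnorm c v = 1 \<and>
      (\<forall>i<r. mv c R v i = opnorm r c R * u i) \<and>
      (\<forall>j<c. mv r (mtrans R) u j = opnorm r c R * v j))"

definition fit :: "nat \<Rightarrow> nat \<Rightarrow> nat \<Rightarrow> nat \<Rightarrow> rmat \<Rightarrow> rmat" where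
  "fit M N m n Y =
     (let R = rearr M N m n Y; r = 2^(m+n); c = 2^(M+N-m-n);
          lam = opnorm r c R; uv = lead_sv r c R
      in (\<lambda>i j. lam * kron (2^(M-m)) (2^(N-n))
                  (unvec (2^n) (fst uv)) (unvec (2^(N-n)) (snd uv)) i j))"

definition frob2 :: "nat \<Rightarrow> nat \<Rightarrow> rmat \<Rightarrow> real" where
  "frob2 r c C = (\<Sum>i<r. \<Sum>j<c. (C i j)^2)"

definition frob_inner :: "nat \<Rightarrow> nat \<Rightarrow> rmat \<Rightarrow> rmat \<Rightarrow> real" where
  "frob_inner r c A B = (\<Sum>i<r. \<Sum>j<c. A i j * B i j)"

definition IC :: "real \<Rightarrow> nat \<Rightarrow> nat \<Rightarrow> nat \<Rightarrow> nat \<Rightarrow> rmat \<Rightarrow> real" where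
  "IC \<kappa> M N m n Y =
     (2::real)^(M+N) * ln (frob2 (2^M) (2^N) (\<lambda>i j. Y i j - fit M N m n Y i j))
     + \<kappa> * ((2::real)^(m+n) + 2^(M+N-m-n))"

definition cfgs :: "nat \<Rightarrow> nat \<Rightarrow> (nat \<times> nat) set" where
  "cfgs M N = ({0..M} \<times> {0..N}) - {(0,0), (M,N)}"

definition cfgsW :: "nat \<Rightarrow> nat \<Rightarrow> nat \<Rightarrow> nat \<Rightarrow> (nat \<times> nat) set" where
  "cfgsW M N m0 n0 = cfgs M N - {(m0,n0)}"

definition cfgsWA :: "nat \<Rightarrow> nat \<Rightarrow> nat \<Rightarrow> nat \<Rightarrow> (nat \<times> nat) set" where
  "cfgsWA M N m0 n0 = {(m,n) \<in> cfgsW M N m0 n0. m + n \<ge> (M - m) + (N - n)}"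

definition cfgsWB :: "nat \<Rightarrow> nat \<Rightarrow> nat \<Rightarrow> nat \<Rightarrow> (nat \<times> nat) set" where
  "cfgsWB M N m0 n0 = {(m,n) \<in> cfgsW M N m0 n0. m + n < (M - m) + (N - n)}"

definition phi :: "nat \<Rightarrow> nat \<Rightarrow> (nat \<times> nat) set \<Rightarrow> rmat \<Rightarrow> real" where
  "phi M N W C = Max ((\<lambda>(m,n). opnorm (2^(m+n)) (2^(M+N-m-n)) (rearr M N m n C)) ` W)"

text \<open>Cosine of the smallest principal angle between the column spaces of
M1 (r x c1) and M2 (r x c2).\<close>
definition cosTheta :: "nat \<Rightarrow> nat \<Rightarrow> nat \<Rightarrow> rmat \<Rightarrow> rmat \<Rightarrow> real" where
  "cosTheta r c1 c2 M1 M2 = Sup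
     {(\<Sum>i<r. mv c1 M1 u1 i * mv c2 M2 u2 i) /
        (sqrt (sqnorm r (mv c1 M1 u1)) * sqrt (sqnorm r (mv c2 M2 u2))) | u1 u2.
       sqnorm r (mv c1 M1 u1) \<noteq> 0 \<and> sqnorm r (mv c2 M2 u2) \<noteq> 0}"

definition gauss_mat :: "nat \<Rightarrow> nat \<Rightarrow> (nat \<times> nat \<Rightarrow> real) measure" where
  "gauss_mat M N = PiM ({..<2^M} \<times> {..<2^N}) (\<lambda>_. density lborel std_normal_density)"


definition kterm :: "nat \<Rightarrow> nat \<Rightarrow> nat \<Rightarrow> nat \<Rightarrow> rmat \<Rightarrow> rmat \<Rightarrow> rmat" where
  "kterm M N m0 n0 A B = kron (2^(M - m0)) (2^(N - n0)) A B"

definition model_Y :: "nat \<Rightarrow> nat \<Rightarrow> nat \<Rightarrow> nat \<Rightarrow> real \<Rightarrow> real \<Rightarrow> real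
     \<Rightarrow> rmat \<Rightarrow> rmat \<Rightarrow> rmat \<Rightarrow> rmat \<Rightarrow> (nat \<times> nat \<Rightarrow> real) \<Rightarrow> rmat" where
  "model_Y M N m0 n0 lam1 lam2 sig A1 B1 A2 B2 E = (\<lambda>i j.
      lam1 * kterm M N m0 n0 A1 B1 i j + lam2 * kterm M N m0 n0 A2 B2 i j
      + sig * 2 powr (- real (M + N) / 2) * E (i, j))"

text \<open>G = lam1^2 psi1^2 - lam2^2 phi2^2 - 2 lam1 lam2 phi1 phi2 xi, with psi1^2 = 1 - phi1^2.\<close>
definition G_val :: "nat \<Rightarrow> nat \<Rightarrow> nat \<Rightarrow> nat \<Rightarrow> real \<Rightarrow> real \<Rightarrow> real
     \<Rightarrow> rmat \<Rightarrow> rmat \<Rightarrow> rmat \<Rightarrow> rmat \<Rightarrow> real" where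
  "G_val M N m0 n0 lam1 lam2 xi A1 B1 A2 B2 =
     (let W = cfgsW M N m0 n0;
          phi1 = phi M N W (kterm M N m0 n0 A1 B1);
          phi2 = phi M N W (kterm M N m0 n0 A2 B2)
      in lam1^2 * (1 - phi1^2) - lam2^2 * phi2^2 - 2 * lam1 * lam2 * phi1 * phi2 * xi)"

end

theory Submission
  imports Defs "HOL-Real_Asymp.Real_Asymp"
begin

text \<open>
  Write \<open>D = 2^(M+N)\<close>. By Eckart--Young the residual of the fit with configuration \<open>(m, n)\<close> is the squared
  Frobenius norm of \<open>Y\<close> minus the squared operator norm of its rearrangement \<open>R\<close>. Transposing if necessary,
  let \<open>R\<close> have \<open>p \<le> q\<close> rows and columns with \<open>p q = D\<close>. An \<open>\<epsilon>\<close>-net on the sphere of dimension \<open>p\<close>, applied to the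
  quadratic form that \<open>R\<close> adds to its noiseless part, bounds the squared norm by that of the signal plus
  \<open>sig\<^sup>2 / p\<close> up to an error of order \<open>(lam1 + lam2) sig D powr (-1/4) + sig\<^sup>2 / sqrt D = o(G)\<close>. For a wrong
  configuration the angle condition bounds the squared norm of the signal by \<open>lam1\<^sup>2 - G\<close>, and the remaining loss
  \<open>sig\<^sup>2 / p\<close> is paid for by the penalty because \<open>ln (1 - z) \<ge> - 2 z ln 2\<close> on \<open>[0, 1/2]\<close>. For the true
  configuration, projecting on \<open>A1, B1\<close> cancels \<open>lam1\<close> and leaves residual \<open>lam2\<^sup>2 + sig\<^sup>2\<close> up to order \<open>D powr (-1/2)\<close>.
  For the expectations one also needs that the logarithm of the residual is not too negative on
  the exceptional event: the residual dominates the squared distance of one Gaussian entry to a quantity independent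
  of it, so a small negative moment of it is bounded.
\<close>

section \<open>Operator norm and leading singular pair\<close>

text \<open>Since \<open>alpha\<close> may tend to zero, an error that merely vanishes is useless;
  each has to be \<open>o(alpha)\<close>. With \<open>S = sig^2 + lam2^2 + G\<close> one has
  \<open>alpha \<ge> G / S\<close>, so an error \<open>Q / S\<close> is harmless once
  \<open>Q = o(G)\<close>. The growth conditions also force \<open>sqrt D * alpha\<close> to
  infinity, which disposes of terms of order \<open>1 / D\<close> up to logarithms.

  The net on the sphere of dimension \<open>p\<close> costs a factor \<open>exp (O(p))\<close>. An
  exponential moment of order \<open>p / Q\<close> pays for it, and the worst case
  \<open>p = sqrt D\<close> is the origin of \<open>D powr (-1/4)\<close>. The tails decay
  exponentially in \<open>p\<close>, which itself doubles with each step away from the two excluded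
  corners; so the union over all configurations costs a constant factor.

  For expectations the exceptional event must be much rarer. A second choice of the exponential
  parameter gives it probability of order \<open>exp (- 2 * sqrt D)\<close>, and there the
  logarithmic loss \<open>T\<close> is split by \<open>T \<le> D + T^2 / D\<close>, so that a second
  moment of order \<open>(ln D)^2\<close> suffices. The residual has to be compared with
  \<open>sig^2 + lam2^2\<close>, not with \<open>sig^2\<close>, because \<open>lam2 / sig\<close>
  may be unbounded.\<close>

lemma sqnorm_nonneg [simp]: "0 \<le> sqnorm d x"
  by (simp add: sqnorm_def sum_nonneg)

lemma sqnorm_scale: "sqnorm d (\<lambda>i. c * x i) = c\<^sup>2 * sqnorm d x"
  by (simp add: sqnorm_def power_mult_distrib sum_distrib_left)

lemma mv_scale: "mv c R (\<lambda>i. a * x i) = (\<lambda>i. a * mv c R x i)"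
  by (auto simp: mv_def sum_distrib_left ac_simps)

lemma mv_cong: "(\<And>i. i < c \<Longrightarrow> x i = y i) \<Longrightarrow> mv c R x = mv c R y"
  by (auto simp: mv_def)

lemma sqnorm_cong: "(\<And>i. i < c \<Longrightarrow> x i = y i) \<Longrightarrow> sqnorm c x = sqnorm c y"
  by (auto simp: sqnorm_def)

lemma sum_mult_le_sqnorm: "(\<Sum>i<d. x i * y i)\<^sup>2 \<le> sqnorm d x * sqnorm d y"
  unfolding sqnorm_def by (rule Cauchy_Schwarz_ineq_sum)

lemma frob2_nonneg [simp]: "0 \<le> frob2 r c R"
  by (simp add: frob2_def sum_nonneg)

lemma sqnorm_mv_le_frob2: "sqnorm r (mv c R x) \<le> frob2 r c R * sqnorm c x"
proof -
  have "sqnorm r (mv c R x) \<le> (\<Sum>i<r. sqnorm c (R i) * sqnorm c x)"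
    unfolding sqnorm_def[of r] mv_def by (intro sum_mono sum_mult_le_sqnorm)
  also have "\<dots> = frob2 r c R * sqnorm c x"
    by (simp add: frob2_def sqnorm_def sum_distrib_right)
  finally show ?thesis .
qed

lemma frob2_mtrans: "frob2 c r (mtrans R) = frob2 r c R"
  unfolding frob2_def mtrans_def by (rule sum.swap)

lemma mtrans_mtrans [simp]: "mtrans (mtrans R) = R"
  by (simp add: mtrans_def)

lemma bilinear_mtrans:
  "(\<Sum>i<r. u i * mv c R v i) = (\<Sum>j<c. v j * mv r (mtrans R) u j)"
  unfolding mv_def mtrans_def sum_distrib_left
  by (subst sum.swap) (intro sum.cong refl, simp)

lemma opnorm_set_bdd:
  "bdd_above {sqrt (sqnorm r (mv c R x)) | x. sqnorm c x \<le> 1}"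
proof (rule bdd_aboveI)
  fix y assume "y \<in> {sqrt (sqnorm r (mv c R x)) | x. sqnorm c x \<le> 1}"
  then obtain x where x: "sqnorm c x \<le> 1" "y = sqrt (sqnorm r (mv c R x))" by auto
  have "sqnorm r (mv c R x) \<le> frob2 r c R * 1"
    using sqnorm_mv_le_frob2[of r c R x] x(1) mult_left_mono[OF x(1), of "frob2 r c R"] by simp
  then show "y \<le> sqrt (frob2 r c R)" using x by simp
qed

lemma opnorm_ge: "sqnorm c x \<le> 1 \<Longrightarrow> sqrt (sqnorm r (mv c R x)) \<le> opnorm r c R"
  unfolding opnorm_def by (intro cSup_upper opnorm_set_bdd) auto

lemma sqnorm_zero [simp]: "sqnorm c (\<lambda>_. 0) = 0"
  by (simp add: sqnorm_def)

lemma opnorm_le: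
  assumes "\<And>x. sqnorm c x \<le> 1 \<Longrightarrow> sqrt (sqnorm r (mv c R x)) \<le> K"
  shows "opnorm r c R \<le> K"
  unfolding opnorm_def
proof (rule cSup_least)
  have "sqnorm c (\<lambda>_. 0) \<le> 1" by simp
  then show "{sqrt (sqnorm r (mv c R x)) |x. sqnorm c x \<le> 1} \<noteq> {}" by blast
qed (use assms in auto)

lemma opnorm_nonneg [simp]: "0 \<le> opnorm r c R"
  using opnorm_ge[of c "\<lambda>_. 0" r R] real_sqrt_ge_zero[OF sqnorm_nonneg] by (metis order_trans sqnorm_zero zero_le_one)

lemma sqnorm_unit: "0 < d \<Longrightarrow> sqnorm d (\<lambda>i. if i = 0 then 1 else 0) = 1"
  by (cases d) (simp_all add: sqnorm_def sum.lessThan_Suc_shift del: sum.lessThan_Suc)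

lemma sqnorm_eq_0D: "sqnorm c x = 0 \<Longrightarrow> i < c \<Longrightarrow> x i = 0"
  by (auto simp: sqnorm_def sum_nonneg_eq_0_iff)

lemma sqnorm_mv_le: "sqnorm r (mv c R x) \<le> (opnorm r c R)\<^sup>2 * sqnorm c x"
proof (cases "sqnorm c x = 0")
  case True
  then have "mv c R x = mv c R (\<lambda>_. 0)" by (intro mv_cong sqnorm_eq_0D)
  then show ?thesis using True by (simp add: mv_def)
next
  case False
  define s where "s = sqnorm c x"
  have s: "s > 0" using False sqnorm_nonneg[of c x] by (simp add: s_def less_le)
  define a where "a = 1 / sqrt s"
  have a2: "a\<^sup>2 = 1 / s" using s by (simp add: a_def power_divide)
  have "sqnorm c (\<lambda>i. a * x i) \<le> 1" using s by (simp add: sqnorm_scale a2 s_def)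
  from opnorm_ge[OF this, of r R] have "sqrt (a\<^sup>2 * sqnorm r (mv c R x)) \<le> opnorm r c R"
    by (simp add: mv_scale sqnorm_scale)
  then have "(sqrt (a\<^sup>2 * sqnorm r (mv c R x)))\<^sup>2 \<le> (opnorm r c R)\<^sup>2"
    by (intro power_mono) auto
  then have "a\<^sup>2 * sqnorm r (mv c R x) \<le> (opnorm r c R)\<^sup>2" by simp
  then show ?thesis using s by (simp add: a2 field_simps s_def)
qed

lemma opnorm_sq_le:
  assumes "\<And>x. sqnorm c x \<le> 1 \<Longrightarrow> sqnorm r (mv c R x) \<le> K"
  shows "(opnorm r c R)\<^sup>2 \<le> K"
proof -
  have "K \<ge> 0" using order_trans[OF sqnorm_nonneg assms[of "\<lambda>_. 0"]] by simp
  have "opnorm r c R \<le> sqrt K" by (intro opnorm_le real_sqrt_le_mono assms)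
  then have "(opnorm r c R)\<^sup>2 \<le> (sqrt K)\<^sup>2" by (intro power_mono) auto
  then show ?thesis using \<open>K \<ge> 0\<close> by simp
qed

lemma opnorm_sq_le_frob2: "(opnorm r c R)\<^sup>2 \<le> frob2 r c R"
proof (rule opnorm_sq_le)
  fix x assume "sqnorm c x \<le> 1"
  then show "sqnorm r (mv c R x) \<le> frob2 r c R"
    using sqnorm_mv_le_frob2[of r c R x] mult_left_mono[of "sqnorm c x" 1 "frob2 r c R"] by simp
qed

lemma bilinear_le:
  "(\<Sum>i<r. u i * mv c R v i)\<^sup>2 \<le> (opnorm r c R)\<^sup>2 * sqnorm r u * sqnorm c v"
proof -
  have "(\<Sum>i<r. u i * mv c R v i)\<^sup>2 \<le> sqnorm r u * sqnorm r (mv c R v)" by (rule sum_mult_le_sqnorm)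
  also have "\<dots> \<le> sqnorm r u * ((opnorm r c R)\<^sup>2 * sqnorm c v)"
    by (intro mult_left_mono sqnorm_mv_le) auto
  finally show ?thesis by (simp add: ac_simps)
qed

text \<open>Duality: for \<open>w = mv r (mtrans R) u\<close> the number \<open>sqnorm c w\<close>
  equals the bilinear form of \<open>R\<close> at \<open>u\<close> and \<open>w\<close>, which is at
  most the norm of \<open>R\<close> times the length of \<open>w\<close>; one factor of that length
  cancels.\<close>

lemma opnorm_mtrans_le: "opnorm c r (mtrans R) \<le> opnorm r c R"
proof -
  have "(opnorm c r (mtrans R))\<^sup>2 \<le> (opnorm r c R)\<^sup>2"
  proof (rule opnorm_sq_le)
    fix u assume u: "sqnorm r u \<le> 1"
    define w where "w = mv r (mtrans R) u"
    have "sqnorm c w = (\<Sum>i<r. u i * mv c R w i)"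
      unfolding bilinear_mtrans w_def[symmetric] sqnorm_def power2_eq_square ..
    then have "(sqnorm c w)\<^sup>2 \<le> (opnorm r c R)\<^sup>2 * sqnorm r u * sqnorm c w"
      using bilinear_le[where u = u and v = w and r = r and c = c and R = R] by simp
    also have "\<dots> \<le> (opnorm r c R)\<^sup>2 * 1 * sqnorm c w"
      by (intro mult_right_mono mult_left_mono u) auto
    finally have *: "sqnorm c w * sqnorm c w \<le> (opnorm r c R)\<^sup>2 * sqnorm c w"
      by (simp add: power2_eq_square)
    show "sqnorm c (mv r (mtrans R) u) \<le> (opnorm r c R)\<^sup>2"
    proof (cases "sqnorm c w = 0")
      case False
      then have "sqnorm c w > 0" using sqnorm_nonneg[of c w] by linarith
      then show ?thesis using * by (simp add: w_def)
    qed (simp add: w_def)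
  qed
  then show ?thesis by (simp add: power2_le_iff_abs_le)
qed

lemma opnorm_mtrans: "opnorm c r (mtrans R) = opnorm r c R"
  using opnorm_mtrans_le[of c r R] opnorm_mtrans_le[of r c "mtrans R"] by simp

text \<open>Vectors are functions on all natural numbers, so the ball for \<open>sqnorm c\<close> is
  not compact: coordinates from \<open>c\<close> on are unconstrained. Fixing them at zero changes
  neither side and places the maximisation in a product of compact sets.\<close>

lemma opnorm_attained:
  assumes "0 < c"
  shows "\<exists>v. sqnorm c v = 1 \<and> sqnorm r (mv c R v) = (opnorm r c R)\<^sup>2"
proof -
  define box :: "(nat \<Rightarrow> real) set" where
    "box = PiE UNIV (\<lambda>i. if i < c then {-1..1} else {0})"
  define K where "K = {x \<in> box. sqnorm c x \<le> 1}"
  have cbox: "compact box"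
    unfolding box_def
  proof -
    have "compactin (product_topology (\<lambda>_::nat. euclidean::real topology) UNIV)
      (PiE UNIV (\<lambda>i. if i < c then {-1..1} else {0}))"
      unfolding compactin_PiE by (intro disjI2 ballI) simp
    then show "compact (PiE UNIV (\<lambda>i. if i < c then {-1..1::real} else {0}))"
      unfolding euclidean_product_topology compactin_euclidean_iff .
  qed
  have cont: "continuous_on UNIV (\<lambda>x. sqnorm c x)" unfolding sqnorm_def
    by (intro continuous_on_sum continuous_on_power continuous_on_product_coordinates)
  have cl: "closed {x. sqnorm c x \<le> 1}"
    by (rule closed_Collect_le[OF cont continuous_on_const])
  have "K = box \<inter> {x. sqnorm c x \<le> 1}" by (auto simp: K_def)
  then have cK: "compact K" using compact_Int_closed[OF cbox cl] by simp
  define e :: "nat \<Rightarrow> real" where "e = (\<lambda>i. if i = 0 then 1 else 0)"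
  have e1: "sqnorm c e = 1" using assms unfolding e_def by (rule sqnorm_unit)
  have "e \<in> K" using assms e1 by (auto simp: K_def box_def e_def)
  then have "K \<noteq> {}" by auto
  have coord: "continuous_on K (\<lambda>x. x i)" for i
    by (rule continuous_on_subset[OF continuous_on_product_coordinates]) auto
  have "continuous_on K (\<lambda>x. sqnorm r (mv c R x))" unfolding sqnorm_def mv_def
    by (intro continuous_on_sum continuous_on_power continuous_on_mult continuous_on_const coord)
  from continuous_attains_sup[OF cK \<open>K \<noteq> {}\<close> this] obtain v where
    v: "v \<in> K" "\<And>x. x \<in> K \<Longrightarrow> sqnorm r (mv c R x) \<le> sqnorm r (mv c R v)" by auto
  have le: "(opnorm r c R)\<^sup>2 \<le> sqnorm r (mv c R v)"
  proof (rule opnorm_sq_le)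
    fix x assume x: "sqnorm c x \<le> 1"
    define y where "y = (\<lambda>i. if i < c then x i else 0)"
    have xy: "mv c R x = mv c R y" "sqnorm c x = sqnorm c y"
      by (auto intro: mv_cong sqnorm_cong simp: y_def)
    have "-1 \<le> x i \<and> x i \<le> 1" if "i < c" for i
    proof -
      have "(x i)\<^sup>2 \<le> sqnorm c x" unfolding sqnorm_def using that
        by (intro member_le_sum) auto
      then have "\<bar>x i\<bar> \<le> 1" using x abs_square_le_1[of "x i"] by linarith
      then show ?thesis by linarith
    qed
    then have "y \<in> K" using x xy(2) by (auto simp: K_def box_def y_def)
    with v(2) xy show "sqnorm r (mv c R x) \<le> sqnorm r (mv c R v)" by simp
  qed
  \<comment> \<open>A maximiser over the ball automatically has length one unless the norm vanishes;
    in that case every unit vector attains it.\<close>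
  show ?thesis
  proof (cases "opnorm r c R = 0")
    case True
    then show ?thesis using e1 sqnorm_mv_le[of r c R e] sqnorm_nonneg[of r "mv c R e"]
      by (intro exI[of _ e]) (auto intro: antisym)
  next
    case False
    have v1: "sqnorm c v \<le> 1" using v(1) by (simp add: K_def)
    have up: "sqnorm r (mv c R v) \<le> (opnorm r c R)\<^sup>2 * sqnorm c v" by (rule sqnorm_mv_le)
    have "(opnorm r c R)\<^sup>2 * 1 \<le> (opnorm r c R)\<^sup>2 * sqnorm c v" using le up by simp
    then have "sqnorm c v = 1" using v1 False by (simp add: mult_le_cancel_left_pos)
    then show ?thesis using le up by (intro exI[of _ v]) auto
  qed
qed

text \<open>First-order condition at a maximiser: the linear term of the quadratic inequality in \<open>t\<close>
  must vanish.\<close>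
lemma quadratic_linear_term_zero:
  fixes a b :: real
  assumes "\<And>t. 2 * t * a \<le> t\<^sup>2 * b"
  shows "a = 0"
proof (rule ccontr)
  assume "a \<noteq> 0"
  define t where "t = a / (\<bar>b\<bar> + 1)"
  have "2 * t * a \<le> t\<^sup>2 * b" by (rule assms)
  also have "\<dots> \<le> t\<^sup>2 * (\<bar>b\<bar> + 1)" by (intro mult_left_mono) auto
  also have "\<dots> = t * a" by (simp add: t_def power2_eq_square)
  finally have "t * a \<le> 0" by (simp add: mult.commute)
  moreover have "0 < a * a / (\<bar>b\<bar> + 1)"
    using \<open>a \<noteq> 0\<close> by (intro divide_pos_pos) (auto simp: zero_less_mult_iff linorder_neq_iff)
  then have "t * a > 0" by (simp add: t_def)
  ultimately show False by simp
qed

lemma sqnorm_add_scale: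
  "sqnorm d (\<lambda>i. x i + t * y i) = sqnorm d x + 2 * t * (\<Sum>i<d. x i * y i) + t\<^sup>2 * sqnorm d y"
  by (simp add: sqnorm_def power2_sum power_mult_distrib sum.distrib sum_distrib_left algebra_simps)

lemma mv_add_scale: "mv c R (\<lambda>i. x i + t * y i) = (\<lambda>i. mv c R x i + t * mv c R y i)"
  by (auto simp: mv_def sum_distrib_left algebra_simps sum.distrib)

lemma sum_sq_test:
  fixes z :: "nat \<Rightarrow> real"
  assumes "\<And>w. (\<Sum>j<c. z j * w j) = 0" "j < c"
  shows "z j = 0"
  using assms(1)[of z] assms(2) by (simp add: sum_nonneg_eq_0_iff)

text \<open>The right vector is a maximiser, the left one its normalised image. The relation for the
  transpose is then the first-order condition at the maximiser. If the norm is zero, both images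
  vanish and any unit vector can be taken on the left.\<close>

lemma lead_sv_exists:
  assumes "0 < c" "0 < r"
  shows "\<exists>u v. sqnorm r u = 1 \<and> sqnorm c v = 1 \<and>
      (\<forall>i<r. mv c R v i = opnorm r c R * u i) \<and>
      (\<forall>j<c. mv r (mtrans R) u j = opnorm r c R * v j)"
proof -
  obtain v where v: "sqnorm c v = 1" "sqnorm r (mv c R v) = (opnorm r c R)\<^sup>2"
    using opnorm_attained[OF assms(1)] by blast
  define s where "s = opnorm r c R"
  show ?thesis
  proof (cases "s = 0")
    case True
    define e :: "nat \<Rightarrow> real" where "e = (\<lambda>i. if i = 0 then 1 else 0)"
    have e1: "sqnorm r e = 1" using assms(2) unfolding e_def by (rule sqnorm_unit)
    have "sqnorm r (mv c R v) = 0" using v True by (simp add: s_def)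
    moreover have "sqnorm c (mv r (mtrans R) e) \<le> (opnorm c r (mtrans R))\<^sup>2 * sqnorm r e" by (rule sqnorm_mv_le)
    then have "sqnorm c (mv r (mtrans R) e) = 0"
      using True by (intro antisym sqnorm_nonneg) (simp add: opnorm_mtrans s_def)
    ultimately show ?thesis using True e1 v(1)
      by (intro exI[of _ e] exI[of _ v]) (auto simp: s_def dest: sqnorm_eq_0D)
  next
    case False
    then have s: "s > 0" using opnorm_nonneg[of r c R] by (simp add: s_def less_le)
    define u where "u = (\<lambda>i. mv c R v i / s)"
    have Rv: "mv c R v = (\<lambda>i. s * u i)" using s by (auto simp: u_def)
    have "s\<^sup>2 * sqnorm r u = s\<^sup>2" using v(2) by (simp add: Rv sqnorm_scale s_def)
    then have u1: "sqnorm r u = 1" using s by simp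
    have "mv r (mtrans R) u j - s * v j = 0" if "j < c" for j
    proof (rule sum_sq_test[OF _ that])
      fix w
      \<comment> \<open>The inequality between \<open>sqnorm r (mv c R x)\<close> and
        \<open>s^2 * sqnorm c x\<close> is an equality at \<open>x = v\<close>. Along
        \<open>v + t w\<close> the constant terms cancel and the linear term cannot have a
        sign.\<close>
      have "(\<Sum>i<r. mv c R v i * mv c R w i) - s\<^sup>2 * (\<Sum>j<c. v j * w j) = 0"
      proof (rule quadratic_linear_term_zero)
        fix t
        have "sqnorm r (mv c R (\<lambda>i. v i + t * w i)) \<le> s\<^sup>2 * sqnorm c (\<lambda>i. v i + t * w i)"
          unfolding s_def by (rule sqnorm_mv_le)
        then have "sqnorm r (mv c R v) + 2 * t * (\<Sum>i<r. mv c R v i * mv c R w i) + t\<^sup>2 * sqnorm r (mv c R w)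
           \<le> s\<^sup>2 * (sqnorm c v + 2 * t * (\<Sum>i<c. v i * w i) + t\<^sup>2 * sqnorm c w)"
          by (simp only: mv_add_scale sqnorm_add_scale)
        then show "2 * t * ((\<Sum>i<r. mv c R v i * mv c R w i) - s\<^sup>2 * (\<Sum>j<c. v j * w j))
            \<le> t\<^sup>2 * (s\<^sup>2 * sqnorm c w - sqnorm r (mv c R w))"
          using v by (simp add: algebra_simps s_def)
      qed
      moreover have "(\<Sum>i<r. mv c R v i * mv c R w i) = s * (\<Sum>i<r. u i * mv c R w i)"
        by (simp add: Rv sum_distrib_left ac_simps)
      ultimately have "s * ((\<Sum>j<c. w j * mv r (mtrans R) u j) - s * (\<Sum>j<c. v j * w j)) = 0"
        unfolding bilinear_mtrans[where u = u and v = w and r = r and c = c and R = R] by (simp add: algebra_simps power2_eq_square)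
      then have "(\<Sum>j<c. w j * mv r (mtrans R) u j) - s * (\<Sum>j<c. v j * w j) = 0" using s by simp
      then show "(\<Sum>j<c. (mv r (mtrans R) u j - s * v j) * w j) = 0"
        by (simp add: algebra_simps sum_subtractf sum_distrib_left)
    qed
    then show ?thesis using u1 v(1) Rv by (intro exI[of _ u] exI[of _ v]) (auto simp: s_def)
  qed
qed

lemma lead_sv_spec:
  assumes "0 < c" "0 < r" "lead_sv r c R = (u, v)"
  shows "sqnorm r u = 1" "sqnorm c v = 1"
    "\<And>i. i < r \<Longrightarrow> mv c R v i = opnorm r c R * u i"
proof -
  let ?P = "\<lambda>(u, v). sqnorm r u = 1 \<and> sqnorm c v = 1 \<and>
      (\<forall>i<r. mv c R v i = opnorm r c R * u i) \<and>
      (\<forall>j<c. mv r (mtrans R) u j = opnorm r c R * v j)"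
  have "\<exists>x. ?P x" using lead_sv_exists[OF assms(1,2), of R] by auto
  then have "?P (lead_sv r c R)" unfolding lead_sv_def by (rule someI_ex)
  then show "sqnorm r u = 1" "sqnorm c v = 1"
    "\<And>i. i < r \<Longrightarrow> mv c R v i = opnorm r c R * u i" using assms(3) by auto
qed

lemma frob2_rank_one_diff:
  assumes "sqnorm r u = 1" "sqnorm c v = 1"
  shows "frob2 r c (\<lambda>i j. R i j - s * (u i * v j)) =
    frob2 r c R - 2 * s * (\<Sum>i<r. u i * mv c R v i) + s\<^sup>2"
proof -
  have "(\<Sum>i<r. \<Sum>j<c. (u i * v j)\<^sup>2) = sqnorm r u * sqnorm c v"
    by (simp add: sqnorm_def sum_product power_mult_distrib)
  then have 1: "(\<Sum>i<r. \<Sum>j<c. (u i)\<^sup>2 * (v j)\<^sup>2) = 1" using assms by (simp add: power_mult_distrib)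
  have 2: "(\<Sum>i<r. \<Sum>j<c. (s * (u i * v j))\<^sup>2) = s\<^sup>2"
  proof -
    have "(\<Sum>i<r. \<Sum>j<c. (s * (u i * v j))\<^sup>2) = s\<^sup>2 * (\<Sum>i<r. \<Sum>j<c. (u i)\<^sup>2 * (v j)\<^sup>2)"
      unfolding sum_distrib_left by (intro sum.cong refl) (simp add: power_mult_distrib)
    then show ?thesis using 1 by simp
  qed
  have 3: "(\<Sum>i<r. \<Sum>j<c. 2 * R i j * (s * (u i * v j))) = 2 * s * (\<Sum>i<r. u i * mv c R v i)"
    unfolding mv_def sum_distrib_left by (intro sum.cong refl) (simp add: ac_simps)
  show ?thesis
    unfolding frob2_def power2_diff sum.distrib sum_subtractf 2 3 by (rule diff_add_eq[symmetric])
qed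

text \<open>Completing the square in \<open>s\<close>: the error is at least the squared Frobenius
  norm minus the square of the bilinear form at \<open>u\<close> and \<open>v\<close>, which the
  operator norm bounds. This is the half of Eckart--Young that holds for every rank one
  competitor.\<close>

lemma frob2_rank_one_diff_ge:
  assumes "sqnorm r u = 1" "sqnorm c v = 1"
  shows "frob2 r c (\<lambda>i j. R i j - s * (u i * v j)) \<ge> frob2 r c R - (opnorm r c R)\<^sup>2"
proof -
  define b where "b = (\<Sum>i<r. u i * mv c R v i)"
  have "b\<^sup>2 \<le> (opnorm r c R)\<^sup>2" using bilinear_le[where u = u and v = v and r = r and c = c and R = R] assms by (simp add: b_def)
  moreover have "0 \<le> (s - b)\<^sup>2" by simp
  ultimately show ?thesis unfolding frob2_rank_one_diff[OF assms] b_def[symmetric]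
    by (simp add: power2_diff algebra_simps)
qed

lemma frob2_lead_sv_diff:
  assumes "0 < c" "0 < r" "lead_sv r c R = (u, v)"
  shows "frob2 r c (\<lambda>i j. R i j - opnorm r c R * (u i * v j)) = frob2 r c R - (opnorm r c R)\<^sup>2"
proof -
  note s = lead_sv_spec[OF assms]
  have "(\<Sum>i<r. u i * mv c R v i) = opnorm r c R * sqnorm r u"
    using s(3) by (simp add: sqnorm_def sum_distrib_left power2_eq_square ac_simps)
  then show ?thesis using frob2_rank_one_diff[OF s(1,2), of R "opnorm r c R"] s(1)
    by (simp add: power2_eq_square)
qed

section \<open>Rearrangement and residuals\<close>

text \<open>The rearrangement seen as a bijection of positions: \<open>b\<close> is the number of
  block columns and \<open>a'\<close>, \<open>b'\<close> are the dimensions of a block. Norms then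
  transfer by reindexing sums, and the Gaussian entries are merely relabelled.\<close>

definition ridx :: "nat \<Rightarrow> nat \<Rightarrow> nat \<Rightarrow> nat \<times> nat \<Rightarrow> nat \<times> nat" where
  "ridx b a' b' = (\<lambda>(r, k). ((r div b) * a' + k div b', (r mod b) * b' + k mod b'))"

lemma digit_less: "x < A \<Longrightarrow> y < B \<Longrightarrow> x * B + y < A * (B::nat)"
proof -
  assume "x < A" "y < B"
  then have "x * B + y < Suc x * B" by simp
  also have "\<dots> \<le> A * B" using \<open>x < A\<close> by (intro mult_le_mono1) simp
  finally show ?thesis .
qed

lemma bij_ridx:
  assumes "0 < b" "0 < a'" "0 < b'"
  shows "bij_betw (ridx b a' b') ({..<a*b} \<times> {..<a'*b'}) ({..<a*a'} \<times> {..<b*b'})"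
proof (rule bij_betw_byWitness[where f' = "\<lambda>(i, j). ((i div a') * b + j div b', (i mod a') * b' + j mod b')"])
  show "\<forall>x\<in>{..<a * b} \<times> {..<a' * b'}.
       (case ridx b a' b' x of (i, j) \<Rightarrow> (i div a' * b + j div b', i mod a' * b' + j mod b')) = x"
  proof (intro ballI)
    fix x assume x: "x \<in> {..<a * b} \<times> {..<a' * b'}"
    obtain r k where rk: "x = (r, k)" by fastforce
    have "k div b' < a'" using x rk by (auto simp: less_mult_imp_div_less)
    then show "(case ridx b a' b' x of (i, j) \<Rightarrow> (i div a' * b + j div b', i mod a' * b' + j mod b')) = x"
      using assms by (simp add: ridx_def rk)
  qed
  show "\<forall>x\<in>{..<a * a'} \<times> {..<b * b'}.
       ridx b a' b' (case x of (i, j) \<Rightarrow> (i div a' * b + j div b', i mod a' * b' + j mod b')) = x"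
  proof (intro ballI)
    fix x assume x: "x \<in> {..<a * a'} \<times> {..<b * b'}"
    obtain i j where ij: "x = (i, j)" by fastforce
    have "j div b' < b" using x ij by (auto simp: less_mult_imp_div_less)
    then show "ridx b a' b' (case x of (i, j) \<Rightarrow> (i div a' * b + j div b', i mod a' * b' + j mod b')) = x"
      using assms by (simp add: ridx_def ij)
  qed
  show "ridx b a' b' ` ({..<a * b} \<times> {..<a' * b'}) \<subseteq> {..<a * a'} \<times> {..<b * b'}"
    using assms by (auto simp: ridx_def less_mult_imp_div_less intro!: digit_less)
  show "(\<lambda>(i, j). (i div a' * b + j div b', i mod a' * b' + j mod b')) ` ({..<a * a'} \<times> {..<b * b'})
    \<subseteq> {..<a * b} \<times> {..<a' * b'}"
    using assms by (auto simp: less_mult_imp_div_less intro!: digit_less)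
qed

definition ridxc :: "nat \<Rightarrow> nat \<Rightarrow> nat \<Rightarrow> nat \<Rightarrow> nat \<times> nat \<Rightarrow> nat \<times> nat" where
  "ridxc M N m n = ridx (2^n) (2^(M-m)) (2^(N-n))"

lemma rearr_ridxc: "rearr M N m n C r k = (case ridxc M N m n (r, k) of (i, j) \<Rightarrow> C i j)"
  by (simp add: rearr_def vecr_def ridxc_def ridx_def)

lemma bij_ridxc:
  assumes "m \<le> M" "n \<le> N"
  shows "bij_betw (ridxc M N m n) ({..<2^(m+n)} \<times> {..<2^(M+N-m-n)}) ({..<2^M} \<times> {..<2^N})"
proof -
  have "M + N - m - n = (M - m) + (N - n)" using assms by simp
  moreover have "(2::nat)^m * 2^(M-m) = 2^M" "(2::nat)^n * 2^(N-n) = 2^N"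
    using assms by (simp_all flip: power_add)
  ultimately show ?thesis using bij_ridx[of "2^n" "2^(M-m)" "2^(N-n)" "2^m"]
    by (simp add: ridxc_def power_add)
qed

lemma sum_rearr:
  assumes "m \<le> M" "n \<le> N"
  shows "(\<Sum>r<2^(m+n). \<Sum>k<2^(M+N-m-n). f (ridxc M N m n (r, k))) = (\<Sum>i<2^M. \<Sum>j<2^N. f (i, j))"
  unfolding sum.cartesian_product
  using sum.reindex_bij_betw[OF bij_ridxc[OF assms], of f]
  by (simp add: case_prod_unfold)

lemma frob2_rearr:
  assumes "m \<le> M" "n \<le> N"
  shows "frob2 (2^(m+n)) (2^(M+N-m-n)) (rearr M N m n C) = frob2 (2^M) (2^N) C"
  unfolding frob2_def using sum_rearr[OF assms, of "\<lambda>(i,j). (C i j)\<^sup>2"]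
  by (simp add: rearr_ridxc case_prod_unfold)

text \<open>Unlike the fit itself, this expression does not mention the singular vectors picked by
  \<open>SOME\<close>, whose dependence on \<open>Y\<close> need not be measurable.\<close>

definition resid :: "nat \<Rightarrow> nat \<Rightarrow> nat \<Rightarrow> nat \<Rightarrow> rmat \<Rightarrow> real" where
  "resid M N m n Y = frob2 (2^M) (2^N) Y - (opnorm (2^(m+n)) (2^(M+N-m-n)) (rearr M N m n Y))\<^sup>2"

lemma rearr_kron:
  assumes "m \<le> M" "n \<le> N" "r < 2^(m+n)" "k < 2^(M+N-m-n)"
  shows "rearr M N m n (kron (2^(M-m)) (2^(N-n)) A B) r k
    = A (r div 2^n) (r mod 2^n) * B (k div 2^(N-n)) (k mod 2^(N-n))"
proof -
  have e: "M + N - m - n = (M - m) + (N - n)" using assms by simp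
  have "k div 2^(N-n) < 2^(M-m)" using assms(4) unfolding e power_add by (rule less_mult_imp_div_less)
  then show ?thesis by (simp add: rearr_def vecr_def kron_def)
qed

text \<open>Two descriptions of the residual are needed together: as the fitting error it enters the
  criterion, and as the distance to some rank one matrix with unit factors it can be bounded from
  below block by block.\<close>

lemma frob2_fit_ex_rank_one:
  assumes "m \<le> M" "n \<le> N"
  shows "\<exists>s u v. sqnorm (2^(m+n)) u = 1 \<and> sqnorm (2^(M+N-m-n)) v = 1 \<and>
    resid M N m n Y = frob2 (2^M) (2^N) (\<lambda>i j. Y i j - fit M N m n Y i j) \<and>
    resid M N m n Y = frob2 (2^(m+n)) (2^(M+N-m-n)) (\<lambda>i j. rearr M N m n Y i j - s * (u i * v j))"
proof -
  define R where "R = rearr M N m n Y"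
  define p q :: nat where "p = 2^(m+n)" and "q = 2^(M+N-m-n)"
  have pq: "0 < p" "0 < q" by (simp_all add: p_def q_def)
  obtain u v where uv: "lead_sv p q R = (u, v)" by fastforce
  note s = lead_sv_spec[OF pq(2,1) uv]
  have fit: "fit M N m n Y = (\<lambda>i j. opnorm p q R * kron (2^(M-m)) (2^(N-n)) (unvec (2^n) u) (unvec (2^(N-n)) v) i j)"
    using uv by (simp add: fit_def Let_def R_def p_def q_def)
  have rf: "rearr M N m n (\<lambda>i j. Y i j - fit M N m n Y i j) r k = R r k - opnorm p q R * (u r * v k)"
    if "r < p" "k < q" for r k
  proof -
    have "rearr M N m n (kron (2^(M-m)) (2^(N-n)) (unvec (2^n) u) (unvec (2^(N-n)) v)) r k = u r * v k"
      using rearr_kron[OF assms that[unfolded p_def q_def], of "unvec (2^n) u" "unvec (2^(N-n)) v"]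
      by (simp only: unvec_def div_mult_mod_eq)
    then show ?thesis by (simp only: fit R_def rearr_def vecr_def)
  qed
  have "frob2 (2^M) (2^N) (\<lambda>i j. Y i j - fit M N m n Y i j)
    = frob2 p q (\<lambda>i j. R i j - opnorm p q R * (u i * v j))"
    unfolding frob2_rearr[OF assms, symmetric] p_def[symmetric] q_def[symmetric]
    by (simp add: frob2_def rf)
  moreover have "frob2 p q (\<lambda>i j. R i j - opnorm p q R * (u i * v j)) = resid M N m n Y"
    unfolding frob2_lead_sv_diff[OF pq(2,1) uv] resid_def
    by (simp only: R_def p_def q_def frob2_rearr[OF assms])
  ultimately show ?thesis using s(1,2)
    by (intro exI[of _ "opnorm p q R"] exI[of _ u] exI[of _ v]) (simp add: p_def q_def R_def)
qed

lemma IC_resid: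
  assumes "m \<le> M" "n \<le> N"
  shows "IC \<kappa> M N m n Y = 2^(M+N) * ln (resid M N m n Y) + \<kappa> * (2^(m+n) + 2^(M+N-m-n))"
  using frob2_fit_ex_rank_one[OF assms, of Y] by (auto simp: IC_def)

lemma resid_nonneg: "m \<le> M \<Longrightarrow> n \<le> N \<Longrightarrow> 0 \<le> resid M N m n Y"
  unfolding resid_def frob2_rearr[symmetric, of m M n N] using opnorm_sq_le_frob2 by simp

section \<open>Distance of a two by two block from rank one\<close>

lemma sq_diff_scaled_le:
  fixes s t w :: real
  assumes "\<bar>w\<bar> \<le> 1"
  shows "(s - w * t)\<^sup>2 \<le> 2 * (s\<^sup>2 + t\<^sup>2)"
proof -
  have "w\<^sup>2 * t\<^sup>2 \<le> t\<^sup>2" using assms by (simp add: abs_square_le_1 mult_left_le_one_le)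
  then have "(w * t)\<^sup>2 \<le> t\<^sup>2" by (simp add: power_mult_distrib)
  moreover have "0 \<le> (s + w * t)\<^sup>2" by simp
  ultimately show ?thesis by (simp add: power2_sum power2_diff)
qed

text \<open>If the rank one matrix annihilates \<open>(v1, -v0)\<close>, the error is at least the squared length of the
  image of that unit direction, hence at least the distance of one column to the line of the other.
  The four candidates only fix which entry of the block is isolated.\<close>
lemma two_by_two_rank_one:
  fixes a b c d :: real
  shows "\<exists>e\<in>{a - b*c/d, c - a*d/b, b - a*d/c, d - b*c/a}.
    e\<^sup>2 \<le> 4 * ((a - u0 * v0)\<^sup>2 + (b - u0 * v1)\<^sup>2 + (c - u1 * v0)\<^sup>2 + (d - u1 * v1)\<^sup>2)"
proof -
  \<comment> \<open>The unknown \<open>z\<close> is eliminated with the multiplier of modulus at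
    most one, that is, by dividing by the larger of \<open>b\<close> and \<open>d\<close>. If
    \<open>d = 0\<close> in the first case then \<open>b = 0\<close> as well, and since division by
    zero gives zero the identity persists.\<close>
  have cols: "\<exists>e\<in>{a - b*c/d, c - a*d/b}. e\<^sup>2 \<le> 2 * ((a - z * b)\<^sup>2 + (c - z * d)\<^sup>2)" for a b c d z :: real
  proof (cases "\<bar>b\<bar> \<le> \<bar>d\<bar>")
    case True
    have eq: "a - b*c/d = (a - z * b) - (b/d) * (c - z * d)" using True by (cases "d = 0") (auto simp: field_simps)
    have le: "\<bar>b/d\<bar> \<le> 1" using True by (cases "d = 0") auto
    have "(a - b*c/d)\<^sup>2 \<le> 2 * ((a - z * b)\<^sup>2 + (c - z * d)\<^sup>2)"
      unfolding eq by (rule sq_diff_scaled_le[OF le])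
    then show ?thesis by blast
  next
    case False
    then have b: "b \<noteq> 0" by auto
    have eq: "c - a*d/b = (c - z * d) - (d/b) * (a - z * b)" using b by (auto simp: field_simps)
    have le: "\<bar>d/b\<bar> \<le> 1" using False b by auto
    have "(c - a*d/b)\<^sup>2 \<le> 2 * ((c - z * d)\<^sup>2 + (a - z * b)\<^sup>2)"
      unfolding eq by (rule sq_diff_scaled_le[OF le])
    then have "(c - a*d/b)\<^sup>2 \<le> 2 * ((a - z * b)\<^sup>2 + (c - z * d)\<^sup>2)" by (simp only: add.commute)
    then show ?thesis by blast
  qed
  have main: "\<exists>e\<in>{a - b*c/d, c - a*d/b}. e\<^sup>2 \<le> 4 * ((a - u0 * v0)\<^sup>2 + (b - u0 * v1)\<^sup>2 + (c - u1 * v0)\<^sup>2 + (d - u1 * v1)\<^sup>2)"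
    if v: "\<bar>v0\<bar> \<le> \<bar>v1\<bar>" for a b c d u0 u1 v0 v1 :: real
  proof -
    \<comment> \<open>The image of the direction \<open>(1, - z)\<close> is free of the rank one
      part; \<open>v1 = 0\<close> forces \<open>v0 = 0\<close>, and then \<open>z = 0\<close>. The
      two eliminations cost a factor 2 each, hence the 4.\<close>
    define z where "z = v0 / v1"
    have z: "\<bar>z\<bar> \<le> 1" "v0 = z * v1" using v by (cases "v1 = 0"; simp add: z_def)+
    have row: "(s - z * t)\<^sup>2 \<le> 2 * ((s - w * v0)\<^sup>2 + (t - w * v1)\<^sup>2)" for s t w
    proof -
      have eq: "s - z * t = (s - w * v0) - z * (t - w * v1)" by (simp add: z(2) algebra_simps)
      show ?thesis unfolding eq by (rule sq_diff_scaled_le[OF z(1)])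
    qed
    obtain e where "e\<in>{a - b*c/d, c - a*d/b}" "e\<^sup>2 \<le> 2 * ((a - z * b)\<^sup>2 + (c - z * d)\<^sup>2)"
      using cols[of a b c d z] by blast
    moreover have "2 * ((a - z * b)\<^sup>2 + (c - z * d)\<^sup>2) \<le> 4 * ((a - u0 * v0)\<^sup>2 + (b - u0 * v1)\<^sup>2 + (c - u1 * v0)\<^sup>2 + (d - u1 * v1)\<^sup>2)"
    proof -
      have aux: "A \<le> 2 * (P1 + P2) \<Longrightarrow> B \<le> 2 * (P3 + P4) \<Longrightarrow> 2 * (A + B) \<le> 4 * (P1 + P2 + P3 + P4)"
        for A B P1 P2 P3 P4 :: real by simp
      show ?thesis by (rule aux[OF row row])
    qed
    ultimately show ?thesis by (meson order_trans)
  qed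
  show ?thesis
  proof (cases "\<bar>v0\<bar> \<le> \<bar>v1\<bar>")
    case True
    from main[OF this, of a b c d u0 u1] show ?thesis by blast
  next
    case False
    then have "\<bar>v1\<bar> \<le> \<bar>v0\<bar>" by simp
    from main[OF this, of b a d c u0 u1] obtain e where e: "e\<in>{b - a*d/c, d - b*c/a}"
      "e\<^sup>2 \<le> 4 * ((b - u0 * v1)\<^sup>2 + (a - u0 * v0)\<^sup>2 + (d - u1 * v1)\<^sup>2 + (c - u1 * v0)\<^sup>2)" by blast
    then have "e\<^sup>2 \<le> 4 * ((a - u0 * v0)\<^sup>2 + (b - u0 * v1)\<^sup>2 + (c - u1 * v0)\<^sup>2 + (d - u1 * v1)\<^sup>2)" by simp
    then show ?thesis using e(1) by blast
  qed
qed

section \<open>A net for quadratic forms\<close>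

lemma sum_half_power_abs_int_le: "(\<Sum>k\<in>{-int n..int n}. (1/2::real) ^ nat \<bar>k\<bar>) \<le> 3"
proof -
  have "(\<Sum>k\<in>{-int n..int n}. (1/2::real) ^ nat \<bar>k\<bar>) = 3 - 2 * (1/2)^n"
  proof (induction n)
    case (Suc n)
    have "{- int (Suc n)..int (Suc n)} = insert (- int (Suc n)) (insert (int (Suc n)) {-int n..int n})"
      by auto
    moreover have "int (Suc n) \<notin> {-int n..int n}" "- int (Suc n) \<notin> insert (int (Suc n)) {-int n..int n}" by auto
    ultimately show ?case using Suc by (simp add: nat_add_distrib)
  qed simp
  then show ?thesis by simp
qed

text \<open>The net consists of the points of a cubic lattice of mesh \<open>1 / (4 sqrt p)\<close> in the ball;
  weighting lattice points with \<open>2 powr - l1\<close> turns counting them into a product of geometric sums.\<close>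
lemma ball_net_exists:
  assumes p: "0 < p"
  shows "\<exists>X. finite X \<and> X \<noteq> {} \<and> card X \<le> 48^p \<and> (\<forall>x\<in>X. sqnorm p x \<le> 1) \<and>
     (\<forall>y. sqnorm p y \<le> 1 \<longrightarrow> (\<exists>x\<in>X. sqnorm p (\<lambda>i. y i - x i) \<le> 1/16))"
proof -
  \<comment> \<open>Rounding changes each coordinate by at most \<open>1 / K\<close>, hence squared
    distances by at most \<open>p / K^2 = 1/16\<close>.\<close>
  define K :: real where "K = 4 * sqrt (real p)"
  have K: "K > 0" using p by (simp add: K_def)
  have K2: "K\<^sup>2 = 16 * real p" by (simp add: K_def power_mult_distrib)
  define P where "P = PiE {..<p} (\<lambda>_. {-int (4*p)..int (4*p)})"
  define Z where "Z = {z\<in>P. (\<Sum>i<p. \<bar>z i\<bar>) \<le> int (4*p) \<and> sqnorm p (\<lambda>i. real_of_int (z i) / K) \<le> 1}"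
  define X where "X = (\<lambda>z i. real_of_int (z i) / K) ` Z"
  have fP: "finite P" unfolding P_def by (intro finite_PiE) auto
  have fZ: "finite Z" unfolding Z_def using fP by simp
  \<comment> \<open>The constant is \<open>48 = 2^4 * 3\<close>: points of \<open>l1\<close> norm at
    most \<open>4 * p\<close> have weight at least \<open>2 powr (- 4 * p)\<close>, and each
    coordinate sums to at most 3.\<close>
  have "real (card Z) \<le> (\<Sum>z\<in>Z. 2^(4*p) * (\<Prod>i<p. (1/2) ^ nat \<bar>z i\<bar>))"
  proof -
    have "(1::real) \<le> 2^(4*p) * (\<Prod>i<p. (1/2) ^ nat \<bar>z i\<bar>)" if "z \<in> Z" for z
    proof -
      have "int (\<Sum>i<p. nat \<bar>z i\<bar>) \<le> int (4*p)" using that by (simp add: Z_def)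
      then have s: "(\<Sum>i<p. nat \<bar>z i\<bar>) \<le> 4*p" by linarith
      have "(\<Prod>i<p. (1/2::real) ^ nat \<bar>z i\<bar>) = (1/2) ^ (\<Sum>i<p. nat \<bar>z i\<bar>)" by (simp add: power_sum)
      also have "\<dots> \<ge> (1/2) ^ (4*p)" using s by (intro power_decreasing) auto
      finally have "(1/2::real)^(4*p) \<le> (\<Prod>i<p. (1/2) ^ nat \<bar>z i\<bar>)" .
      then have "2^(4*p) * (1/2::real)^(4*p) \<le> 2^(4*p) * (\<Prod>i<p. (1/2) ^ nat \<bar>z i\<bar>)" by (intro mult_left_mono) auto
      moreover have "2^(4*p) * (1/2::real)^(4*p) = 1" by (simp flip: power_mult_distrib)
      ultimately show ?thesis by simp
    qed
    then show ?thesis using sum_mono[of Z "\<lambda>_. 1::real"] by simp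
  qed
  also have "\<dots> \<le> (\<Sum>z\<in>P. 2^(4*p) * (\<Prod>i<p. (1/2) ^ nat \<bar>z i\<bar>))"
    by (intro sum_mono2 fP) (auto simp: Z_def intro!: mult_nonneg_nonneg prod_nonneg)
  also have "\<dots> = 2^(4*p) * (\<Prod>i<p. \<Sum>k\<in>{-int (4*p)..int (4*p)}. (1/2) ^ nat \<bar>k\<bar>)"
    unfolding P_def by (subst prod_sum_PiE) (auto simp: sum_distrib_left)
  also have "\<dots> \<le> 2^(4*p) * (\<Prod>i<p. 3)"
    by (intro mult_left_mono prod_mono conjI sum_half_power_abs_int_le sum_nonneg) auto
  also have "\<dots> = (48::real)^p" by (simp add: power_mult flip: power_mult_distrib)
  finally have "real (card Z) \<le> real (48^p)" by simp
  then have cZ: "card Z \<le> 48^p" by (simp only: of_nat_le_iff)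
  have dense: "\<exists>x\<in>X. sqnorm p (\<lambda>i. y i - x i) \<le> 1/16" if y: "sqnorm p y \<le> 1" for y
  proof -
    \<comment> \<open>Rounding goes towards zero, so that no coordinate grows and the lattice point
      stays in the ball. Outside the dimension the value must be \<open>undefined\<close> for
      membership in the extensional product \<open>P\<close>.\<close>
    define z where "z = (\<lambda>i. if i < p then (if y i \<ge> 0 then \<lfloor>y i * K\<rfloor> else - \<lfloor>- y i * K\<rfloor>) else undefined)"
    have az: "real_of_int \<bar>z i\<bar> \<le> \<bar>y i\<bar> * K" "\<bar>y i - z i / K\<bar> \<le> 1 / K" if "i < p" for i
    proof -
      have f: "0 \<le> t \<Longrightarrow> real_of_int \<bar>\<lfloor>t\<rfloor>\<bar> \<le> t" for t :: real by simp
      show "real_of_int \<bar>z i\<bar> \<le> \<bar>y i\<bar> * K" using that K f[of "y i * K"] f[of "- y i * K"]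
        by (auto simp: z_def mult_nonpos_nonneg)
      have g: "\<bar>t - of_int \<lfloor>t\<rfloor>\<bar> \<le> 1" for t :: real by linarith
      have "\<bar>t + of_int \<lfloor>- t\<rfloor>\<bar> \<le> 1" for t :: real by linarith
      then have "\<bar>y i * K - z i\<bar> \<le> 1" using that g[of "y i * K"] by (simp add: z_def)
      moreover have "\<bar>y i - z i / K\<bar> = \<bar>y i * K - z i\<bar> / K" using K by (simp add: field_simps abs_divide)
      ultimately show "\<bar>y i - z i / K\<bar> \<le> 1 / K" using K by (simp add: divide_right_mono)
    qed
    have z2: "(\<Sum>i<p. (real_of_int (z i))\<^sup>2) \<le> K\<^sup>2 * sqnorm p y"
      unfolding sqnorm_def sum_distrib_left
    proof (rule sum_mono)
      fix i assume "i \<in> {..<p}"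
      then have "\<bar>real_of_int (z i)\<bar> \<le> \<bar>y i\<bar> * K" using az(1)[of i] by simp
      then have "(real_of_int (z i))\<^sup>2 \<le> (\<bar>y i\<bar> * K)\<^sup>2" by (metis abs_ge_zero power2_abs power_mono)
      then show "(real_of_int (z i))\<^sup>2 \<le> K\<^sup>2 * (y i)\<^sup>2" by (simp add: power_mult_distrib ac_simps)
    qed
    also have "\<dots> \<le> K\<^sup>2 * 1" by (intro mult_left_mono y) auto
    finally have z16: "(\<Sum>i<p. (real_of_int (z i))\<^sup>2) \<le> K\<^sup>2" by simp
    have sq1: "sqnorm p (\<lambda>i. real_of_int (z i) / K) \<le> 1"
      using z16 K by (simp add: sqnorm_def power_divide flip: sum_divide_distrib)
    \<comment> \<open>Cauchy--Schwarz turns length at most \<open>K = 4 * sqrt p\<close> into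
      \<open>l1\<close> norm at most \<open>4 * p\<close>, the bound used for counting.\<close>
    have "(\<Sum>i<p. 1 * real_of_int \<bar>z i\<bar>)\<^sup>2 \<le> (\<Sum>i<p. 1\<^sup>2) * (\<Sum>i<p. (real_of_int \<bar>z i\<bar>)\<^sup>2)" by (rule Cauchy_Schwarz_ineq_sum)
    also have "\<dots> \<le> real p * (16 * real p)" using z16 by (simp add: K2 mult_left_mono)
    also have "\<dots> = (4 * real p)\<^sup>2" by (simp add: power2_eq_square)
    finally have "(\<Sum>i<p. real_of_int \<bar>z i\<bar>)\<^sup>2 \<le> (4 * real p)\<^sup>2" by simp
    then have "(\<Sum>i<p. real_of_int \<bar>z i\<bar>) \<le> 4 * real p" by (rule power2_le_imp_le) simp
    then have "real_of_int (\<Sum>i<p. \<bar>z i\<bar>) \<le> real_of_int (int (4*p))" by simp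
    then have l1: "(\<Sum>i<p. \<bar>z i\<bar>) \<le> int (4*p)" by (simp only: of_int_le_iff)
    have "- int (4*p) \<le> z i \<and> z i \<le> int (4*p)" if "i < p" for i
    proof -
      have "\<bar>z i\<bar> \<le> (\<Sum>i<p. \<bar>z i\<bar>)" using that by (intro member_le_sum) auto
      then show ?thesis using l1 by linarith
    qed
    moreover have "z i = undefined" if "\<not> i < p" for i using that by (simp add: z_def)
    ultimately have "z \<in> P" unfolding P_def by (simp add: PiE_iff extensional_def)
    then have "z \<in> Z" using l1 sq1 by (simp add: Z_def)
    then have "(\<lambda>i. real_of_int (z i) / K) \<in> X" by (simp add: X_def)
    moreover have "sqnorm p (\<lambda>i. y i - real_of_int (z i) / K) \<le> (\<Sum>i<p. (1/K)\<^sup>2)"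
      unfolding sqnorm_def
    proof (rule sum_mono)
      fix i assume "i \<in> {..<p}"
      then have "\<bar>y i - z i / K\<bar>\<^sup>2 \<le> (1/K)\<^sup>2" using az(2)[of i] by (intro power_mono) auto
      then show "(y i - z i / K)\<^sup>2 \<le> (1/K)\<^sup>2" by simp
    qed
    moreover have "(\<Sum>i<p. (1/K)\<^sup>2) = 1/16" using p by (simp add: power_divide K2)
    ultimately show ?thesis by (intro bexI[of _ "\<lambda>i. real_of_int (z i) / K"]) simp_all
  qed
  have "sqnorm p (\<lambda>_. 0) \<le> 1" by simp
  from dense[OF this] have "X \<noteq> {}" by auto
  moreover have "card X \<le> 48^p" using card_image_le[OF fZ] cZ unfolding X_def by (rule order_trans)
  moreover have "\<forall>x\<in>X. sqnorm p x \<le> 1" by (auto simp: X_def Z_def)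
  moreover have "finite X" using fZ by (simp add: X_def)
  ultimately show ?thesis using dense by blast
qed

text \<open>Let \<open>B\<close> be the supremum of the form over the ball. Moving to the nearest
  net point changes the form by at most \<open>B / 2\<close>, so \<open>B \<le> m + B / 2\<close>.
  This absorption requires \<open>B\<close> to be finite, which a crude bound by the sum of all
  coefficients supplies.\<close>

lemma quadform_net_bound:
  fixes C :: rmat and p :: nat
  defines "b \<equiv> \<lambda>y. \<Sum>i<p. \<Sum>j<p. C i j * y i * y j"
  assumes net: "\<And>y. sqnorm p y \<le> 1 \<Longrightarrow> \<exists>x\<in>X. sqnorm p (\<lambda>i. y i - x i) \<le> 1/16"
    and X1: "\<And>x. x \<in> X \<Longrightarrow> sqnorm p x \<le> 1"
    and m: "\<And>x. x \<in> X \<Longrightarrow> \<bar>b x\<bar> \<le> m"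
    and y: "sqnorm p y \<le> 1"
  shows "\<bar>b y\<bar> \<le> 2 * m"
proof -
  define S where "S = {\<bar>b x\<bar> | x. sqnorm p x \<le> 1}"
  define B where "B = Sup S"
  have bS: "bdd_above S"
  proof (rule bdd_aboveI)
    fix t assume "t \<in> S"
    then obtain x where x: "sqnorm p x \<le> 1" "t = \<bar>b x\<bar>" by (auto simp: S_def)
    have xi: "\<bar>x i\<bar> \<le> 1" if "i < p" for i
    proof -
      have "(x i)\<^sup>2 \<le> sqnorm p x" unfolding sqnorm_def using that by (intro member_le_sum) auto
      then show ?thesis using x abs_square_le_1 by force
    qed
    have "\<bar>b x\<bar> \<le> (\<Sum>i<p. \<Sum>j<p. \<bar>C i j * x i * x j\<bar>)" unfolding b_def
      by (intro order_trans[OF sum_abs] sum_mono sum_abs)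
    also have "\<dots> \<le> (\<Sum>i<p. \<Sum>j<p. \<bar>C i j\<bar>)"
    proof (intro sum_mono)
      fix i j assume "i \<in> {..<p}" "j \<in> {..<p}"
      then have "\<bar>x i\<bar> * \<bar>x j\<bar> \<le> 1" using mult_mono[of "\<bar>x i\<bar>" 1 "\<bar>x j\<bar>" 1] xi by simp
      then show "\<bar>C i j * x i * x j\<bar> \<le> \<bar>C i j\<bar>"
        using mult_left_mono[of "\<bar>x i\<bar> * \<bar>x j\<bar>" 1 "\<bar>C i j\<bar>"] by (simp add: abs_mult mult.assoc)
    qed
    finally show "t \<le> (\<Sum>i<p. \<Sum>j<p. \<bar>C i j\<bar>)" using x by simp
  qed
  have up: "\<bar>b x\<bar> \<le> B" if "sqnorm p x \<le> 1" for x
    unfolding B_def using that by (intro cSup_upper bS) (auto simp: S_def)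
  have bsc: "b (\<lambda>i. t * x i) = t\<^sup>2 * b x" for t x
    by (simp add: b_def sum_distrib_left power2_eq_square ac_simps)
  have upb: "\<bar>b x\<bar> \<le> B * sqnorm p x" for x
  proof (cases "sqnorm p x = 0")
    case True
    then have "x i = 0" if "i < p" for i using that by (rule sqnorm_eq_0D)
    then show ?thesis using True by (simp add: b_def)
  next
    case False
    define s where "s = sqnorm p x"
    have s: "s > 0" using False sqnorm_nonneg[of p x] unfolding s_def by linarith
    have "sqnorm p (\<lambda>i. (1 / sqrt s) * x i) \<le> 1" unfolding sqnorm_scale using s by (simp add: power_divide s_def)
    from up[OF this] have "\<bar>b x\<bar> / s \<le> B" unfolding bsc using s by (simp add: power_divide abs_mult abs_divide)
    then show ?thesis using s by (simp add: s_def field_simps)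
  qed
  \<comment> \<open>Polarisation; both orders of the mixed product occur, so the coefficients may be
    asymmetric. The weights 4 and 1/2 balance the distance 1/4 to the net against the length 2 of
    \<open>y + x\<close>: the two new vectors have total squared length at most 4, and division by 8
    yields the factor 1/2.\<close>
  have diff: "b y - b x = (b (\<lambda>i. 4 * (y i - x i) + (y i + x i) / 2) - b (\<lambda>i. 4 * (y i - x i) - (y i + x i) / 2)) / 8" for x y
    unfolding b_def sum_subtractf[symmetric] sum_divide_distrib
    by (intro sum.cong refl) (simp add: field_simps)
  have half: "\<bar>b z\<bar> \<le> m + B / 2" if z: "sqnorm p z \<le> 1" for z
  proof -
    obtain x where x: "x \<in> X" "sqnorm p (\<lambda>i. z i - x i) \<le> 1/16" using net[OF z] by blast
    define U V where "U = (\<lambda>i. 4 * (z i - x i) + (z i + x i) / 2)" and "V = (\<lambda>i. 4 * (z i - x i) - (z i + x i) / 2)"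
    have par: "sqnorm p U + sqnorm p V = 2 * 16 * sqnorm p (\<lambda>i. z i - x i) + 2 / 4 * sqnorm p (\<lambda>i. z i + x i)"
      unfolding U_def V_def sqnorm_def sum_distrib_left sum.distrib[symmetric]
      by (intro sum.cong refl) (simp add: field_simps power2_eq_square)
    have "sqnorm p (\<lambda>i. z i + x i) \<le> 2 * sqnorm p z + 2 * sqnorm p x"
    proof -
      have "(s + t)\<^sup>2 \<le> 2 * s\<^sup>2 + 2 * t\<^sup>2" for s t :: real
        using sum_squares_bound[of s t] by (simp add: power2_sum)
      then show ?thesis unfolding sqnorm_def sum_distrib_left sum.distrib[symmetric] by (intro sum_mono)
    qed
    then have "sqnorm p (\<lambda>i. z i + x i) \<le> 4" using z X1[OF x(1)] by linarith
    then have UV: "sqnorm p U + sqnorm p V \<le> 4" using par x(2) by linarith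
    have "\<bar>b z - b x\<bar> \<le> (\<bar>b U\<bar> + \<bar>b V\<bar>) / 8" unfolding diff[of z x] U_def[symmetric] V_def[symmetric]
      using abs_triangle_ineq4[of "b U" "b V"] by simp
    also have "\<dots> \<le> (B * sqnorm p U + B * sqnorm p V) / 8" by (intro divide_right_mono add_mono upb) simp
    also have "\<dots> = B * (sqnorm p U + sqnorm p V) / 8" by (simp add: algebra_simps)
    also have "\<dots> \<le> B * 4 / 8" using UV up[of "\<lambda>_. 0"] by (intro divide_right_mono mult_left_mono) auto
    finally show ?thesis using m[OF x(1)] by linarith
  qed
  have "S \<noteq> {}" using y by (auto simp: S_def)
  then have "B \<le> m + B / 2" unfolding B_def by (rule cSup_least) (use half in \<open>auto simp: S_def B_def\<close>)
  then show ?thesis using up[OF y] by linarith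
qed

section \<open>Gaussian exponential moments\<close>

abbreviation snorm :: "real measure" where
  "snorm \<equiv> density lborel (\<lambda>x. ennreal (std_normal_density x))"

definition gauss :: "'i set \<Rightarrow> ('i \<Rightarrow> real) measure" where
  "gauss I = PiM I (\<lambda>_. snorm)"

lemma prob_space_snorm: "prob_space snorm"
  by (rule prob_space_normal_density) simp

lemma prob_space_gauss: "prob_space (gauss I)"
  unfolding gauss_def by (intro prob_space_PiM prob_space_snorm)

lemma measurable_gauss_component [measurable]:
  "i \<in> I \<Longrightarrow> (\<lambda>E. E i) \<in> borel_measurable (gauss I)"
  unfolding gauss_def using measurable_component_singleton[of i I "\<lambda>_. snorm"]
  by (simp cong: measurable_cong_sets)

lemma distr_gauss_component: "i \<in> I \<Longrightarrow> distr (gauss I) borel (\<lambda>E. E i) = snorm"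
proof -
  assume i: "i \<in> I"
  have "distr (gauss I) borel (\<lambda>E. E i) = distr (gauss I) snorm (\<lambda>E. E i)" by (rule distr_cong) auto
  also have "\<dots> = snorm" unfolding gauss_def by (rule distr_PiM_component[OF prob_space_snorm i])
  finally show ?thesis .
qed

lemma distributed_gauss_component:
  assumes "i \<in> I"
  shows "distributed (gauss I) lborel (\<lambda>E. E i) std_normal_density"
proof -
  have "distr (gauss I) lborel (\<lambda>E. E i) = distr (gauss I) borel (\<lambda>E. E i)" by (rule distr_cong) auto
  then show ?thesis unfolding distributed_def using assms distr_gauss_component[OF assms] by simp
qed

lemma indep_vars_gauss:
  "prob_space.indep_vars (gauss I) (\<lambda>_. borel) (\<lambda>i E. E i) I"
proof (cases "I = {}")
  case True
  interpret prob_space "gauss I" by (rule prob_space_gauss)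
  show ?thesis unfolding indep_vars_def indep_sets_def using True by auto
next
  case False
  interpret prob_space "gauss I" by (rule prob_space_gauss)
  have "distr (gauss I) (PiM I (\<lambda>_. borel)) (\<lambda>x. \<lambda>i\<in>I. x i) = distr (gauss I) (gauss I) (\<lambda>x. x)"
    by (intro distr_cong) (auto simp: gauss_def space_PiM intro!: sets_PiM_cong restrict_ext)
  also have "\<dots> = PiM I (\<lambda>i. distr (gauss I) borel (\<lambda>E. E i))"
    unfolding distr_id by (subst gauss_def, intro PiM_cong) (auto simp: distr_gauss_component)
  finally show ?thesis
    by (subst indep_vars_iff_distr_eq_PiM'[OF False]) auto
qed

text \<open>Completing the square turns the integrand into a multiple of the normal density with
  variance \<open>s^2 = 1 / (1 - 2 * b)\<close> and mean \<open>a * s^2\<close>. Subtracting 1 from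
  the square cancels the first-order part of \<open>ln s\<close>; what is left is quadratic in
  \<open>b\<close>, and the range of \<open>b\<close> is where the second-order bound for the
  logarithm applies.\<close>

lemma nn_integral_snorm_exp_le:
  fixes a b :: real
  assumes b: "\<bar>b\<bar> \<le> 1/4"
  shows "(\<integral>\<^sup>+x. ennreal (exp (a * x + b * (x\<^sup>2 - 1))) \<partial>snorm) \<le> ennreal (exp (4 * b\<^sup>2 + a\<^sup>2))"
proof -
  define s where "s = 1 / sqrt (1 - 2 * b)"
  have pos: "1 - 2 * b > 0" using b by auto
  have s: "s > 0" "s\<^sup>2 = 1 / (1 - 2 * b)" using pos by (auto simp: s_def power_divide)
  define c where "c = exp (- b + a\<^sup>2 * s\<^sup>2 / 2) * s"
  have c: "c \<ge> 0" using s by (simp add: c_def)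
  have eq: "std_normal_density x * exp (a * x + b * (x\<^sup>2 - 1)) = c * normal_density (a * s\<^sup>2) s x" for x
  proof -
    have b': "b = (1 - 1 / s\<^sup>2) / 2" using s(2) by simp
    have "- x\<^sup>2 / 2 + (a * x + b * (x\<^sup>2 - 1)) = (- b + a\<^sup>2 * s\<^sup>2 / 2) + (- (x - a * s\<^sup>2)\<^sup>2 / (2 * s\<^sup>2))"
      using s(1) unfolding b' by (simp add: field_simps power2_eq_square)
    then have "exp (- x\<^sup>2 / 2) * exp (a * x + b * (x\<^sup>2 - 1)) = exp (- b + a\<^sup>2 * s\<^sup>2 / 2) * exp (- (x - a * s\<^sup>2)\<^sup>2 / (2 * s\<^sup>2))"
      by (simp only: exp_add[symmetric])
    then show ?thesis using s(1) by (simp add: c_def std_normal_density_def normal_density_def real_sqrt_mult field_simps)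
  qed
  have "(\<integral>\<^sup>+x. ennreal (exp (a * x + b * (x\<^sup>2 - 1))) \<partial>snorm) =
      (\<integral>\<^sup>+x. ennreal (std_normal_density x) * ennreal (exp (a * x + b * (x\<^sup>2 - 1))) \<partial>lborel)"
    by (subst nn_integral_density) auto
  also have "\<dots> = (\<integral>\<^sup>+x. ennreal c * ennreal (normal_density (a * s\<^sup>2) s x) \<partial>lborel)"
    using c by (intro nn_integral_cong) (simp add: eq flip: ennreal_mult)
  also have "\<dots> = ennreal c * (\<integral>\<^sup>+x. ennreal (normal_density (a * s\<^sup>2) s x) \<partial>lborel)"
    by (rule nn_integral_cmult) auto
  also have "(\<integral>\<^sup>+x. ennreal (normal_density (a * s\<^sup>2) s x) \<partial>lborel) = 1"
    using s by (simp add: nn_integral_eq_integral)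
  also have "ennreal c * 1 \<le> ennreal (exp (4 * b\<^sup>2 + a\<^sup>2))"
  proof -
    have "\<bar>ln (1 + (- 2 * b)) - (- 2 * b)\<bar> \<le> 2 * (- 2 * b)\<^sup>2"
      by (rule abs_ln_one_plus_x_minus_x_bound) (use b in auto)
    then have "- (2 * b) - 8 * b\<^sup>2 \<le> ln (1 - 2 * b)" by (simp add: abs_le_iff)
    then have "ln s \<le> b + 4 * b\<^sup>2" using pos by (simp add: s_def ln_div ln_sqrt power2_eq_square)
    then have "s \<le> exp (b + 4 * b\<^sup>2)" using s(1) by (metis exp_le_cancel_iff exp_ln)
    moreover have "s\<^sup>2 \<le> 2" using b pos by (simp add: s(2) field_simps)
    then have "a\<^sup>2 * s\<^sup>2 / 2 \<le> a\<^sup>2" using mult_left_mono[of "s\<^sup>2" 2 "a\<^sup>2"] by simp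
    ultimately have "c \<le> exp (- b + a\<^sup>2) * exp (b + 4 * b\<^sup>2)"
      unfolding c_def using s by (intro mult_mono) auto
    also have "\<dots> = exp (4 * b\<^sup>2 + a\<^sup>2)" by (simp flip: exp_add)
    finally show ?thesis by (simp add: ennreal_leI)
  qed
  finally show ?thesis .
qed

lemma distributed_gauss_linear:
  fixes c :: "'k \<Rightarrow> real"
  assumes "inj_on f K" "f ` K \<subseteq> I" "finite K" and v: "0 < (\<Sum>k\<in>K. (c k)\<^sup>2)"
  shows "distributed (gauss I) lborel (\<lambda>E. \<Sum>k\<in>K. c k * E (f k)) (normal_density 0 (sqrt (\<Sum>k\<in>K. (c k)\<^sup>2)))"
proof -
  interpret prob_space "gauss I" by (rule prob_space_gauss)
  \<comment> \<open>Summands with coefficient zero are dropped, since a degenerate normal variable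
    has no density.\<close>
  define L where "L = {k\<in>K. c k \<noteq> 0}"
  have L: "finite L" "L \<subseteq> K" "inj_on f L" using assms by (auto simp: L_def inj_on_def)
  define d where "d = (\<lambda>i. c (the_inv_into L f i))"
  have d: "d (f k) = c k" if "k \<in> L" for k using that L(3) by (simp add: d_def the_inv_into_f_f)
  have sL: "(\<Sum>k\<in>K. (c k)\<^sup>2) = (\<Sum>i\<in>f ` L. (\<bar>d i\<bar> * 1)\<^sup>2)"
    "(\<lambda>E. \<Sum>k\<in>K. c k * E (f k)) = (\<lambda>E. \<Sum>i\<in>f ` L. 0 + d i * E i)"
  proof -
    have "(\<Sum>k\<in>K. (c k)\<^sup>2) = (\<Sum>k\<in>L. (c k)\<^sup>2)"
      using assms(3) by (intro sum.mono_neutral_right) (auto simp: L_def)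
    then show "(\<Sum>k\<in>K. (c k)\<^sup>2) = (\<Sum>i\<in>f ` L. (\<bar>d i\<bar> * 1)\<^sup>2)"
      by (simp add: sum.reindex[OF L(3)] d)
    have "(\<Sum>k\<in>K. c k * E (f k)) = (\<Sum>k\<in>L. c k * E (f k))" for E
      using assms(3) by (intro sum.mono_neutral_right) (auto simp: L_def)
    then show "(\<lambda>E. \<Sum>k\<in>K. c k * E (f k)) = (\<lambda>E. \<Sum>i\<in>f ` L. 0 + d i * E i)"
      by (intro ext) (simp add: sum.reindex[OF L(3)] d)
  qed
  have ne: "f ` L \<noteq> {}" using v sL by auto
  have sub: "f ` L \<subseteq> I" using assms(2) L(2) by auto
  have dn: "d i \<noteq> 0" if "i \<in> f ` L" for i using that d by (auto simp: L_def)
  have "indep_vars (\<lambda>_. borel) (\<lambda>i E. E i) (f ` L)"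
    by (rule indep_vars_subset[OF indep_vars_gauss sub])
  then have "indep_vars (\<lambda>_. borel) (\<lambda>i E. 0 + d i * E i) (f ` L)"
    by (rule indep_vars_compose2[where Y = "\<lambda>i x. 0 + d i * x"]) auto
  moreover have "distributed (gauss I) lborel (\<lambda>E. 0 + d i * E i) (normal_density (0 + d i * 0) (\<bar>d i\<bar> * 1))" if "i \<in> f ` L" for i
    by (rule normal_density_affine[OF distributed_gauss_component]) (use that sub dn in auto)
  ultimately have "distributed (gauss I) lborel (\<lambda>E. \<Sum>i\<in>f ` L. 0 + d i * E i)
     (normal_density (\<Sum>i\<in>f ` L. 0 + d i * 0) (sqrt (\<Sum>i\<in>f ` L. (\<bar>d i\<bar> * 1)\<^sup>2)))"
    using L(1) ne dn by (intro sum_indep_normal) auto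
  then show ?thesis unfolding sL by simp
qed

lemma nn_integral_gauss_linear_exp_le:
  fixes c :: "'k \<Rightarrow> real"
  assumes "inj_on f K" "f ` K \<subseteq> I" "finite K"
  defines "v \<equiv> (\<Sum>k\<in>K. (c k)\<^sup>2)"
  assumes b: "\<bar>b\<bar> * v \<le> 1/4"
  shows "(\<integral>\<^sup>+E. ennreal (exp (a * (\<Sum>k\<in>K. c k * E (f k)) + b * ((\<Sum>k\<in>K. c k * E (f k))\<^sup>2 - v))) \<partial>gauss I)
    \<le> ennreal (exp (4 * b\<^sup>2 * v\<^sup>2 + a\<^sup>2 * v))"
proof (cases "v = 0")
  case True
  then have c: "c k = 0" if "k \<in> K" for k using that assms(3) by (simp add: v_def sum_nonneg_eq_0_iff)
  interpret prob_space "gauss I" by (rule prob_space_gauss)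
  show ?thesis using True c emeasure_space_1 by simp
next
  case False
  interpret prob_space "gauss I" by (rule prob_space_gauss)
  have "0 \<le> v" unfolding v_def by (intro sum_nonneg) auto
  then have v: "v > 0" using False by simp
  define w where "w = (\<lambda>E. \<Sum>k\<in>K. c k * E (f k))"
  have d: "distributed (gauss I) lborel w (normal_density 0 (sqrt v))"
    unfolding w_def v_def by (rule distributed_gauss_linear) (use assms v in auto)
  have d': "distributed (gauss I) lborel (\<lambda>E. (w E - 0) / sqrt v) std_normal_density"
    by (rule normal_standard_normal_convert[THEN iffD1, OF _ d]) (use v in auto)
  have "(\<integral>\<^sup>+E. ennreal (exp (a * w E + b * ((w E)\<^sup>2 - v))) \<partial>gauss I)
    = (\<integral>\<^sup>+E. ennreal (exp ((a * sqrt v) * ((w E - 0) / sqrt v) + (b * v) * (((w E - 0) / sqrt v)\<^sup>2 - 1))) \<partial>gauss I)"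
    using v by (intro nn_integral_cong) (simp add: power_divide field_simps)
  also have "\<dots> = (\<integral>\<^sup>+x. ennreal (std_normal_density x) * ennreal (exp ((a * sqrt v) * x + (b * v) * (x\<^sup>2 - 1))) \<partial>lborel)"
    by (subst distributed_nn_integral[OF d']) auto
  also have "\<dots> = (\<integral>\<^sup>+x. ennreal (exp ((a * sqrt v) * x + (b * v) * (x\<^sup>2 - 1))) \<partial>snorm)"
    by (subst nn_integral_density) auto
  also have "\<dots> \<le> ennreal (exp (4 * (b * v)\<^sup>2 + (a * sqrt v)\<^sup>2))"
    by (rule nn_integral_snorm_exp_le) (use b v in \<open>simp add: abs_mult\<close>)
  finally show ?thesis using v by (simp add: w_def power_mult_distrib mult.assoc)
qed

text \<open>The relabelling \<open>\<beta>\<close> of the noise lets one set of lemmas serve every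
  rearrangement and its transpose.\<close>

definition noisy :: "rmat \<Rightarrow> real \<Rightarrow> (nat \<times> nat \<Rightarrow> 'i) \<Rightarrow> ('i \<Rightarrow> real) \<Rightarrow> rmat" where
  "noisy T \<tau> \<beta> E = (\<lambda>i j. T i j + \<tau> * E (\<beta> (i, j)))"

text \<open>The deviation of the squared length of the image of \<open>x\<close> from its
  expectation: each of the \<open>q\<close> columns contributes the noise variance
  \<open>\<tau>\<^sup>2 * sqnorm p x\<close>.\<close>

definition sqdev :: "nat \<Rightarrow> nat \<Rightarrow> rmat \<Rightarrow> real \<Rightarrow> (nat \<times> nat \<Rightarrow> 'i) \<Rightarrow> ('i \<Rightarrow> real) \<Rightarrow> (nat \<Rightarrow> real) \<Rightarrow> real" where
  "sqdev p q T \<tau> \<beta> E x = sqnorm q (mv p (mtrans (noisy T \<tau> \<beta> E)) x)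
     - sqnorm q (mv p (mtrans T) x) - \<tau>\<^sup>2 * real q * sqnorm p x"

text \<open>Different columns use disjoint sets of noise entries, so this is a sum of independent
  terms, each a centred quadratic polynomial of one normal variable.\<close>

lemma sqdev_columns:
  "sqdev p q T \<tau> \<beta> E x = (\<Sum>j<q. 2 * \<tau> * mv p (mtrans T) x j * (\<Sum>i<p. x i * E (\<beta> (i, j)))
     + \<tau>\<^sup>2 * ((\<Sum>i<p. x i * E (\<beta> (i, j)))\<^sup>2 - sqnorm p x))"
proof -
  have "mv p (mtrans (noisy T \<tau> \<beta> E)) x j = mv p (mtrans T) x j + \<tau> * (\<Sum>i<p. x i * E (\<beta> (i, j)))" for j
    by (simp add: mv_def mtrans_def noisy_def algebra_simps sum.distrib sum_distrib_left)
  then show ?thesis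
    by (simp add: sqdev_def sqnorm_def[of q] power2_sum algebra_simps sum.distrib sum_subtractf power_mult_distrib)
qed

text \<open>The form in which the net bound applies; its coefficients are random but do not depend
  on \<open>x\<close>.\<close>

lemma sqdev_quadform:
  "sqdev p q T \<tau> \<beta> E x = (\<Sum>i<p. \<Sum>k<p. ((\<Sum>j<q. noisy T \<tau> \<beta> E i j * noisy T \<tau> \<beta> E k j - T i j * T k j)
     - (if i = k then \<tau>\<^sup>2 * real q else 0)) * x i * x k)"
proof -
  have sq: "sqnorm q (mv p (mtrans R) x) = (\<Sum>i<p. \<Sum>k<p. (\<Sum>j<q. R i j * R k j) * x i * x k)" for R
  proof -
    have "sqnorm q (mv p (mtrans R) x) = (\<Sum>j<q. \<Sum>i<p. \<Sum>k<p. R i j * R k j * x i * x k)"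
      unfolding sqnorm_def mv_def mtrans_def power2_eq_square sum_product
      by (intro sum.cong refl) (simp add: ac_simps)
    also have "\<dots> = (\<Sum>i<p. \<Sum>j<q. \<Sum>k<p. R i j * R k j * x i * x k)" by (rule sum.swap)
    also have "\<dots> = (\<Sum>i<p. \<Sum>k<p. \<Sum>j<q. R i j * R k j * x i * x k)" by (intro sum.cong refl sum.swap)
    finally show ?thesis by (simp add: sum_distrib_right)
  qed
  have "\<tau>\<^sup>2 * real q * sqnorm p x = (\<Sum>i<p. \<Sum>k<p. (if i = k then \<tau>\<^sup>2 * real q else 0) * x i * x k)"
  proof -
    have "(\<Sum>k<p. (if i = k then \<tau>\<^sup>2 * real q else 0) * x i * x k) = \<tau>\<^sup>2 * real q * (x i)\<^sup>2" if "i < p" for i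
    proof -
      have "(\<Sum>k<p. (if i = k then \<tau>\<^sup>2 * real q else 0) * x i * x k)
        = (\<Sum>k<p. if i = k then \<tau>\<^sup>2 * real q * x i * x k else 0)" by (intro sum.cong) auto
      also have "\<dots> = \<tau>\<^sup>2 * real q * (x i)\<^sup>2" using that by (simp add: power2_eq_square)
      finally show ?thesis .
    qed
    then show ?thesis by (simp add: sqnorm_def sum_distrib_left)
  qed
  then show ?thesis unfolding sqdev_def sq
    by (simp add: sum_subtractf left_diff_distrib)
qed

lemma borel_measurable_sqdev [measurable]:
  assumes "\<beta> ` ({..<p} \<times> {..<q}) \<subseteq> I"
  shows "(\<lambda>E. sqdev p q T \<tau> \<beta> E x) \<in> borel_measurable (gauss I)"
  unfolding sqdev_columns using assms
  by (intro borel_measurable_sum borel_measurable_add borel_measurable_times borel_measurable_diff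
      borel_measurable_power borel_measurable_const measurable_gauss_component) auto

lemma prod_le_ennreal:
  fixes f g :: "'a \<Rightarrow> ennreal"
  assumes "\<And>i. i \<in> A \<Longrightarrow> f i \<le> g i"
  shows "prod f A \<le> prod g A"
  using assms by (induction A rule: infinite_finite_induct) (auto intro: mult_mono)

text \<open>Independence of the columns makes the exponential moment a product of one-dimensional
  ones with \<open>a = 2 * \<theta> * \<tau> * r j\<close> and
  \<open>b = \<theta> * \<tau>^2\<close>. The squares of the \<open>r j\<close> add up to the
  squared length of the signal's image, which gives the term with \<open>\<rho>\<close>.\<close>

lemma nn_integral_exp_sqdev_le:
  assumes inj: "inj_on \<beta> ({..<p} \<times> {..<q})" and sub: "\<beta> ` ({..<p} \<times> {..<q}) \<subseteq> I"
    and x: "sqnorm p x \<le> 1" and \<rho>: "sqnorm q (mv p (mtrans T) x) \<le> \<rho>\<^sup>2"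
    and \<theta>: "\<bar>\<theta>\<bar> * \<tau>\<^sup>2 \<le> 1/4"
  shows "(\<integral>\<^sup>+E. ennreal (exp (\<theta> * sqdev p q T \<tau> \<beta> E x)) \<partial>gauss I)
    \<le> ennreal (exp (4 * real q * \<theta>\<^sup>2 * \<tau>^4 + 4 * \<theta>\<^sup>2 * \<tau>\<^sup>2 * \<rho>\<^sup>2))"
proof -
  interpret prob_space "gauss I" by (rule prob_space_gauss)
  define r where "r = mv p (mtrans T) x"
  define v where "v = sqnorm p x"
  have v: "0 \<le> v" "v \<le> 1" using x by (auto simp: v_def)
  define w where "w = (\<lambda>j y. \<Sum>i<p. x i * y (\<beta> (i, j)))" for j :: nat and y :: "'a \<Rightarrow> real"
  define g where "g = (\<lambda>j y. ennreal (exp ((2 * \<theta> * \<tau> * r j) * w j y + (\<theta> * \<tau>\<^sup>2) * ((w j y)\<^sup>2 - v))))"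
  define K where "K = (\<lambda>j. \<beta> ` ({..<p} \<times> {j}))"
  have Ksub: "K j \<subseteq> I" if "j < q" for j using sub that by (auto simp: K_def)
  have disj: "disjoint_family_on K {..<q}"
    using inj by (auto simp: disjoint_family_on_def K_def inj_on_def)
  have ind: "indep_vars (\<lambda>j. PiM (K j) (\<lambda>_. borel)) (\<lambda>j \<omega>. \<lambda>i\<in>K j. \<omega> i) {..<q}"
    by (rule indep_vars_restrict[OF indep_vars_gauss _ disj]) (use Ksub in auto)
  have wm: "w j \<in> borel_measurable (PiM (K j) (\<lambda>_. borel))" if "j < q" for j
    unfolding w_def by (intro borel_measurable_sum borel_measurable_times borel_measurable_const measurable_component_singleton)
       (auto simp: K_def)
  have gm: "g j \<in> borel_measurable (PiM (K j) (\<lambda>_. borel))" if "j < q" for j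
    unfolding g_def using wm[OF that] by measurable
  have res: "g j (\<lambda>i\<in>K j. \<omega> i) = g j \<omega>" for j \<omega>
  proof -
    have "w j (\<lambda>i\<in>K j. \<omega> i) = w j \<omega>" unfolding w_def by (intro sum.cong refl) (auto simp: K_def)
    then show ?thesis by (simp add: g_def)
  qed
  have ind2: "indep_vars (\<lambda>_. borel) (\<lambda>j \<omega>. g j \<omega>) {..<q}"
    using indep_vars_compose2[OF ind, of g "\<lambda>_. borel"] gm by (simp add: res)
  have "(\<integral>\<^sup>+E. ennreal (exp (\<theta> * sqdev p q T \<tau> \<beta> E x)) \<partial>gauss I) = (\<integral>\<^sup>+E. (\<Prod>j<q. g j E) \<partial>gauss I)"
  proof (rule nn_integral_cong)
    fix E
    have "\<theta> * sqdev p q T \<tau> \<beta> E x = (\<Sum>j<q. (2 * \<theta> * \<tau> * r j) * w j E + (\<theta> * \<tau>\<^sup>2) * ((w j E)\<^sup>2 - v))"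
      unfolding sqdev_columns r_def w_def v_def by (subst sum_distrib_left, intro sum.cong refl) (simp add: distrib_left mult.assoc mult.left_commute)
    then show "ennreal (exp (\<theta> * sqdev p q T \<tau> \<beta> E x)) = (\<Prod>j<q. g j E)"
      by (simp add: exp_sum g_def prod_ennreal)
  qed
  also have "\<dots> = (\<Prod>j<q. \<integral>\<^sup>+E. g j E \<partial>gauss I)"
    by (rule indep_vars_nn_integral[OF _ ind2]) auto
  also have "\<dots> \<le> (\<Prod>j<q. ennreal (exp (4 * (\<theta> * \<tau>\<^sup>2)\<^sup>2 * v\<^sup>2 + (2 * \<theta> * \<tau> * r j)\<^sup>2 * v)))"
  proof (rule prod_le_ennreal)
    fix j assume j: "j \<in> {..<q}"
    have "\<bar>\<theta> * \<tau>\<^sup>2\<bar> * v \<le> (1/4) * 1"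
      using \<theta> v by (intro mult_mono) (auto simp: abs_mult)
    then have b: "\<bar>\<theta> * \<tau>\<^sup>2\<bar> * (\<Sum>i<p. (x i)\<^sup>2) \<le> 1/4" by (simp add: v_def sqnorm_def)
    have "inj_on (\<lambda>i. \<beta> (i, j)) {..<p}" using inj j by (auto simp: inj_on_def)
    from nn_integral_gauss_linear_exp_le[OF this _ _ b, where I = I and a = "2 * \<theta> * \<tau> * r j"]
    show "(\<integral>\<^sup>+E. g j E \<partial>gauss I) \<le> ennreal (exp (4 * (\<theta> * \<tau>\<^sup>2)\<^sup>2 * v\<^sup>2 + (2 * \<theta> * \<tau> * r j)\<^sup>2 * v))"
      using sub j by (auto simp: g_def w_def v_def sqnorm_def image_subset_iff)
  qed
  also have "\<dots> = ennreal (exp (\<Sum>j<q. 4 * (\<theta> * \<tau>\<^sup>2)\<^sup>2 * v\<^sup>2 + (2 * \<theta> * \<tau> * r j)\<^sup>2 * v))"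
    by (simp add: prod_ennreal exp_sum)
  also have "(\<Sum>j<q. 4 * (\<theta> * \<tau>\<^sup>2)\<^sup>2 * v\<^sup>2 + (2 * \<theta> * \<tau> * r j)\<^sup>2 * v) =
      4 * real q * \<theta>\<^sup>2 * \<tau>^4 * v\<^sup>2 + 4 * \<theta>\<^sup>2 * \<tau>\<^sup>2 * sqnorm q r * v"
    by (simp add: sum.distrib sqnorm_def sum_distrib_left sum_distrib_right power_mult_distrib ac_simps flip: power_mult)
  also have "\<dots> \<le> 4 * real q * \<theta>\<^sup>2 * \<tau>^4 * 1 + 4 * \<theta>\<^sup>2 * \<tau>\<^sup>2 * \<rho>\<^sup>2 * 1"
    using v \<rho> by (intro add_mono mult_mono) (auto simp: r_def power_le_one)
  finally show ?thesis by (simp add: ennreal_leI)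
qed

text \<open>Both the cross term and the centred noise term are handled at once by the net argument,
  applied to the quadratic form \<open>sqdev\<close>.\<close>
lemma sqdev_uniform_bound:
  fixes \<beta> :: "nat \<times> nat \<Rightarrow> 'i"
  assumes p: "0 < p" and inj: "inj_on \<beta> ({..<p} \<times> {..<q})" and sub: "\<beta> ` ({..<p} \<times> {..<q}) \<subseteq> I"
    and \<rho>: "\<And>x. sqnorm p x \<le> 1 \<Longrightarrow> sqnorm q (mv p (mtrans T) x) \<le> \<rho>\<^sup>2"
  obtains H where "H \<in> borel_measurable (gauss I)"
    "\<And>E x. sqnorm p x \<le> 1 \<Longrightarrow> \<bar>sqdev p q T \<tau> \<beta> E x\<bar> \<le> H E"
    "\<And>\<theta>. 0 \<le> \<theta> \<Longrightarrow> \<theta> * \<tau>\<^sup>2 \<le> 1/8 \<Longrightarrow> (\<integral>\<^sup>+E. ennreal (exp (\<theta> * H E)) \<partial>gauss I)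
      \<le> ennreal (2 * 48^p * exp (16 * real q * \<theta>\<^sup>2 * \<tau>^4 + 16 * \<theta>\<^sup>2 * \<tau>\<^sup>2 * \<rho>\<^sup>2))"
proof -
  obtain X where X: "finite X" "X \<noteq> {}" "card X \<le> 48^p" "\<And>x. x \<in> X \<Longrightarrow> sqnorm p x \<le> 1"
    "\<And>y. sqnorm p y \<le> 1 \<Longrightarrow> \<exists>x\<in>X. sqnorm p (\<lambda>i. y i - x i) \<le> 1/16"
    using ball_net_exists[OF p] by blast
  \<comment> \<open>The factor 2 is the loss of the net bound. It doubles the exponential parameter,
    hence 16 in place of 4 and 1/8 in place of 1/4. The maximum of absolute values is bounded by a
    sum over net points and both signs, hence \<open>2 * 48^p\<close>.\<close>
  define H where "H = (\<lambda>E. 2 * Max ((\<lambda>x. \<bar>sqdev p q T \<tau> \<beta> E x\<bar>) ` X))"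
  have Hm: "H \<in> borel_measurable (gauss I)"
  proof -
    have "(\<lambda>E. Max ((\<lambda>x. \<bar>sqdev p q T \<tau> \<beta> E x\<bar>) ` X)) \<in> borel_measurable (gauss I)"
      by (rule borel_measurable_Max[OF X(1)]) (rule borel_measurable_abs[OF borel_measurable_sqdev[OF sub]])
    then show ?thesis unfolding H_def by (rule borel_measurable_times[OF borel_measurable_const])
  qed
  have Hb: "\<bar>sqdev p q T \<tau> \<beta> E x\<bar> \<le> H E" if "sqnorm p x \<le> 1" for E x
    unfolding H_def sqdev_quadform
    by (rule quadform_net_bound[OF X(5,4) _ that]) (use X(1) in \<open>auto intro!: Max_ge simp: sqdev_quadform[symmetric]\<close>)
  show ?thesis
  proof (rule that[OF Hm Hb])
    fix \<theta> :: real assume \<theta>: "0 \<le> \<theta>" "\<theta> * \<tau>\<^sup>2 \<le> 1/8"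
    define B where "B = exp (16 * real q * \<theta>\<^sup>2 * \<tau>^4 + 16 * \<theta>\<^sup>2 * \<tau>\<^sup>2 * \<rho>\<^sup>2)"
    have one: "(\<integral>\<^sup>+E. ennreal (exp (s * sqdev p q T \<tau> \<beta> E x)) \<partial>gauss I) \<le> ennreal B"
      if "x \<in> X" "\<bar>s\<bar> = 2 * \<theta>" for x s
    proof -
      have "s\<^sup>2 = 4 * \<theta>\<^sup>2" using that(2) by (metis power2_abs power_mult_distrib four_x_squared)
      moreover have "\<bar>s\<bar> * \<tau>\<^sup>2 \<le> 1/4" using that(2) \<theta> by simp
      ultimately show ?thesis unfolding B_def
        using nn_integral_exp_sqdev_le[OF inj sub X(4)[OF that(1)] \<rho>[OF X(4)[OF that(1)]], where \<theta> = s and \<tau> = \<tau>]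
        by (simp add: ac_simps)
    qed
    have "ennreal (exp (\<theta> * H E)) \<le> (\<Sum>x\<in>X. ennreal (exp ((2 * \<theta>) * sqdev p q T \<tau> \<beta> E x)) + ennreal (exp ((- 2 * \<theta>) * sqdev p q T \<tau> \<beta> E x)))" for E
    proof -
      have "Max ((\<lambda>x. \<bar>sqdev p q T \<tau> \<beta> E x\<bar>) ` X) \<in> (\<lambda>x. \<bar>sqdev p q T \<tau> \<beta> E x\<bar>) ` X" using X by (intro Max_in) auto
      then obtain x where x: "x \<in> X" "H E = 2 * \<bar>sqdev p q T \<tau> \<beta> E x\<bar>" by (auto simp: H_def)
      let ?f = "\<lambda>x. ennreal (exp ((2 * \<theta>) * sqdev p q T \<tau> \<beta> E x)) + ennreal (exp ((- 2 * \<theta>) * sqdev p q T \<tau> \<beta> E x))"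
      have "ennreal (exp (\<theta> * H E)) \<le> ?f x"
        unfolding x(2) by (cases "sqdev p q T \<tau> \<beta> E x \<ge> 0") (auto simp: ac_simps add_increasing add_increasing2)
      also have "?f x \<le> sum ?f X" using x X by (intro member_le_sum) auto
      finally show ?thesis .
    qed
    then have "(\<integral>\<^sup>+E. ennreal (exp (\<theta> * H E)) \<partial>gauss I) \<le>
      (\<integral>\<^sup>+E. (\<Sum>x\<in>X. ennreal (exp ((2 * \<theta>) * sqdev p q T \<tau> \<beta> E x)) + ennreal (exp ((- 2 * \<theta>) * sqdev p q T \<tau> \<beta> E x))) \<partial>gauss I)"
      by (intro nn_integral_mono) auto
    also have "\<dots> = (\<Sum>x\<in>X. (\<integral>\<^sup>+E. ennreal (exp ((2 * \<theta>) * sqdev p q T \<tau> \<beta> E x)) \<partial>gauss I) + (\<integral>\<^sup>+E. ennreal (exp ((- 2 * \<theta>) * sqdev p q T \<tau> \<beta> E x)) \<partial>gauss I))"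
    proof -
      have m: "(\<lambda>E. ennreal (exp (s * sqdev p q T \<tau> \<beta> E x))) \<in> borel_measurable (gauss I)" for s x
      proof -
        have "(\<lambda>t::real. ennreal (exp (s * t))) \<in> borel_measurable borel" by measurable
        then show ?thesis by (rule measurable_compose[OF borel_measurable_sqdev[OF sub]])
      qed
      show ?thesis
        by (subst nn_integral_sum, rule borel_measurable_add[OF m m]) (intro sum.cong refl nn_integral_add m)
    qed
    also have "\<dots> \<le> (\<Sum>x\<in>X. ennreal B + ennreal B)"
      using \<theta> by (intro sum_mono add_mono one) auto
    also have "\<dots> = ennreal (2 * real (card X) * B)"
      by (simp add: B_def ennreal_plus[symmetric] ennreal_of_nat_eq_real_of_nat ennreal_mult[symmetric] del: ennreal_plus)
    also have "\<dots> \<le> ennreal (2 * 48^p * B)"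
    proof -
      have "real (card X) \<le> 48^p" using X(3) by (metis of_nat_le_iff of_nat_numeral of_nat_power)
      then show ?thesis by (intro ennreal_leI mult_mono) (auto simp: B_def)
    qed
    finally show "(\<integral>\<^sup>+E. ennreal (exp (\<theta> * H E)) \<partial>gauss I)
      \<le> ennreal (2 * 48^p * exp (16 * real q * \<theta>\<^sup>2 * \<tau>^4 + 16 * \<theta>\<^sup>2 * \<tau>\<^sup>2 * \<rho>\<^sup>2))" unfolding B_def .
  qed
qed

section \<open>Measurability of the operator norm and small-ball estimates\<close>

text \<open>Integer lists form a countable type, so a union over these vectors is a countable union
  of measurable sets.\<close>

definition ivec :: "int list \<Rightarrow> nat \<Rightarrow> real" where
  "ivec zs i = (if i < length zs then real_of_int (zs ! i) else 0)"

lemma floor_scaled_tendsto: "(\<lambda>n. real_of_int \<lfloor>real (Suc n) * x\<rfloor> / real (Suc n)) \<longlonglongrightarrow> x"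
proof (rule LIMSEQ_I)
  fix r :: real assume "0 < r"
  then obtain k where k: "inverse (real (Suc k)) < r" using reals_Archimedean by blast
  have "norm (real_of_int \<lfloor>real (Suc n) * x\<rfloor> / real (Suc n) - x) < r" if "k \<le> n" for n
  proof -
    have "\<bar>real_of_int \<lfloor>real (Suc n) * x\<rfloor> - real (Suc n) * x\<bar> \<le> 1" by linarith
    then have "\<bar>real_of_int \<lfloor>real (Suc n) * x\<rfloor> - real (Suc n) * x\<bar> / real (Suc n) \<le> inverse (real (Suc n))"
      by (simp add: divide_simps)
    moreover have "real_of_int \<lfloor>real (Suc n) * x\<rfloor> / real (Suc n) - x = (real_of_int \<lfloor>real (Suc n) * x\<rfloor> - real (Suc n) * x) / real (Suc n)"
      by (simp add: field_simps)
    moreover have "inverse (real (Suc n)) \<le> inverse (real (Suc k))" using that by (simp add: field_simps)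
    ultimately show ?thesis using k by (simp only: real_norm_def abs_divide)
  qed
  then show "\<exists>no. \<forall>n\<ge>no. norm (real_of_int \<lfloor>real (Suc n) * x\<rfloor> / real (Suc n) - x) < r" by blast
qed

text \<open>By homogeneity and density, integer vectors suffice to witness a strict lower bound for the
  operator norm; this makes it measurable.\<close>
lemma opnorm_gt_iff:
  assumes a: "0 \<le> a"
  shows "a < opnorm r c R \<longleftrightarrow> (\<exists>zs. a\<^sup>2 * sqnorm c (ivec zs) < sqnorm r (mv c R (ivec zs)))"
proof
  assume "a < opnorm r c R"
  have "sqnorm c (\<lambda>_. 0) \<le> 1" by simp
  then have "{sqrt (sqnorm r (mv c R x)) | x. sqnorm c x \<le> 1} \<noteq> {}" by blast
  from less_cSup_iff[OF this opnorm_set_bdd, of a] \<open>a < opnorm r c R\<close>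
  obtain x where x: "sqnorm c x \<le> 1" "a < sqrt (sqnorm r (mv c R x))" unfolding opnorm_def by auto
  have "a\<^sup>2 * sqnorm c x \<le> a\<^sup>2" using x(1) mult_left_mono[of "sqnorm c x" 1 "a\<^sup>2"] by simp
  also have "a\<^sup>2 < (sqrt (sqnorm r (mv c R x)))\<^sup>2" using x(2) a by (intro power_strict_mono) auto
  finally have lt: "0 < sqnorm r (mv c R x) - a\<^sup>2 * sqnorm c x" by simp
  define y where "y = (\<lambda>n i. real_of_int \<lfloor>real (Suc n) * x i\<rfloor> / real (Suc n))"
  have y: "(\<lambda>n. y n i) \<longlonglongrightarrow> x i" for i unfolding y_def by (rule floor_scaled_tendsto)
  have "(\<lambda>n. sqnorm r (mv c R (y n)) - a\<^sup>2 * sqnorm c (y n)) \<longlonglongrightarrow> sqnorm r (mv c R x) - a\<^sup>2 * sqnorm c x"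
    unfolding sqnorm_def mv_def by (intro tendsto_intros y)
  from order_tendstoD(1)[OF this lt] obtain n where n: "0 < sqnorm r (mv c R (y n)) - a\<^sup>2 * sqnorm c (y n)"
    by (auto simp: eventually_sequentially)
  define zs where "zs = map (\<lambda>i. \<lfloor>real (Suc n) * x i\<rfloor>) [0..<c]"
  have z: "y n i = (1 / real (Suc n)) * ivec zs i" if "i < c" for i
    using that by (simp add: y_def ivec_def zs_def)
  have e: "mv c R (y n) = (\<lambda>i. (1 / real (Suc n)) * mv c R (ivec zs) i)" "sqnorm c (y n) = (1 / real (Suc n))\<^sup>2 * sqnorm c (ivec zs)"
    using mv_cong[where y = "\<lambda>i. (1 / real (Suc n)) * ivec zs i", OF z] sqnorm_cong[where y = "\<lambda>i. (1 / real (Suc n)) * ivec zs i", OF z]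
    by (simp_all only: mv_scale sqnorm_scale)
  have "0 < (1 / real (Suc n))\<^sup>2 * (sqnorm r (mv c R (ivec zs)) - a\<^sup>2 * sqnorm c (ivec zs))"
    using n unfolding e sqnorm_scale by (simp add: algebra_simps)
  then have "0 < sqnorm r (mv c R (ivec zs)) - a\<^sup>2 * sqnorm c (ivec zs)"
    by (simp add: zero_less_mult_iff)
  then show "\<exists>zs. a\<^sup>2 * sqnorm c (ivec zs) < sqnorm r (mv c R (ivec zs))" by auto
next
  assume "\<exists>zs. a\<^sup>2 * sqnorm c (ivec zs) < sqnorm r (mv c R (ivec zs))"
  then obtain zs where "a\<^sup>2 * sqnorm c (ivec zs) < sqnorm r (mv c R (ivec zs))" by blast
  also have "\<dots> \<le> (opnorm r c R)\<^sup>2 * sqnorm c (ivec zs)" by (rule sqnorm_mv_le)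
  finally have "a\<^sup>2 < (opnorm r c R)\<^sup>2" using sqnorm_nonneg[of c "ivec zs"] by (simp add: mult_less_cancel_right)
  then show "a < opnorm r c R" by (rule power_less_imp_less_base) simp
qed

lemma borel_measurable_opnorm:
  assumes "\<And>i j. i < r \<Longrightarrow> j < c \<Longrightarrow> (\<lambda>\<omega>. R \<omega> i j) \<in> borel_measurable M"
  shows "(\<lambda>\<omega>. opnorm r c (R \<omega>)) \<in> borel_measurable M"
  unfolding borel_measurable_iff_greater
proof
  fix a :: real
  show "{\<omega> \<in> space M. a < opnorm r c (R \<omega>)} \<in> sets M"
  proof (cases "0 \<le> a")
    case True
    have m: "(\<lambda>\<omega>. sqnorm r (mv c (R \<omega>) x)) \<in> borel_measurable M" for x
      unfolding sqnorm_def mv_def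
      by (intro borel_measurable_sum borel_measurable_power borel_measurable_times borel_measurable_const assms) auto
    have s: "{\<omega> \<in> space M. a\<^sup>2 * sqnorm c (ivec zs) < sqnorm r (mv c (R \<omega>) (ivec zs))} \<in> sets M" for zs
      by (rule borel_measurable_less[OF borel_measurable_const m])
    have "(\<Union>zs. {\<omega> \<in> space M. a\<^sup>2 * sqnorm c (ivec zs) < sqnorm r (mv c (R \<omega>) (ivec zs))}) \<in> sets M"
      by (rule sets.countable_UN'[OF countableI_type]) (use s in blast)
    moreover have "{\<omega> \<in> space M. a < opnorm r c (R \<omega>)} = (\<Union>zs. {\<omega> \<in> space M. a\<^sup>2 * sqnorm c (ivec zs) < sqnorm r (mv c (R \<omega>) (ivec zs))})"
      unfolding opnorm_gt_iff[OF True] by blast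
    ultimately show ?thesis by (simp only:)
  next
    case False
    then have "{\<omega> \<in> space M. a < opnorm r c (R \<omega>)} = space M"
      using less_le_trans[OF _ opnorm_nonneg] by (simp add: not_le)
    then show ?thesis by (simp only: sets.top)
  qed
qed

text \<open>The value at zero has to be infinite by fiat, because \<open>powr\<close> with base zero
  is zero. Exponent \<open>-1/2\<close> keeps the singularity integrable.\<close>

definition sing :: "real \<Rightarrow> ennreal" where
  "sing y = (if y = 0 then \<infinity> else ennreal (\<bar>y\<bar> powr (-1/2)))"

lemma measurable_sing [measurable]: "sing \<in> borel_measurable borel"
  unfolding sing_def by measurable

lemma nn_integral_sing_unit: "(\<integral>\<^sup>+y. indicator {-1..1} y * sing y \<partial>lborel) \<le> 4"
proof -
  define g where "g = (\<lambda>y::real. indicator {0..1} y * ennreal (y powr (-1/2)))"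
  have gm [measurable]: "g \<in> borel_measurable borel" unfolding g_def by measurable
  have "((\<lambda>y::real. y powr (-1/2)) has_integral (1 powr (-1/2 + 1) / (-1/2 + 1))) {0..1}"
    by (rule has_integral_powr_from_0) auto
  then have h: "((\<lambda>y::real. y powr (-1/2)) has_integral 2) {0..1}" by simp
  have "(\<integral>\<^sup>+y. indicator {0..1::real} y * ennreal (y powr (-1/2)) \<partial>lborel) = ennreal 2"
    using nn_integral_has_integral_lebesgue'[OF _ h] by (simp add: mult.commute)
  then have g2: "(\<integral>\<^sup>+y. g y \<partial>lborel) = 2" by (simp add: g_def)
  have "(\<integral>\<^sup>+y. g (0 + (-1) * y) \<partial>lborel) = 2"
    using nn_integral_real_affine[of g "-1" 0] gm g2 by simp
  then have g3: "(\<integral>\<^sup>+y. g (- y) \<partial>lborel) = 2" by simp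
  have "(\<integral>\<^sup>+y. indicator {-1..1} y * sing y \<partial>lborel) \<le> (\<integral>\<^sup>+y. g y + g (- y) \<partial>lborel)"
  proof (rule nn_integral_mono_AE)
    have "AE y in lborel. y \<noteq> (0::real)" by (rule AE_lborel_singleton)
    then show "AE y in lborel. indicator {-1..1} y * sing y \<le> g y + g (- y)"
    proof eventually_elim
      case (elim y)
      then show ?case by (cases "y > 0") (auto simp: g_def sing_def indicator_def)
    qed
  qed
  also have "\<dots> = 4" by (subst nn_integral_add) (auto simp: g2 g3)
  finally show ?thesis .
qed

text \<open>Within distance 1 of \<open>h\<close> the density is at most 1 and the singularity
  integrates to 4; further away the singular weight is at most 1. Uniformity in \<open>h\<close> is
  the point, since \<open>h\<close> will be random.\<close>

lemma nn_integral_snorm_sing_le: "(\<integral>\<^sup>+x. sing (x - h) \<partial>snorm) \<le> 5"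
proof -
  have d1: "std_normal_density x \<le> 1" for x
  proof -
    have "1 \<le> sqrt (2 * pi)" using pi_ge_two by simp
    then have "1 / sqrt (2 * pi) \<le> 1" by (simp add: divide_le_eq)
    moreover have "exp (- x\<^sup>2 / 2) \<le> 1" by simp
    ultimately show ?thesis unfolding std_normal_density_def by (intro mult_le_one) auto
  qed
  have "(\<integral>\<^sup>+x. sing (x - h) \<partial>snorm) = (\<integral>\<^sup>+x. ennreal (std_normal_density x) * sing (x - h) \<partial>lborel)"
    by (subst nn_integral_density) auto
  also have "\<dots> \<le> (\<integral>\<^sup>+x. ennreal (std_normal_density x) + indicator {-1..1} (x - h) * sing (x - h) \<partial>lborel)"
  proof (rule nn_integral_mono)
    fix x :: real
    show "ennreal (std_normal_density x) * sing (x - h) \<le> ennreal (std_normal_density x) + indicator {-1..1} (x - h) * sing (x - h)"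
    proof (cases "x - h \<in> {-1..1}")
      case True
      have "ennreal (std_normal_density x) * sing (x - h) \<le> 1 * sing (x - h)"
        using d1 by (intro mult_right_mono) auto
      then show ?thesis using True by (simp add: add_increasing)
    next
      case False
      then have "\<bar>x - h\<bar> \<ge> 1" "x \<noteq> h" by auto
      then have "\<bar>x - h\<bar> powr (-1/2) \<le> 1" by (simp add: powr_minus divide_simps ge_one_powr_ge_zero inverse_le_1_iff)
      then have "sing (x - h) \<le> 1" using \<open>x \<noteq> h\<close> by (simp add: sing_def)
      then have "ennreal (std_normal_density x) * sing (x - h) \<le> ennreal (std_normal_density x) * 1" by (intro mult_left_mono) auto
      then show ?thesis using False by simp
    qed
  qed
  also have "\<dots> = (\<integral>\<^sup>+x. ennreal (std_normal_density x) \<partial>lborel) + (\<integral>\<^sup>+x. indicator {-1..1} (x - h) * sing (x - h) \<partial>lborel)"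
    by (subst nn_integral_add) auto
  also have "(\<integral>\<^sup>+x. ennreal (std_normal_density x) \<partial>lborel) = 1" by (simp add: nn_integral_eq_integral)
  also have "(\<integral>\<^sup>+x. indicator {-1..1} (x - h) * sing (x - h) \<partial>lborel) = (\<integral>\<^sup>+x. indicator {-1..1} x * sing x \<partial>lborel)"
    using nn_integral_real_affine[of "\<lambda>x. indicator {-1..1} (x - h) * sing (x - h)" 1 h] by simp
  also have "1 + \<dots> \<le> 1 + 4" by (intro add_left_mono nn_integral_sing_unit)
  also have "1 + 4 = (5::ennreal)" by simp
  finally show ?thesis .
qed

lemma nn_integral_gauss_sing_le:
  assumes I: "finite I" "i \<in> I" and h: "h \<in> borel_measurable (gauss I)"
    and indep: "\<And>E y. h (E(i := y)) = h E"
  shows "(\<integral>\<^sup>+E. sing (E i - h E) \<partial>gauss I) \<le> 5"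
proof -
  interpret product_sigma_finite "\<lambda>_::'a. snorm"
    by (intro product_sigma_finite.intro prob_space_imp_sigma_finite prob_space_snorm)
  have I': "insert i (I - {i}) = I" using I by auto
  have m: "(\<lambda>E. sing (E i - h E)) \<in> borel_measurable (gauss I)"
    using h measurable_gauss_component[OF I(2)] by measurable
  have "(\<integral>\<^sup>+E. sing (E i - h E) \<partial>gauss I) = (\<integral>\<^sup>+E. \<integral>\<^sup>+y. sing ((E(i := y)) i - h (E(i := y))) \<partial>snorm \<partial>gauss (I - {i}))"
    using product_nn_integral_insert[of "I - {i}" i "\<lambda>E. sing (E i - h E)"] I m unfolding gauss_def I' by simp
  also have "\<dots> = (\<integral>\<^sup>+E. \<integral>\<^sup>+y. sing (y - h E) \<partial>snorm \<partial>gauss (I - {i}))" by (simp add: indep)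
  also have "\<dots> \<le> (\<integral>\<^sup>+E. 5 \<partial>gauss (I - {i}))" by (intro nn_integral_mono nn_integral_snorm_sing_le)
  also have "\<dots> = 5" using prob_space.emeasure_space_1[OF prob_space_gauss[of "I - {i}"]] by simp
  finally show ?thesis .
qed

text \<open>In the leading two by two block some Schur complement \<open>e i j\<close> is at most
  twice the square root of the residual. It equals \<open>\<tau>\<close> times one Gaussian entry
  shifted by a function of the other three, so the four singular weights, of mean at most 5 each,
  dominate the power \<open>-1/4\<close> of the residual.\<close>

lemma resid_small_ball:
  fixes \<beta> :: "nat \<times> nat \<Rightarrow> 'i"
  assumes I: "finite I" and pq: "2 \<le> p" "2 \<le> q"
    and inj: "inj_on \<beta> ({..<p} \<times> {..<q})" and sub: "\<beta> ` ({..<p} \<times> {..<q}) \<subseteq> I"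
    and \<tau>: "0 < \<tau>"
    and \<rho>: "\<And>E. \<exists>s u v. \<rho> E = frob2 p q (\<lambda>i j. noisy T \<tau> \<beta> E i j - s * (u i * v j))"
  shows "AE E in gauss I. 0 < \<rho> E"
    "(\<integral>\<^sup>+E. ennreal ((4 * \<rho> E / \<tau>\<^sup>2) powr (-1/4)) \<partial>gauss I) \<le> 20"
proof -
  define R where "R = noisy T \<tau> \<beta>"
  \<comment> \<open>On the indices 0 and 1 the terms \<open>1-i\<close> and \<open>1-j\<close>
    denote the other index, so one formula covers the four candidates.\<close>
  define h where "h = (\<lambda>i j E. (R E i (1-j) * R E (1-i) j / R E (1-i) (1-j) - T i j) / \<tau>)"
  define e where "e = (\<lambda>i j E. R E i j - R E i (1-j) * R E (1-i) j / R E (1-i) (1-j))"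
  define W where "W = (\<lambda>E. (\<Sum>i<2. \<Sum>j<2. sing (E (\<beta> (i, j)) - h i j E)))"
  have e_eq: "e i j E = \<tau> * (E (\<beta> (i, j)) - h i j E)" for i j E
    using \<tau> by (simp add: e_def h_def R_def noisy_def field_simps)
  have mem: "\<beta> (i, j) \<in> I" if "i < 2" "j < 2" for i j
    using sub pq that by (auto simp: image_subset_iff)
  have Rm: "(\<lambda>E. R E i j) \<in> borel_measurable (gauss I)" if "i < 2" "j < 2" for i j
    unfolding R_def noisy_def using measurable_gauss_component[OF mem[OF that]] by measurable
  have hm: "h i j \<in> borel_measurable (gauss I)" if "i < 2" "j < 2" for i j
  proof -
    have "1 - i < 2" "1 - j < 2" by auto
    then show ?thesis unfolding h_def using that
      by (intro borel_measurable_divide borel_measurable_diff borel_measurable_times borel_measurable_const Rm)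
  qed
  have hind: "h i j (E(\<beta> (i, j) := y)) = h i j E" if "i < 2" "j < 2" for i j E y
  proof -
    have "\<beta> (i', j') \<noteq> \<beta> (i, j)" if "i' < 2" "j' < 2" "(i', j') \<noteq> (i, j)" for i' j'
      using inj_on_eq_iff[OF inj, of "(i', j')" "(i, j)"] pq that \<open>i < 2\<close> \<open>j < 2\<close> by simp
    moreover have "(i, 1 - j) \<noteq> (i, j)" "(1 - i, j) \<noteq> (i, j)" "(1 - i, 1 - j) \<noteq> (i, j)"
      using that by (auto; presburger)+
    ultimately show ?thesis using that by (simp add: h_def R_def noisy_def)
  qed
  have sm: "(\<lambda>E. sing (E (\<beta> (i, j)) - h i j E)) \<in> borel_measurable (gauss I)" if "i < 2" "j < 2" for i j
    by (rule measurable_compose[OF borel_measurable_diff[OF measurable_gauss_component[OF mem[OF that]] hm[OF that]] measurable_sing])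
  have Wm: "W \<in> borel_measurable (gauss I)" unfolding W_def
    by (intro borel_measurable_sum sm) auto
  have "(\<integral>\<^sup>+E. W E \<partial>gauss I) = (\<Sum>i<2. \<Sum>j<2. \<integral>\<^sup>+E. sing (E (\<beta> (i, j)) - h i j E) \<partial>gauss I)"
    unfolding W_def by (subst nn_integral_sum, intro borel_measurable_sum sm, simp, simp, intro sum.cong refl nn_integral_sum sm) simp_all
  also have "\<dots> \<le> (\<Sum>i<(2::nat). \<Sum>j<(2::nat). 5)"
  proof (intro sum_mono)
    fix i j :: nat assume "i \<in> {..<2}" "j \<in> {..<2}"
    then have ij: "i < 2" "j < 2" by auto
    show "(\<integral>\<^sup>+E. sing (E (\<beta> (i, j)) - h i j E) \<partial>gauss I) \<le> 5"
      by (rule nn_integral_gauss_sing_le[OF I mem[OF ij] hm[OF ij] hind[OF ij]])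
  qed
  also have "\<dots> = (20::ennreal)" by simp
  finally have W20: "(\<integral>\<^sup>+E. W E \<partial>gauss I) \<le> 20" .
  \<comment> \<open>Finiteness of \<open>W\<close> says that no candidate hits its singular value
    exactly; this yields positivity of the residual along with the moment bound.\<close>
  have key: "0 < \<rho> E \<and> ennreal ((4 * \<rho> E / \<tau>\<^sup>2) powr (-1/4)) \<le> W E" if W: "W E \<noteq> \<infinity>" for E
  proof -
    obtain s u v where suv: "\<rho> E = frob2 p q (\<lambda>i j. R E i j - s * (u i * v j))" using \<rho>[of E] unfolding R_def by blast
    have "(\<Sum>i<2. \<Sum>j<2. (R E i j - s * (u i * v j))\<^sup>2) \<le> \<rho> E"
    proof -
      have "(\<Sum>i<2. \<Sum>j<2. (R E i j - s * (u i * v j))\<^sup>2) \<le> (\<Sum>i<2. \<Sum>j<q. (R E i j - s * (u i * v j))\<^sup>2)"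
        using pq by (intro sum_mono sum_mono2) auto
      also have "\<dots> \<le> (\<Sum>i<p. \<Sum>j<q. (R E i j - s * (u i * v j))\<^sup>2)"
        using pq by (intro sum_mono2 sum_nonneg) auto
      finally show ?thesis by (simp add: suv frob2_def)
    qed
    then have blk: "(R E 0 0 - (s * u 0) * v 0)\<^sup>2 + (R E 0 1 - (s * u 0) * v 1)\<^sup>2 + (R E 1 0 - (s * u 1) * v 0)\<^sup>2 + (R E 1 1 - (s * u 1) * v 1)\<^sup>2 \<le> \<rho> E"
      by (simp add: numeral_2_eq_2 ac_simps)
    obtain i j where ij: "i < 2" "j < 2" "(e i j E)\<^sup>2 \<le> 4 * \<rho> E"
    proof -
      obtain x where x: "x \<in> {e 0 0 E, e 1 0 E, e 0 1 E, e 1 1 E}"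
        "x\<^sup>2 \<le> 4 * ((R E 0 0 - (s * u 0) * v 0)\<^sup>2 + (R E 0 1 - (s * u 0) * v 1)\<^sup>2 + (R E 1 0 - (s * u 1) * v 0)\<^sup>2 + (R E 1 1 - (s * u 1) * v 1)\<^sup>2)"
        using two_by_two_rank_one[of "R E 0 0" "R E 0 1" "R E 1 0" "R E 1 1" "s * u 0" "v 0" "v 1" "s * u 1"]
        by (auto simp: e_def ac_simps)
      have "x\<^sup>2 \<le> 4 * \<rho> E" by (rule order_trans[OF x(2) mult_left_mono[OF blk]]) simp
      then show ?thesis using x(1) that[of 0 0] that[of 0 1] that[of 1 0] that[of 1 1] by auto
    qed
    define d where "d = E (\<beta> (i, j)) - h i j E"
    have "sing d \<le> W E"
    proof -
      have "sing d \<le> (\<Sum>j<2. sing (E (\<beta> (i, j)) - h i j E))" unfolding d_def using ij by (intro member_le_sum) auto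
      also have "\<dots> \<le> W E" unfolding W_def using ij by (intro member_le_sum) auto
      finally show ?thesis .
    qed
    then have d0: "d \<noteq> 0" using W by (auto simp: sing_def top_unique)
    have d2: "\<tau>\<^sup>2 * d\<^sup>2 \<le> 4 * \<rho> E" using ij(3) by (simp add: e_eq d_def power_mult_distrib)
    have "0 < \<tau>\<^sup>2 * d\<^sup>2" using \<tau> d0 by simp
    then have pos: "0 < \<rho> E" using d2 by linarith
    have "\<bar>d\<bar> powr 2 \<le> 4 * \<rho> E / \<tau>\<^sup>2" using d2 \<tau> by (simp add: pos_le_divide_eq mult.commute)
    then have "(4 * \<rho> E / \<tau>\<^sup>2) powr (-1/4) \<le> (\<bar>d\<bar> powr 2) powr (-1/4)"
      using d0 by (intro powr_mono2') auto
    also have "\<dots> = \<bar>d\<bar> powr (-1/2)" unfolding powr_powr by simp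
    finally have "ennreal ((4 * \<rho> E / \<tau>\<^sup>2) powr (-1/4)) \<le> sing d" using d0 by (simp add: sing_def ennreal_leI)
    then show ?thesis using pos \<open>sing d \<le> W E\<close> by (blast intro: order_trans)
  qed
  have fin: "(\<integral>\<^sup>+E. W E \<partial>gauss I) \<noteq> \<infinity>" using W20 by (auto simp: top_unique)
  have AE: "AE E in gauss I. W E \<noteq> \<infinity>" by (rule nn_integral_PInf_AE[OF Wm fin])
  then show "AE E in gauss I. 0 < \<rho> E" by eventually_elim (use key in blast)
  have "(\<integral>\<^sup>+E. ennreal ((4 * \<rho> E / \<tau>\<^sup>2) powr (-1/4)) \<partial>gauss I) \<le> (\<integral>\<^sup>+E. W E \<partial>gauss I)"
    by (rule nn_integral_mono_AE) (use AE key in \<open>auto elim!: eventually_mono\<close>)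
  then show "(\<integral>\<^sup>+E. ennreal ((4 * \<rho> E / \<tau>\<^sup>2) powr (-1/4)) \<partial>gauss I) \<le> 20" using W20 by (rule order_trans)
qed

section \<open>Tails and means from exponential moments\<close>

lemma (in prob_space) exp_moment_integrable:
  fixes H :: "'a \<Rightarrow> real"
  assumes H: "H \<in> borel_measurable M" and K: "0 \<le> K"
    and mgf: "(\<integral>\<^sup>+E. ennreal (exp (\<theta> * H E)) \<partial>M) \<le> ennreal K"
  shows "integrable M (\<lambda>E. exp (\<theta> * H E))" "(\<integral>E. exp (\<theta> * H E) \<partial>M) \<le> K"
proof -
  have m: "(\<lambda>E. exp (\<theta> * H E)) \<in> borel_measurable M"
    by (rule measurable_compose[OF H]) measurable
  show i: "integrable M (\<lambda>E. exp (\<theta> * H E))"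
    by (rule integrableI_bounded[OF m]) (use mgf in \<open>auto simp: intro: le_less_trans\<close>)
  show "(\<integral>E. exp (\<theta> * H E) \<partial>M) \<le> K"
    using mgf K by (subst (asm) nn_integral_eq_integral[OF i]) auto
qed

lemma (in prob_space) exp_moment_tail:
  fixes H :: "'a \<Rightarrow> real"
  assumes H: "H \<in> borel_measurable M" and \<theta>: "0 < \<theta>" and K: "0 \<le> K"
    and mgf: "(\<integral>\<^sup>+E. ennreal (exp (\<theta> * H E)) \<partial>M) \<le> ennreal K"
  shows "prob {E\<in>space M. s \<le> H E} \<le> K * exp (- \<theta> * s)"
proof -
  note i = exp_moment_integrable[OF H K mgf]
  have "prob {E\<in>space M. s \<le> H E} \<le> exp (- \<theta> * s) * (\<integral>E. exp (\<theta> * H E) \<partial>M)"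
  proof -
    have "{E\<in>space M. s \<le> H E} = {E\<in>space M. exp (\<theta> * s) \<le> exp (\<theta> * H E)}" using \<theta> by auto
    moreover have "prob {E\<in>space M. exp (\<theta> * s) \<le> exp (\<theta> * H E)} \<le> (\<integral>E. exp (\<theta> * H E) \<partial>M) / exp (\<theta> * s)"
      by (rule integral_Markov_inequality_measure[OF i(1), where A = "space M"]) auto
    ultimately show ?thesis by (simp add: exp_minus divide_inverse mult.commute)
  qed
  also have "\<dots> \<le> exp (- \<theta> * s) * K" by (intro mult_left_mono i(2)) auto
  finally show ?thesis by (simp add: mult.commute)
qed

text \<open>Jensen's inequality in tangent form: \<open>\<theta> * H\<close> lies below
  \<open>A + exp (\<theta> * H - A) - 1\<close>, whose mean is at most \<open>A\<close>. The same
  majorant gives integrability.\<close>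

lemma (in prob_space) exp_moment_integral:
  fixes H :: "'a \<Rightarrow> real"
  assumes Hm: "H \<in> borel_measurable M" and H0: "\<And>E. 0 \<le> H E" and \<theta>: "0 < \<theta>"
    and mgf: "(\<integral>\<^sup>+E. ennreal (exp (\<theta> * H E)) \<partial>M) \<le> ennreal (exp A)"
  shows "integrable M H" "integral\<^sup>L M H \<le> A / \<theta>"
proof -
  have ie: "integrable M (\<lambda>E. exp (\<theta> * H E))" and ee: "(\<integral>E. exp (\<theta> * H E) \<partial>M) \<le> exp A"
    using exp_moment_integrable[OF assms(1) _ mgf] by auto
  have pt: "\<theta> * H E \<le> A + (exp (\<theta> * H E) * exp (- A) - 1)" for E
    using exp_ge_add_one_self[of "\<theta> * H E - A"] by (simp add: exp_diff exp_minus divide_inverse)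
  have ir: "integrable M (\<lambda>E. (A + (exp (\<theta> * H E) * exp (- A) - 1)) / \<theta>)" using ie by simp
  have pt': "H E \<le> (A + (exp (\<theta> * H E) * exp (- A) - 1)) / \<theta>" for E
    using pt[of E] \<theta> by (simp add: pos_le_divide_eq mult.commute)
  show iH: "integrable M H"
  proof (rule Bochner_Integration.integrable_bound[OF ir Hm AE_I2])
    fix E
    show "norm (H E) \<le> norm ((A + (exp (\<theta> * H E) * exp (- A) - 1)) / \<theta>)"
      unfolding real_norm_def abs_of_nonneg[OF H0] by (rule order_trans[OF pt' abs_ge_self])
  qed
  have "integral\<^sup>L M H \<le> (\<integral>E. (A + (exp (\<theta> * H E) * exp (- A) - 1)) / \<theta> \<partial>M)"
    by (rule integral_mono[OF iH ir pt'])
  also have "\<dots> = (A + ((\<integral>E. exp (\<theta> * H E) \<partial>M) * exp (- A) - 1)) / \<theta>"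
    using ie by (simp add: prob_space)
  also have "\<dots> \<le> (A + (exp A * exp (- A) - 1)) / \<theta>"
    using ee \<theta> by (intro divide_right_mono add_left_mono diff_right_mono mult_right_mono) auto
  also have "\<dots> = A / \<theta>" by (simp flip: exp_add)
  finally show "integral\<^sup>L M H \<le> A / \<theta>" .
qed

section \<open>Logarithms of residuals\<close>

text \<open>Concavity: on the interval the logarithm lies above its chord through
  \<open>z = 0\<close> and \<open>z = 1/2\<close>.\<close>

lemma ln_one_minus_chord:
  fixes z :: real
  assumes "0 \<le> z" "z \<le> 1/2"
  shows "- 2 * ln 2 * z \<le> ln (1 - z)"
proof -
  have "(1 - 2 * z) * ln 1 + (2 * z) * ln (1/2) \<le> ln ((1 - 2 * z) *\<^sub>R 1 + (2 * z) *\<^sub>R (1/2))"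
    using concave_onD[OF ln_concave, of "2 * z" 1 "1/2"] assms by simp
  then show ?thesis by (simp add: ln_div algebra_simps)
qed

text \<open>The chord bound is tight at \<open>p = 2\<close>; this is where the threshold \<open>2 ln 2\<close> for the penalty
  comes from.\<close>
lemma ln_residual_lower:
  fixes S s2 p err res :: real
  assumes S: "0 < S" "0 \<le> s2" "s2 \<le> S" and p: "2 \<le> p" and err: "0 \<le> err" "err \<le> S / 8"
    and res: "S - s2 / p - err \<le> res"
  shows "0 < res" "ln S - 2 * ln 2 / p - 4 * err / S \<le> ln res"
proof -
  \<comment> \<open>The lower bound is factored as \<open>S * (1 - z) * (1 - y)\<close>. The noise
    loss satisfies \<open>z \<le> 1 / p \<le> 1/2\<close>, and dividing the relative error by
    \<open>1 - z\<close> at most doubles it, so \<open>y \<le> 1/4\<close>; the chord bound then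
    applies to both factors.\<close>
  define z where "z = s2 / S / p"
  define y where "y = err / S / (1 - z)"
  have "s2 / S \<le> 1" using S by (simp add: divide_le_eq)
  then have zp: "z \<le> 1 / p" unfolding z_def using p by (intro divide_right_mono) auto
  also have "1 / p \<le> 1 / 2" using p by (simp add: divide_simps)
  finally have z2: "z \<le> 1 / 2" .
  have z0: "0 \<le> z" using S p by (simp add: z_def)
  have e8: "err / S \<le> 1 / 8" "0 \<le> err / S" using err S by (simp_all add: divide_simps)
  have y: "0 \<le> y" "y \<le> 2 * (err / S)"
  proof -
    show "0 \<le> y" unfolding y_def by (rule divide_nonneg_nonneg[OF e8(2)]) (use z2 in simp)
    have "err / S \<le> (2 * (err / S)) * (1 - z)" using e8 z2 mult_left_mono[of "1/2" "1 - z" "2 * (err / S)"] by simp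
    then show "y \<le> 2 * (err / S)" unfolding y_def by (subst pos_divide_le_eq) (use z2 in simp_all)
  qed
  have y2: "y \<le> 1 / 4" using y e8 by linarith
  have fac: "S - s2 / p - err = S * ((1 - z) * (1 - y))"
  proof -
    have "(1 - z) * y = err / S" using z2 by (simp add: y_def)
    then have "(1 - z) * (1 - y) = 1 - z - err / S" by (simp add: right_diff_distrib)
    moreover have "S * z = s2 / p" "S * (err / S) = err" using S by (simp_all add: z_def)
    ultimately show ?thesis by (simp only: right_diff_distrib mult_1_right)
  qed
  have pos: "0 < S * ((1 - z) * (1 - y))" using S z2 y2 by simp
  then show "0 < res" using res fac by linarith
  have "ln (S * ((1 - z) * (1 - y))) = ln S + (ln (1 - z) + ln (1 - y))"
    using S z2 y2 by (simp add: ln_mult)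
  moreover have "- 2 * ln 2 * z \<le> ln (1 - z)" by (rule ln_one_minus_chord[OF z0 z2])
  moreover have "2 * ln 2 * z \<le> 2 * ln 2 / p" using mult_left_mono[OF zp, of "2 * ln 2"] by simp
  moreover have "- 2 * ln 2 * y \<le> ln (1 - y)" by (rule ln_one_minus_chord) (use y y2 in auto)
  moreover have "2 * ln 2 * y \<le> 4 * err / S"
  proof -
    have "ln 2 \<le> (1::real)" using ln_le_minus_one[of "2::real"] by simp
    then have "2 * ln 2 * y \<le> 2 * 1 * y" using y(1) by (intro mult_right_mono) auto
    then show ?thesis using y(2) by simp
  qed
  moreover have "ln (S * ((1 - z) * (1 - y))) \<le> ln res" using pos res fac by (intro ln_mono) auto
  ultimately show "ln S - 2 * ln 2 / p - 4 * err / S \<le> ln res" by linarith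
qed

lemma ln_sq_le: "1 \<le> x \<Longrightarrow> (ln x)\<^sup>2 \<le> 4 * (x::real)"
proof -
  assume x: "1 \<le> x"
  have "ln x = 2 * ln (sqrt x)" using x by (simp add: ln_sqrt)
  also have "\<dots> \<le> 2 * sqrt x" using x ln_bound[of "sqrt x"] by simp
  finally have "(ln x)\<^sup>2 \<le> (2 * sqrt x)\<^sup>2" using x by (intro power_mono) auto
  then show ?thesis using x by (simp add: power_mult_distrib)
qed

text \<open>With \<open>y = V powr (-1/8)\<close> one has \<open>1 + y^8 \<le> (1 + y)^8\<close>.
  The exponent is chosen so that the square of the bound is a multiple of
  \<open>V powr (-1/4)\<close>, the negative moment that the small-ball estimate controls.\<close>

lemma ln_one_plus_inverse_le:
  fixes V :: real
  assumes "0 < V"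
  shows "ln (1 + 1 / V) \<le> 8 * V powr (-1/8)"
proof -
  define y where "y = V powr (-1/8)"
  have y: "0 < y" using assms by (simp add: y_def)
  have y8: "y^8 = 1 / V"
  proof -
    have "y^8 = y powr 8" using y by (simp add: powr_numeral)
    also have "\<dots> = V powr (-1)" unfolding y_def powr_powr by simp
    finally show ?thesis using assms by (simp add: powr_minus_divide)
  qed
  have "1 + 1 / V \<le> (1 + y)^8"
  proof -
    have a: "1 + y^2 \<le> (1 + y)^2" using y by (simp add: power2_sum)
    have b: "1 + y^4 \<le> (1 + y^2)^2" using y by (simp add: power2_sum flip: power_mult)
    have "1 + y^8 \<le> (1 + y^4)^2" using y by (simp add: power2_sum flip: power_mult)
    also have "\<dots> \<le> ((1 + y^2)^2)^2" by (rule power_mono[OF b]) (use y in simp)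
    also have "\<dots> \<le> (((1 + y)^2)^2)^2" by (intro power_mono a) (use y in simp_all)
    also have "\<dots> = (1 + y)^8" unfolding power_mult[symmetric] by simp
    finally show ?thesis unfolding y8[symmetric] .
  qed
  then have "ln (1 + 1 / V) \<le> ln ((1 + y)^8)" using assms by (intro ln_mono) (auto simp: add_pos_pos)
  also have "\<dots> = 8 * ln (1 + y)" using y by (simp add: ln_realpow)
  also have "\<dots> \<le> 8 * y" using ln_add_one_self_le_self[of y] y by simp
  finally show ?thesis unfolding y_def .
qed

lemma sq_sum3_le: "(a + b + c)\<^sup>2 \<le> 3 * (a\<^sup>2 + b\<^sup>2 + (c::real)\<^sup>2)"
  using sum_squares_bound[of a b] sum_squares_bound[of a c] sum_squares_bound[of b c]
  by (simp add: power2_eq_square algebra_simps)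

text \<open>The argument is at most a product of a factor in \<open>n\<close>, a factor in
  \<open>D\<close> and \<open>1 + 1 / V\<close>. The squared logarithm is thereby dominated by an
  expression linear in \<open>n\<close> and in \<open>V powr (-1/4)\<close>, both of which will have
  bounded mean.\<close>

lemma ln_ratio_sq_le:
  fixes n D V :: real
  assumes n: "0 \<le> n" and D: "1 \<le> D" and V: "0 < V"
  shows "(ln (8 + (2 + 4 * n) * (4 * D / V)))\<^sup>2 \<le> 120 + 48 * n + 3 * (ln (4 * D))\<^sup>2 + 192 * V powr (-1/4)"
    and "0 \<le> ln (8 + (2 + 4 * n) * (4 * D / V))"
proof -
  have pos: "0 < 4 * D / V" using D V by simp
  have one: "1 \<le> 8 + (2 + 4 * n) * (4 * D / V)"
  proof -
    have "0 \<le> (2 + 4 * n) * (4 * D / V)" by (rule mult_nonneg_nonneg) (use n pos in auto)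
    then show ?thesis by linarith
  qed
  then show ge: "0 \<le> ln (8 + (2 + 4 * n) * (4 * D / V))" by simp
  have "8 + (2 + 4 * n) * (4 * D / V) \<le> (10 + 4 * n) * ((4 * D) * (1 + 1 / V))"
  proof -
    have "8 \<le> (10 + 4 * n) * (4 * D)" using mult_mono[of 8 "10 + 4 * n" 1 "4 * D"] n D by simp
    moreover have "(2 + 4 * n) * (4 * D / V) \<le> (10 + 4 * n) * (4 * D / V)" using pos by (intro mult_right_mono) auto
    ultimately show ?thesis by (simp add: algebra_simps)
  qed
  then have "ln (8 + (2 + 4 * n) * (4 * D / V)) \<le> ln ((10 + 4 * n) * ((4 * D) * (1 + 1 / V)))"
    using one by (intro ln_mono) auto
  also have "\<dots> = ln (10 + 4 * n) + (ln (4 * D) + ln (1 + 1 / V))"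
  proof -
    have "0 < 1 / V" using V by simp
    then have "1 + 1 / V \<noteq> 0" by linarith
    then show ?thesis using n D by (simp add: ln_mult)
  qed
  also have "\<dots> \<le> ln (10 + 4 * n) + ln (4 * D) + 8 * V powr (-1/8)"
    using ln_one_plus_inverse_le[OF V] by simp
  finally have "(ln (8 + (2 + 4 * n) * (4 * D / V)))\<^sup>2 \<le> (ln (10 + 4 * n) + ln (4 * D) + 8 * V powr (-1/8))\<^sup>2"
    using ge by (intro power_mono)
  also have "\<dots> \<le> 3 * ((ln (10 + 4 * n))\<^sup>2 + (ln (4 * D))\<^sup>2 + (8 * V powr (-1/8))\<^sup>2)" by (rule sq_sum3_le)
  also have "(8 * V powr (-1/8))\<^sup>2 = 64 * V powr (-1/4)"
    using V by (simp add: power_mult_distrib power2_eq_square flip: powr_add)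
  also have "3 * ((ln (10 + 4 * n))\<^sup>2 + (ln (4 * D))\<^sup>2 + 64 * V powr (-1/4)) \<le> 3 * (4 * (10 + 4 * n) + (ln (4 * D))\<^sup>2 + 64 * V powr (-1/4))"
    using ln_sq_le[of "10 + 4 * n"] n by simp
  finally show "(ln (8 + (2 + 4 * n) * (4 * D / V)))\<^sup>2 \<le> 120 + 48 * n + 3 * (ln (4 * D))\<^sup>2 + 192 * V powr (-1/4)" by simp
qed

text \<open>A pointwise integrable minorant \<open>L\<close> of the logarithm is integrated. Where
  the error is below \<open>S / 8\<close> the chord bound applies; elsewhere the logarithm may drop
  below \<open>ln K\<close>, and the drop is controlled through the squared logarithm of
  \<open>K / res\<close>. The majorant \<open>U\<close> serves integrability.\<close>

lemma (in prob_space) expected_ln_residual_lower: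
  fixes res err Nn U :: "'a \<Rightarrow> real" and S K g sv p D ev b :: real
  assumes rm: "res \<in> borel_measurable M" and em: "err \<in> borel_measurable M"
    and Nn: "integrable M Nn" "\<And>E. 0 \<le> Nn E" "integral\<^sup>L M Nn \<le> 1"
    and S: "0 < K" "0 \<le> g" "S = K * (1 + g)" and sv: "0 < sv" "sv \<le> K" and p: "2 \<le> p" and D: "1 \<le> D"
    and AE: "AE E in M. 0 < res E"
    and lower: "\<And>E. S - sv / p - err E \<le> res E"
    and err: "\<And>E. 0 \<le> err E" "integrable M err" "integral\<^sup>L M err \<le> ev"
    and ratio: "\<And>E. 0 < res E \<Longrightarrow> K / res E \<le> 8 + (2 + 4 * Nn E) * (sv / res E)"
    and ball: "(\<integral>\<^sup>+E. ennreal ((4 * (D * res E / sv)) powr (-1/4)) \<partial>M) \<le> 20"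
    and U: "\<And>E. res E \<le> U E" "integrable M U"
    and b: "prob {E\<in>space M. S / 8 \<le> err E} \<le> b"
  shows "integrable M (\<lambda>E. ln (res E))"
    "ln S - 2 * ln 2 / p - 4 * ev / S - b * (ln (1 + g) + D) - (4008 + 3 * (ln (4 * D))\<^sup>2) / D
      \<le> (\<integral>E. ln (res E) \<partial>M)"
proof -
  define V where "V = (\<lambda>E. 4 * (D * res E / sv))"
  define A where "A = {E\<in>space M. S / 8 \<le> err E}"
  define J where "J = (\<lambda>E. 120 + 48 * Nn E + 3 * (ln (4 * D))\<^sup>2 + 192 * V E powr (-1/4))"
  define L where "L = (\<lambda>E. ln S - 2 * ln 2 / p - 4 * err E / S - indicator A E * (ln (1 + g) + D) - J E / D)"
  have S0: "0 < S" "K \<le> S" using S by (auto simp: algebra_simps add_pos_nonneg)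
  have Am: "A \<in> sets M" unfolding A_def by (rule borel_measurable_le[OF borel_measurable_const em])
  have Vm: "V \<in> borel_measurable M" unfolding V_def
    by (intro borel_measurable_times borel_measurable_divide borel_measurable_const rm)
  have Vpm: "(\<lambda>E. V E powr (-1/4)) \<in> borel_measurable M"
    by (rule measurable_compose[OF Vm]) measurable
  have ball': "(\<integral>\<^sup>+E. ennreal (V E powr (-1/4)) \<partial>M) \<le> 20" using ball by (simp only: V_def)
  have Vi: "integrable M (\<lambda>E. V E powr (-1/4))"
    by (rule integrableI_bounded[OF Vpm]) (use ball' in \<open>auto intro: le_less_trans\<close>)
  have V20: "(\<integral>E. V E powr (-1/4) \<partial>M) \<le> 20"
  proof -
    have "ennreal (\<integral>E. V E powr (-1/4) \<partial>M) \<le> ennreal 20"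
      using ball' by (subst (asm) nn_integral_eq_integral[OF Vi]) auto
    then show ?thesis by (subst (asm) ennreal_le_iff) auto
  qed
  have Ji: "integrable M J" unfolding J_def using Vi Nn(1) by simp
  \<comment> \<open>The constant is \<open>120 + 48 * 1 + 192 * 20\<close>.\<close>
  have J4: "integral\<^sup>L M J \<le> 4008 + 3 * (ln (4 * D))\<^sup>2"
  proof -
    have "integral\<^sup>L M J = 120 + 48 * integral\<^sup>L M Nn + 3 * (ln (4 * D))\<^sup>2 + 192 * (\<integral>E. V E powr (-1/4) \<partial>M)"
      unfolding J_def using Vi Nn(1) by (simp add: prob_space)
    then show ?thesis using V20 Nn(3) by simp
  qed
  have iA: "integrable M (indicat_real A)"
    by (rule integrable_real_indicator[OF Am]) (simp add: less_top[symmetric])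
  have Li: "integrable M L" unfolding L_def using Ji err(2) iA by simp
  have g0: "0 \<le> ln (1 + g)" using S(2) by simp
  have J0: "0 \<le> J E" for E unfolding J_def using Nn(2)[of E] by simp
  have pt: "L E \<le> ln (res E)" if E: "E \<in> space M" "0 < res E" for E
  proof (cases "E \<in> A")
    case False
    then have e8: "err E \<le> S / 8" using E by (auto simp: A_def)
    have "ln S - 2 * ln 2 / p - 4 * err E / S \<le> ln (res E)"
      by (rule ln_residual_lower(2)[OF S0(1) _ _ p err(1) e8 lower]) (use sv S0 in auto)
    moreover have "0 \<le> J E / D" using J0 D by simp
    ultimately show ?thesis using False by (simp add: L_def)
  next
    case True
    define T where "T = ln (8 + (2 + 4 * Nn E) * (4 * D / V E))"
    have V0: "0 < V E" using E D sv by (simp add: V_def)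
    have eq: "sv / res E = 4 * D / V E" using E D sv by (simp add: V_def field_simps)
    have T: "T\<^sup>2 \<le> J E" "0 \<le> T" unfolding T_def J_def using ln_ratio_sq_le[OF Nn(2) D V0] by auto
    have "ln (K / res E) \<le> T" unfolding T_def eq[symmetric] using ratio[OF E(2)] S(1) E(2) by (intro ln_mono) auto
    then have "ln K - T \<le> ln (res E)" using S(1) E(2) by (simp add: ln_div)
    moreover have "ln S = ln K + ln (1 + g)" using S by (simp add: ln_mult)
    \<comment> \<open>The first summand is charged to the small probability of the exceptional
      event. The second is kept without indicator, so its mean is just a second moment divided by
      \<open>D\<close>.\<close>
    moreover have "T \<le> D + T\<^sup>2 / D"
    proof (cases "T \<le> D")
      case True
      then show ?thesis using D by (simp add: add_increasing2)
    next
      case False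
      then have "T * D \<le> T * T" using T(2) by (intro mult_left_mono) auto
      then have "T \<le> T\<^sup>2 / D" using D by (simp add: pos_le_divide_eq power2_eq_square)
      then show ?thesis using D by simp
    qed
    moreover have "T\<^sup>2 / D \<le> J E / D" using T D by (intro divide_right_mono) auto
    moreover have "0 \<le> 2 * ln 2 / p" "0 \<le> 4 * err E / S" using p err(1)[of E] S0 by auto
    ultimately show ?thesis using True by (simp add: L_def)
  qed
  have lm: "(\<lambda>E. ln (res E)) \<in> borel_measurable M" by (rule measurable_compose[OF rm]) measurable
  have AE2: "AE E in M. L E \<le> ln (res E) \<and> ln (res E) \<le> U E"
    using AE AE_space
  proof eventually_elim
    case (elim E)
    then show ?case using pt[of E] ln_bound[of "res E"] U(1)[of E] by linarith
  qed
  show li: "integrable M (\<lambda>E. ln (res E))"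
  proof (rule Bochner_Integration.integrable_bound[OF _ lm])
    show "integrable M (\<lambda>E. \<bar>L E\<bar> + \<bar>U E\<bar>)" using Li U(2) by simp
    show "AE E in M. norm (ln (res E)) \<le> norm (\<bar>L E\<bar> + \<bar>U E\<bar>)"
      using AE2 by eventually_elim auto
  qed
  have "ln S - 2 * ln 2 / p - 4 * ev / S - b * (ln (1 + g) + D) - (4008 + 3 * (ln (4 * D))\<^sup>2) / D \<le>
     ln S - 2 * ln 2 / p - 4 * integral\<^sup>L M err / S - prob A * (ln (1 + g) + D) - integral\<^sup>L M J / D"
  proof -
    have "4 * integral\<^sup>L M err / S \<le> 4 * ev / S" using err(3) S0 by (simp add: divide_right_mono)
    moreover have "prob A * (ln (1 + g) + D) \<le> b * (ln (1 + g) + D)"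
      using b g0 D by (intro mult_right_mono) (auto simp: A_def)
    moreover have "integral\<^sup>L M J / D \<le> (4008 + 3 * (ln (4 * D))\<^sup>2) / D" using J4 D by (intro divide_right_mono) auto
    ultimately show ?thesis by linarith
  qed
  also have "\<dots> = integral\<^sup>L M L"
    unfolding L_def using Ji err(2) iA Am by (simp add: prob_space)
  also have "\<dots> \<le> (\<integral>E. ln (res E) \<partial>M)"
    using AE2 by (intro integral_mono_AE Li li) auto
  finally show "ln S - 2 * ln 2 / p - 4 * ev / S - b * (ln (1 + g) + D) - (4008 + 3 * (ln (4 * D))\<^sup>2) / D
      \<le> (\<integral>E. ln (res E) \<partial>M)" .
qed

section \<open>The two-term model\<close>

lemma gauss_mat_eq: "gauss_mat M N = gauss ({..<2^M} \<times> {..<2^N})"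
  by (simp add: gauss_mat_def gauss_def)

lemma sum_div_mod:
  fixes f :: "nat \<Rightarrow> nat \<Rightarrow> 'a::comm_monoid_add"
  assumes "0 < b"
  shows "(\<Sum>r<a*b. f (r div b) (r mod b)) = (\<Sum>i<a. \<Sum>j<b. f i j)"
  unfolding sum.cartesian_product
  by (rule sum.reindex_bij_witness[of _ "\<lambda>(i, j). i * b + j" "\<lambda>r. (r div b, r mod b)"])
     (use assms in \<open>auto simp: less_mult_imp_div_less intro: digit_less\<close>)

text \<open>At the configuration of the factors each rearranged Kronecker product is an outer
  product of two vectors, so the inner product splits.\<close>

lemma sum_kterm_mult:
  assumes "m0 \<le> M" "n0 \<le> N"
  shows "(\<Sum>i<2^M. \<Sum>j<2^N. kterm M N m0 n0 A B i j * kterm M N m0 n0 A' B' i j)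
    = frob_inner (2^m0) (2^n0) A A' * frob_inner (2^(M-m0)) (2^(N-n0)) B B'"
proof -
  define a a' where "a = (\<lambda>r. A (r div 2^n0) (r mod 2^n0))" and "a' = (\<lambda>r. A' (r div 2^n0) (r mod 2^n0))"
  define b b' where "b = (\<lambda>k. B (k div 2^(N-n0)) (k mod 2^(N-n0)))" and "b' = (\<lambda>k. B' (k div 2^(N-n0)) (k mod 2^(N-n0)))"
  have "(\<Sum>i<2^M. \<Sum>j<2^N. kterm M N m0 n0 A B i j * kterm M N m0 n0 A' B' i j)
    = (\<Sum>r<2^(m0+n0). \<Sum>k<2^(M+N-m0-n0). rearr M N m0 n0 (kterm M N m0 n0 A B) r k * rearr M N m0 n0 (kterm M N m0 n0 A' B') r k)"
    using sum_rearr[OF assms, of "\<lambda>(i, j). kterm M N m0 n0 A B i j * kterm M N m0 n0 A' B' i j"]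
    by (simp only: rearr_ridxc case_prod_unfold fst_conv snd_conv)
  also have "\<dots> = (\<Sum>r<2^(m0+n0). \<Sum>k<2^(M+N-m0-n0). (a r * a' r) * (b k * b' k))"
  proof (intro sum.cong refl)
    fix r k :: nat assume "r \<in> {..<2^(m0+n0)}" "k \<in> {..<2^(M+N-m0-n0)}"
    then have rk: "r < 2^(m0+n0)" "k < 2^(M+N-m0-n0)" by auto
    show "rearr M N m0 n0 (kterm M N m0 n0 A B) r k * rearr M N m0 n0 (kterm M N m0 n0 A' B') r k = (a r * a' r) * (b k * b' k)"
      unfolding kterm_def rearr_kron[OF assms rk] a_def a'_def b_def b'_def by simp
  qed
  also have "\<dots> = (\<Sum>r<2^(m0+n0). a r * a' r) * (\<Sum>k<2^(M+N-m0-n0). b k * b' k)" by (simp only: sum_product)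
  also have "(\<Sum>r<2^(m0+n0). a r * a' r) = frob_inner (2^m0) (2^n0) A A'"
    using sum_div_mod[of "2^n0" "\<lambda>i j. A i j * A' i j" "2^m0"] by (simp add: a_def a'_def frob_inner_def power_add)
  also have "(\<Sum>k<2^(M+N-m0-n0). b k * b' k) = frob_inner (2^(M-m0)) (2^(N-n0)) B B'"
  proof -
    have e: "M + N - m0 - n0 = (M - m0) + (N - n0)" using assms by simp
    show ?thesis unfolding e power_add using sum_div_mod[of "2^(N-n0)" "\<lambda>i j. B i j * B' i j" "2^(M-m0)"]
      by (simp add: b_def b'_def frob_inner_def)
  qed
  finally show ?thesis .
qed

text \<open>The real supremum is an upper bound only for a bounded set, and Cauchy--Schwarz bounds
  all quotients by 1. Pairs with a vanishing image are excluded from that set; for them both sides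
  are zero.\<close>

lemma cosTheta_bound:
  assumes cos: "cosTheta r c1 c2 M1 M2 \<le> xi" and xi: "0 \<le> xi"
  shows "(\<Sum>i<r. mv c1 M1 u1 i * mv c2 M2 u2 i) \<le> xi * (sqrt (sqnorm r (mv c1 M1 u1)) * sqrt (sqnorm r (mv c2 M2 u2)))"
proof (cases "sqnorm r (mv c1 M1 u1) \<noteq> 0 \<and> sqnorm r (mv c2 M2 u2) \<noteq> 0")
  case True
  let ?S = "{(\<Sum>i<r. mv c1 M1 u1 i * mv c2 M2 u2 i) / (sqrt (sqnorm r (mv c1 M1 u1)) * sqrt (sqnorm r (mv c2 M2 u2))) | u1 u2.
       sqnorm r (mv c1 M1 u1) \<noteq> 0 \<and> sqnorm r (mv c2 M2 u2) \<noteq> 0}"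
  have cs: "(\<Sum>i<r. x i * y i) \<le> sqrt (sqnorm r x) * sqrt (sqnorm r y)" for x y :: "nat \<Rightarrow> real"
    unfolding real_sqrt_mult[symmetric] by (intro real_le_rsqrt sum_mult_le_sqnorm)
  have pos: "0 < sqrt (sqnorm r x) * sqrt (sqnorm r y)" if "sqnorm r x \<noteq> 0" "sqnorm r y \<noteq> 0" for x y
    using that sqnorm_nonneg[of r x] sqnorm_nonneg[of r y] by (intro mult_pos_pos) (simp_all add: less_le)
  have "bdd_above ?S"
    by (rule bdd_aboveI[of _ 1]) (use cs pos in \<open>auto simp: divide_le_eq\<close>)
  then have "(\<Sum>i<r. mv c1 M1 u1 i * mv c2 M2 u2 i) / (sqrt (sqnorm r (mv c1 M1 u1)) * sqrt (sqnorm r (mv c2 M2 u2))) \<le> cosTheta r c1 c2 M1 M2"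
    unfolding cosTheta_def using True by (intro cSup_upper) auto
  also note cos
  finally show ?thesis using pos True by (simp add: pos_divide_le_eq)
next
  case False
  have "mv c1 M1 u1 i * mv c2 M2 u2 i = 0" if "i < r" for i
    using False sqnorm_eq_0D[OF _ that] by auto
  then have "(\<Sum>i<r. mv c1 M1 u1 i * mv c2 M2 u2 i) = 0" by (intro sum.neutral) blast
  moreover have "sqrt (sqnorm r (mv c1 M1 u1)) * sqrt (sqnorm r (mv c2 M2 u2)) = 0" using False by auto
  ultimately show ?thesis by (simp only: mult_zero_right order.refl)
qed

text \<open>Expanding the square at a single \<open>x\<close>, the cross term pairs a vector from
  each column space, so the angle condition bounds it by \<open>xi\<close> times the product of the
  lengths.\<close>

lemma opnorm_lin_comb_le:
  assumes cos: "cosTheta r c c M1 M2 \<le> xi" and xi: "0 \<le> xi" and lam: "0 \<le> l1" "0 \<le> l2"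
    and phi: "opnorm r c M1 \<le> p1" "opnorm r c M2 \<le> p2"
  shows "(opnorm r c (\<lambda>i j. l1 * M1 i j + l2 * M2 i j))\<^sup>2 \<le> l1\<^sup>2 * p1\<^sup>2 + l2\<^sup>2 * p2\<^sup>2 + 2 * l1 * l2 * p1 * p2 * xi"
proof (rule opnorm_sq_le)
  fix x assume x: "sqnorm c x \<le> 1"
  define s1 s2 where "s1 = sqrt (sqnorm r (mv c M1 x))" and "s2 = sqrt (sqnorm r (mv c M2 x))"
  have s: "0 \<le> s1" "0 \<le> s2" "s1 \<le> p1" "s2 \<le> p2"
    using opnorm_ge[OF x, of r M1] opnorm_ge[OF x, of r M2] phi by (auto simp: s1_def s2_def)
  have sq: "sqnorm r (mv c M1 x) = s1\<^sup>2" "sqnorm r (mv c M2 x) = s2\<^sup>2" by (simp_all add: s1_def s2_def)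
  have "mv c (\<lambda>i j. l1 * M1 i j + l2 * M2 i j) x = (\<lambda>i. l1 * mv c M1 x i + l2 * mv c M2 x i)"
    by (auto simp: mv_def sum_distrib_left sum.distrib algebra_simps)
  then have "sqnorm r (mv c (\<lambda>i j. l1 * M1 i j + l2 * M2 i j) x) =
     sqnorm r (\<lambda>i. l1 * mv c M1 x i) + 2 * l2 * (\<Sum>i<r. (l1 * mv c M1 x i) * mv c M2 x i) + l2\<^sup>2 * sqnorm r (mv c M2 x)"
    by (simp only: sqnorm_add_scale)
  also have "\<dots> = l1\<^sup>2 * s1\<^sup>2 + 2 * l1 * l2 * (\<Sum>i<r. mv c M1 x i * mv c M2 x i) + l2\<^sup>2 * s2\<^sup>2"
    by (simp add: sqnorm_scale sq sum_distrib_left ac_simps)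
  also have "\<dots> \<le> l1\<^sup>2 * s1\<^sup>2 + 2 * l1 * l2 * (xi * (s1 * s2)) + l2\<^sup>2 * s2\<^sup>2"
    using cosTheta_bound[OF cos xi, of x x] lam unfolding s1_def s2_def
    by (intro add_right_mono add_left_mono mult_left_mono) auto
  also have "\<dots> \<le> l1\<^sup>2 * p1\<^sup>2 + 2 * l1 * l2 * (xi * (p1 * p2)) + l2\<^sup>2 * p2\<^sup>2"
    using s xi lam by (intro add_mono mult_left_mono mult_mono power_mono) auto
  finally show "sqnorm r (mv c (\<lambda>i j. l1 * M1 i j + l2 * M2 i j) x) \<le> l1\<^sup>2 * p1\<^sup>2 + l2\<^sup>2 * p2\<^sup>2 + 2 * l1 * l2 * p1 * p2 * xi"
    by (simp add: algebra_simps)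
qed

text \<open>The operator norm is taken of the transpose, whose domain has dimension \<open>p\<close>
  and carries the net. The bound on \<open>sqdev\<close> is exported too, because the one-row case
  needs it at a particular vector.\<close>

lemma opnorm_noisy_bound:
  fixes \<beta> :: "nat \<times> nat \<Rightarrow> 'i"
  assumes p: "0 < p" and inj: "inj_on \<beta> ({..<p} \<times> {..<q})" and sub: "\<beta> ` ({..<p} \<times> {..<q}) \<subseteq> I"
    and \<rho>: "frob2 p q T \<le> \<rho>\<^sup>2"
  shows "\<exists>H. H \<in> borel_measurable (gauss I) \<and> (\<forall>E. 0 \<le> H E) \<and>
    (\<forall>E. (opnorm p q (noisy T \<tau> \<beta> E))\<^sup>2 \<le> (opnorm p q T)\<^sup>2 + \<tau>\<^sup>2 * real q + H E) \<and>
    (\<forall>E x. sqnorm p x \<le> 1 \<longrightarrow> \<bar>sqdev p q T \<tau> \<beta> E x\<bar> \<le> H E) \<and>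
    (\<forall>\<theta>. 0 \<le> \<theta> \<longrightarrow> \<theta> * \<tau>\<^sup>2 \<le> 1/8 \<longrightarrow> (\<integral>\<^sup>+E. ennreal (exp (\<theta> * H E)) \<partial>gauss I)
      \<le> ennreal (2 * 48^p * exp (16 * real q * \<theta>\<^sup>2 * \<tau>^4 + 16 * \<theta>\<^sup>2 * \<tau>\<^sup>2 * \<rho>\<^sup>2)))"
proof -
  have r: "sqnorm q (mv p (mtrans T) x) \<le> \<rho>\<^sup>2" if "sqnorm p x \<le> 1" for x
  proof -
    have "sqnorm q (mv p (mtrans T) x) \<le> frob2 q p (mtrans T) * sqnorm p x" by (rule sqnorm_mv_le_frob2)
    also have "\<dots> \<le> frob2 q p (mtrans T) * 1" by (intro mult_left_mono that) auto
    finally show ?thesis using \<rho> by (simp add: frob2_mtrans)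
  qed
  obtain H where H: "H \<in> borel_measurable (gauss I)"
    "\<And>E x. sqnorm p x \<le> 1 \<Longrightarrow> \<bar>sqdev p q T \<tau> \<beta> E x\<bar> \<le> H E"
    "\<And>\<theta>. 0 \<le> \<theta> \<Longrightarrow> \<theta> * \<tau>\<^sup>2 \<le> 1/8 \<Longrightarrow> (\<integral>\<^sup>+E. ennreal (exp (\<theta> * H E)) \<partial>gauss I)
      \<le> ennreal (2 * 48^p * exp (16 * real q * \<theta>\<^sup>2 * \<tau>^4 + 16 * \<theta>\<^sup>2 * \<tau>\<^sup>2 * \<rho>\<^sup>2))"
    using sqdev_uniform_bound[OF p inj sub, of T \<rho> \<tau>] r by blast
  have H0: "0 \<le> H E" for E using H(2)[of "\<lambda>_. 0" E] by simp
  have op: "(opnorm p q (noisy T \<tau> \<beta> E))\<^sup>2 \<le> (opnorm p q T)\<^sup>2 + \<tau>\<^sup>2 * real q + H E" for E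
  proof -
    have "(opnorm q p (mtrans (noisy T \<tau> \<beta> E)))\<^sup>2 \<le> (opnorm q p (mtrans T))\<^sup>2 + \<tau>\<^sup>2 * real q + H E"
    proof (rule opnorm_sq_le)
      fix x assume x: "sqnorm p x \<le> 1"
      have "sqnorm q (mv p (mtrans T) x) \<le> (opnorm q p (mtrans T))\<^sup>2 * sqnorm p x" by (rule sqnorm_mv_le)
      also have "\<dots> \<le> (opnorm q p (mtrans T))\<^sup>2 * 1" by (intro mult_left_mono x) auto
      finally have 1: "sqnorm q (mv p (mtrans T) x) \<le> (opnorm q p (mtrans T))\<^sup>2" by simp
      have 2: "\<tau>\<^sup>2 * real q * sqnorm p x \<le> \<tau>\<^sup>2 * real q * 1" by (intro mult_left_mono x) auto
      show "sqnorm q (mv p (mtrans (noisy T \<tau> \<beta> E)) x) \<le> (opnorm q p (mtrans T))\<^sup>2 + \<tau>\<^sup>2 * real q + H E"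
        using H(2)[OF x, of E] 1 2 unfolding sqdev_def by linarith
    qed
    then show ?thesis by (simp add: opnorm_mtrans)
  qed
  show ?thesis
    by (intro exI[of _ H] conjI allI impI H(1) H0 op H(2) H(3))
qed

lemma gauss_moments:
  assumes "i \<in> I"
  shows "integrable (gauss I) (\<lambda>E. E i)" "(\<integral>E. E i \<partial>gauss I) = 0"
    "integrable (gauss I) (\<lambda>E. (E i)\<^sup>2)" "(\<integral>E. (E i)\<^sup>2 \<partial>gauss I) = 1"
proof -
  note d = distributed_gauss_component[OF assms]
  have n: "0 \<le> std_normal_density x" for x by simp
  show "integrable (gauss I) (\<lambda>E. E i)"
    using distributed_integrable[OF d, of "\<lambda>x. x"] integrable_std_normal_moment[of 1] by simp
  show "(\<integral>E. E i \<partial>gauss I) = 0"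
    using distributed_integral[OF d, of "\<lambda>x. x"] integral_std_normal_moment_odd[of 0] by simp
  show "integrable (gauss I) (\<lambda>E. (E i)\<^sup>2)"
    using distributed_integrable[OF d, of "\<lambda>x. x\<^sup>2"] integrable_std_normal_moment[of 2] by simp
  show "(\<integral>E. (E i)\<^sup>2 \<partial>gauss I) = 1"
    using distributed_integral[OF d, of "\<lambda>x. x\<^sup>2"] integral_std_normal_moment_even[of 1] by simp
qed

text \<open>The factor 2 goes into the power, and
  \<open>96 \<le> (5/2)^5 \<le> exp 5\<close>.\<close>

lemma two_mult_48_power_le: "1 \<le> p \<Longrightarrow> 2 * 48^p \<le> exp (5 * real p)"
proof -
  assume p: "1 \<le> p"
  have "(5/2::real) \<le> exp 1" using exp_lower_Taylor_quadratic[of "1::real"] by simp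
  then have "(5/2::real)^5 \<le> exp 1 ^ 5" by (intro power_mono) auto
  then have e5: "(96::real) \<le> exp 5" by (simp add: exp_of_nat_mult[symmetric] power_divide)
  have "2 * 48^p \<le> (2::real)^p * 48^p" using p by (intro mult_right_mono) (auto simp: self_le_power)
  also have "\<dots> = 96^p" by (simp flip: power_mult_distrib)
  also have "\<dots> \<le> exp 5 ^ p" using e5 by (intro power_mono) auto
  also have "\<dots> = exp (5 * real p)" by (simp add: exp_of_nat2_mult)
  finally show ?thesis .
qed

text \<open>A single member of the sequence; all estimates made here have explicit constants that do
  not depend on it. By \<open>cfg0\<close> the true rearrangement also has at least two rows and two
  columns, as the small-ball estimate requires.\<close>

locale two_term =
  fixes M N m0 n0 :: nat and lam1 lam2 sig xi :: real and A1 B1 A2 B2 :: rmat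
  assumes lam: "lam2 \<le> lam1" "0 < lam2" and sig: "0 < sig"
    and m0: "m0 \<le> M" and n0: "n0 \<le> N"
    and A_orth: "frob_inner (2^m0) (2^n0) A1 A1 = 1" "frob_inner (2^m0) (2^n0) A2 A2 = 1" "frob_inner (2^m0) (2^n0) A1 A2 = 0"
    and B_orth: "frob_inner (2^(M-m0)) (2^(N-n0)) B1 B1 = 1" "frob_inner (2^(M-m0)) (2^(N-n0)) B2 B2 = 1" "frob_inner (2^(M-m0)) (2^(N-n0)) B1 B2 = 0"
    and xi: "0 < xi"
    and WA: "\<forall>(m,n)\<in>cfgsWA M N m0 n0.
        cosTheta (2^(m+n)) (2^(M+N-m-n)) (2^(M+N-m-n)) (rearr M N m n (kterm M N m0 n0 A1 B1)) (rearr M N m n (kterm M N m0 n0 A2 B2)) \<le> xi"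
    and WB: "\<forall>(m,n)\<in>cfgsWB M N m0 n0.
        cosTheta (2^(M+N-m-n)) (2^(m+n)) (2^(m+n)) (mtrans (rearr M N m n (kterm M N m0 n0 A1 B1))) (mtrans (rearr M N m n (kterm M N m0 n0 A2 B2))) \<le> xi"
    and cfg0: "(m0, n0) \<in> cfgs M N"
begin

abbreviation "I \<equiv> {..<2^M::nat} \<times> {..<2^N::nat}"
definition D :: real where "D = 2^(M+N)"
definition tau :: real where "tau = sig * 2 powr (- real (M + N) / 2)"
definition K1 :: rmat where "K1 = kterm M N m0 n0 A1 B1"
definition K2 :: rmat where "K2 = kterm M N m0 n0 A2 B2"
definition X :: rmat where "X = (\<lambda>i j. lam1 * K1 i j + lam2 * K2 i j)"
definition plus_noise :: "rmat \<Rightarrow> (nat \<times> nat \<Rightarrow> real) \<Rightarrow> rmat" where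
  "plus_noise C E = (\<lambda>i j. C i j + tau * E (i, j))"
definition G :: real where "G = G_val M N m0 n0 lam1 lam2 xi A1 B1 A2 B2"
definition rows :: "nat \<Rightarrow> nat \<Rightarrow> nat" where "rows m n = 2^(m+n)"
definition cols :: "nat \<Rightarrow> nat \<Rightarrow> nat" where "cols m n = 2^(M+N-m-n)"
definition pmin :: "nat \<Rightarrow> nat \<Rightarrow> nat" where "pmin m n = min (rows m n) (cols m n)"
definition res :: "nat \<Rightarrow> nat \<Rightarrow> (nat \<times> nat \<Rightarrow> real) \<Rightarrow> real" where
  "res m n E = resid M N m n (plus_noise X E)"

text \<open>The common shape of all random errors: \<open>p\<close> is the dimension of the net and
  \<open>\<rho>\<close> bounds the Frobenius norm of the signal. The exponent is that of the net
  bound with \<open>tau^2 = sig^2 / D\<close> and \<open>q = D / p\<close>.\<close>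

definition noise_ctrl :: "nat \<Rightarrow> real \<Rightarrow> ((nat \<times> nat \<Rightarrow> real) \<Rightarrow> real) \<Rightarrow> bool" where
  "noise_ctrl p \<rho> H \<longleftrightarrow> H \<in> borel_measurable (gauss I) \<and> (\<forall>E. 0 \<le> H E) \<and>
     (\<forall>\<theta>\<ge>0. \<theta> * (sig\<^sup>2 / D) \<le> 1/8 \<longrightarrow> (\<integral>\<^sup>+E. ennreal (exp (\<theta> * H E)) \<partial>gauss I)
        \<le> ennreal (2 * 48^p * exp (16 * \<theta>\<^sup>2 * (sig^4 / (D * real p) + sig\<^sup>2 * \<rho>\<^sup>2 / D))))"

lemma D_pos [simp]: "0 < D" by (simp add: D_def)

lemma D_nonneg [simp]: "0 \<le> D" by (simp add: D_def)

lemma D_nonzero [simp]: "D \<noteq> 0" by (simp add: D_def)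

lemma D_ge1: "1 \<le> D" by (simp add: D_def)

lemma finite_I: "finite I" by simp

lemma tau_pos: "0 < tau" using sig by (simp add: tau_def)

lemma tau2: "tau\<^sup>2 = sig\<^sup>2 / D"
proof -
  have "(2 powr (- real (M + N) / 2))\<^sup>2 = 2 powr (- real (M + N))"
    by (simp add: power2_eq_square flip: powr_add)
  also have "\<dots> = inverse (2 powr real (M + N))" by (rule powr_minus)
  also have "2 powr real (M + N) = D" by (simp only: D_def powr_realpow zero_less_numeral)
  finally show ?thesis by (simp only: tau_def power_mult_distrib divide_inverse)
qed

lemma tau4: "tau^4 = sig^4 / D\<^sup>2"
proof -
  have "tau^4 = (tau\<^sup>2)\<^sup>2" by (simp flip: power_mult)
  then show ?thesis by (simp add: tau2 power_divide flip: power_mult)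
qed

lemma model_Y_eq: "model_Y M N m0 n0 lam1 lam2 sig A1 B1 A2 B2 E = plus_noise X E"
  by (simp add: model_Y_def plus_noise_def X_def K1_def K2_def tau_def)

lemma rows_cols:
  assumes "m \<le> M" "n \<le> N"
  shows "real (rows m n) * real (cols m n) = D" "0 < rows m n" "0 < cols m n"
proof -
  have "(m + n) + (M + N - m - n) = M + N" using assms by simp
  then have "(2::real)^(m+n) * 2^(M+N-m-n) = 2^(M+N)" by (metis power_add)
  then show "real (rows m n) * real (cols m n) = D" by (simp add: rows_def cols_def D_def)
qed (simp_all add: rows_def cols_def)

lemma noisy_rearr: "noisy (rearr M N m n C) tau (ridxc M N m n) E = rearr M N m n (plus_noise C E)"
  by (auto simp: noisy_def rearr_ridxc plus_noise_def fun_eq_iff split: prod.splits)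

lemma rearr_lin: "rearr M N m n X = (\<lambda>i j. lam1 * rearr M N m n K1 i j + lam2 * rearr M N m n K2 i j)"
  by (simp add: rearr_def vecr_def X_def)

lemma inj_ridxc: "m \<le> M \<Longrightarrow> n \<le> N \<Longrightarrow> inj_on (ridxc M N m n) ({..<rows m n} \<times> {..<cols m n})"
  and ridxc_image: "m \<le> M \<Longrightarrow> n \<le> N \<Longrightarrow> ridxc M N m n ` ({..<rows m n} \<times> {..<cols m n}) = I"
  using bij_ridxc[of m M n N] by (auto simp only: bij_betw_def rows_def cols_def)

lemma K_sums: "(\<Sum>i<2^M. \<Sum>j<2^N. K1 i j * K1 i j) = 1" "(\<Sum>i<2^M. \<Sum>j<2^N. K2 i j * K2 i j) = 1"
   "(\<Sum>i<2^M. \<Sum>j<2^N. K1 i j * K2 i j) = 0"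
  unfolding K1_def K2_def sum_kterm_mult[OF m0 n0] using A_orth B_orth by auto

lemma frob2_X: "frob2 (2^M) (2^N) X = lam1\<^sup>2 + lam2\<^sup>2"
proof -
  have "frob2 (2^M) (2^N) X = (\<Sum>i<2^M. \<Sum>j<2^N. lam1\<^sup>2 * (K1 i j * K1 i j) + lam2\<^sup>2 * (K2 i j * K2 i j) + 2 * lam1 * lam2 * (K1 i j * K2 i j))"
    unfolding frob2_def X_def by (intro sum.cong refl) (simp add: power2_sum power_mult_distrib power2_eq_square algebra_simps)
  also have "\<dots> = lam1\<^sup>2 * (\<Sum>i<2^M. \<Sum>j<2^N. K1 i j * K1 i j) + lam2\<^sup>2 * (\<Sum>i<2^M. \<Sum>j<2^N. K2 i j * K2 i j)
     + 2 * lam1 * lam2 * (\<Sum>i<2^M. \<Sum>j<2^N. K1 i j * K2 i j)"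
    by (simp only: sum.distrib sum_distrib_left)
  also have "\<dots> = lam1\<^sup>2 * 1 + lam2\<^sup>2 * 1 + 2 * lam1 * lam2 * 0" by (simp only: K_sums)
  finally show ?thesis by simp
qed

lemma frob2_X_le: "frob2 (2^M) (2^N) X \<le> (lam1 + lam2)\<^sup>2"
  using lam by (simp add: frob2_X power2_sum)

lemma frob2_lam2_K2: "frob2 (2^M) (2^N) (\<lambda>i j. lam2 * K2 i j) = lam2\<^sup>2"
proof -
  have "frob2 (2^M) (2^N) (\<lambda>i j. lam2 * K2 i j) = lam2\<^sup>2 * (\<Sum>i<2^M. \<Sum>j<2^N. K2 i j * K2 i j)"
    unfolding frob2_def sum_distrib_left by (intro sum.cong refl) (simp add: power2_eq_square)
  then show ?thesis by (simp add: K_sums)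
qed

text \<open>The squared Frobenius norm is the operator norm problem for configuration
  \<open>(0, 0)\<close>, where the rearrangement is a single row: \<open>sqdev\<close> at the vector
  1 is the required difference, with net dimension 1.\<close>

lemma frob_noise:
  assumes "frob2 (2^M) (2^N) C \<le> \<rho>\<^sup>2"
  shows "\<exists>F. noise_ctrl 1 \<rho> F \<and> (\<forall>E. \<bar>frob2 (2^M) (2^N) (plus_noise C E) - frob2 (2^M) (2^N) C - sig\<^sup>2\<bar> \<le> F E)"
proof -
  have rc: "rows 0 0 = 1" "cols 0 0 = 2^(M+N)" by (simp_all add: rows_def cols_def)
  have fr: "frob2 1 (2^(M+N)) (rearr M N 0 0 C') = frob2 (2^M) (2^N) C'" for C'
    using frob2_rearr[of 0 M 0 N C'] by simp
  have inj: "inj_on (ridxc M N 0 0) ({..<1} \<times> {..<2^(M+N)})" using inj_ridxc[of 0 0] unfolding rc by simp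
  have sub: "ridxc M N 0 0 ` ({..<1} \<times> {..<2^(M+N)}) \<subseteq> I" using ridxc_image[of 0 0] unfolding rc by simp
  have fr1: "frob2 1 (2^(M+N)) (rearr M N 0 0 C) \<le> \<rho>\<^sup>2" unfolding fr by (rule assms)
  from opnorm_noisy_bound[OF zero_less_one inj sub fr1, where \<tau> = tau]
  obtain F where F: "F \<in> borel_measurable (gauss I)" "\<forall>E. 0 \<le> F E"
    "\<forall>E x. sqnorm 1 x \<le> 1 \<longrightarrow> \<bar>sqdev 1 (2^(M+N)) (rearr M N 0 0 C) tau (ridxc M N 0 0) E x\<bar> \<le> F E"
    "\<forall>\<theta>. 0 \<le> \<theta> \<longrightarrow> \<theta> * tau\<^sup>2 \<le> 1/8 \<longrightarrow> (\<integral>\<^sup>+E. ennreal (exp (\<theta> * F E)) \<partial>gauss I)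
      \<le> ennreal (2 * 48^1 * exp (16 * real (2^(M+N)) * \<theta>\<^sup>2 * tau^4 + 16 * \<theta>\<^sup>2 * tau\<^sup>2 * \<rho>\<^sup>2))"
    by (elim exE conjE) (rule that)
  have rD: "real (2^(M+N)) = D" by (simp add: D_def)
  have nc: "noise_ctrl 1 \<rho> F" unfolding noise_ctrl_def
  proof (intro conjI allI impI F(1) F(2)[rule_format])
    fix \<theta> :: real assume t: "0 \<le> \<theta>" "\<theta> * (sig\<^sup>2 / D) \<le> 1/8"
    have "16 * D * \<theta>\<^sup>2 * tau^4 + 16 * \<theta>\<^sup>2 * tau\<^sup>2 * \<rho>\<^sup>2 = 16 * \<theta>\<^sup>2 * (sig^4 / (D * real 1) + sig\<^sup>2 * \<rho>\<^sup>2 / D)"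
      using D_pos unfolding tau2 tau4 by (simp add: power2_eq_square field_simps del: D_pos)
    then show "(\<integral>\<^sup>+E. ennreal (exp (\<theta> * F E)) \<partial>gauss I) \<le> ennreal (2 * 48^1 * exp (16 * \<theta>\<^sup>2 * (sig^4 / (D * real 1) + sig\<^sup>2 * \<rho>\<^sup>2 / D)))"
      using F(4)[rule_format, OF t(1)] t(2) unfolding rD tau2 by simp
  qed
  have one: "sqnorm q (mv 1 (mtrans R) (\<lambda>_. 1)) = frob2 1 q R" for q R
    by (simp add: sqnorm_def mv_def mtrans_def frob2_def)
  have s1: "sqnorm 1 (\<lambda>_. 1) = 1" by (simp add: sqnorm_def)
  have bd: "\<bar>frob2 (2^M) (2^N) (plus_noise C E) - frob2 (2^M) (2^N) C - sig\<^sup>2\<bar> \<le> F E" for E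
  proof -
    have "\<bar>sqdev 1 (2^(M+N)) (rearr M N 0 0 C) tau (ridxc M N 0 0) E (\<lambda>_. 1)\<bar> \<le> F E"
      by (rule F(3)[rule_format]) (simp only: s1 order.refl)
    then show ?thesis unfolding sqdev_def noisy_rearr one fr s1 rD tau2 by simp
  qed
  show ?thesis using nc bd by blast
qed

text \<open>The contribution \<open>sig^2 / p\<close> is the noise variance \<open>tau^2\<close>
  summed over the longer side \<open>q = D / p\<close>.\<close>

lemma config_noise:
  assumes mn: "m \<le> M" "n \<le> N"
  shows "\<exists>H. noise_ctrl (pmin m n) (lam1 + lam2) H \<and>
    (\<forall>E. (opnorm (rows m n) (cols m n) (rearr M N m n (plus_noise X E)))\<^sup>2
      \<le> (opnorm (rows m n) (cols m n) (rearr M N m n X))\<^sup>2 + sig\<^sup>2 / real (pmin m n) + H E)"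
proof -
  define \<rho> where "\<rho> = lam1 + lam2"
  have fr: "frob2 (rows m n) (cols m n) (rearr M N m n X) \<le> \<rho>\<^sup>2"
    using frob2_rearr[OF mn, of X] frob2_X_le by (simp only: rows_def cols_def \<rho>_def)
  have conv: "noise_ctrl p \<rho> H" if pq: "real p * real q = D" "0 < p" and H: "H \<in> borel_measurable (gauss I)" "\<And>E. 0 \<le> H E"
    "\<And>\<theta>. 0 \<le> \<theta> \<Longrightarrow> \<theta> * tau\<^sup>2 \<le> 1/8 \<Longrightarrow> (\<integral>\<^sup>+E. ennreal (exp (\<theta> * H E)) \<partial>gauss I)
      \<le> ennreal (2 * 48^p * exp (16 * real q * \<theta>\<^sup>2 * tau^4 + 16 * \<theta>\<^sup>2 * tau\<^sup>2 * \<rho>\<^sup>2))" for p q :: nat and H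
    unfolding noise_ctrl_def
  proof (intro conjI allI impI H(1,2))
    fix \<theta> :: real assume t: "0 \<le> \<theta>" "\<theta> * (sig\<^sup>2 / D) \<le> 1/8"
    have q: "real q = D / real p" using pq by (simp add: field_simps)
    have "16 * real q * \<theta>\<^sup>2 * tau^4 + 16 * \<theta>\<^sup>2 * tau\<^sup>2 * \<rho>\<^sup>2 = 16 * \<theta>\<^sup>2 * (sig^4 / (D * real p) + sig\<^sup>2 * \<rho>\<^sup>2 / D)"
      using pq(2) D_pos unfolding q tau2 tau4 by (simp add: power2_eq_square field_simps del: D_pos)
    then show "(\<integral>\<^sup>+E. ennreal (exp (\<theta> * H E)) \<partial>gauss I) \<le> ennreal (2 * 48^p * exp (16 * \<theta>\<^sup>2 * (sig^4 / (D * real p) + sig\<^sup>2 * \<rho>\<^sup>2 / D)))"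
      using H(3)[OF t(1)] t(2) unfolding tau2 by simp
  qed
  have tq: "tau\<^sup>2 * real q = sig\<^sup>2 / real p" if "real p * real q = D" "0 < p" for p q :: nat
  proof -
    have "real q = D / real p" using that by (simp add: field_simps)
    then show ?thesis by (simp add: tau2)
  qed
  show ?thesis
  proof (cases "rows m n \<le> cols m n")
    case True
    then have p: "pmin m n = rows m n" by (simp add: pmin_def)
    from opnorm_noisy_bound[OF rows_cols(2)[OF mn] inj_ridxc[OF mn] eq_refl[OF ridxc_image[OF mn]] fr, where \<tau> = tau]
    obtain H where H: "H \<in> borel_measurable (gauss I)" "\<forall>E. 0 \<le> H E"
      "\<forall>E. (opnorm (rows m n) (cols m n) (noisy (rearr M N m n X) tau (ridxc M N m n) E))\<^sup>2 \<le>
        (opnorm (rows m n) (cols m n) (rearr M N m n X))\<^sup>2 + tau\<^sup>2 * real (cols m n) + H E"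
      "\<forall>\<theta>. 0 \<le> \<theta> \<longrightarrow> \<theta> * tau\<^sup>2 \<le> 1/8 \<longrightarrow> (\<integral>\<^sup>+E. ennreal (exp (\<theta> * H E)) \<partial>gauss I)
      \<le> ennreal (2 * 48^(rows m n) * exp (16 * real (cols m n) * \<theta>\<^sup>2 * tau^4 + 16 * \<theta>\<^sup>2 * tau\<^sup>2 * \<rho>\<^sup>2))"
      by (elim exE conjE) (rule that)
    have nc: "noise_ctrl (rows m n) \<rho> H" by (rule conv[OF rows_cols(1,2)[OF mn] H(1) H(2)[rule_format] H(4)[rule_format]])
    show ?thesis
      by (intro exI[of _ H] conjI allI) (use nc H(3)[rule_format] in \<open>simp_all only: p \<rho>_def noisy_rearr tq[OF rows_cols(1,2)[OF mn]]\<close>)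
  next
    case False
    then have p: "pmin m n = cols m n" by (simp add: pmin_def)
    define \<beta> where "\<beta> = (\<lambda>(i, j). ridxc M N m n (j, i))"
    define T where "T = mtrans (rearr M N m n X)"
    have pq: "real (cols m n) * real (rows m n) = D" using rows_cols(1)[OF mn] by (simp add: mult.commute)
    have inj: "inj_on \<beta> ({..<cols m n} \<times> {..<rows m n})"
      using inj_ridxc[OF mn] by (auto simp: inj_on_def \<beta>_def)
    have sub: "\<beta> ` ({..<cols m n} \<times> {..<rows m n}) \<subseteq> I"
      unfolding ridxc_image[OF mn, symmetric] by (auto simp: \<beta>_def)
    have fr': "frob2 (cols m n) (rows m n) T \<le> \<rho>\<^sup>2" using fr by (simp add: T_def frob2_mtrans)
    have nT: "noisy T tau \<beta> E = mtrans (rearr M N m n (plus_noise X E))" for E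
      unfolding noisy_rearr[symmetric] by (simp add: noisy_def mtrans_def T_def \<beta>_def)
    from opnorm_noisy_bound[OF rows_cols(3)[OF mn] inj sub fr', where \<tau> = tau]
    obtain H where H: "H \<in> borel_measurable (gauss I)" "\<forall>E. 0 \<le> H E"
      "\<forall>E. (opnorm (cols m n) (rows m n) (noisy T tau \<beta> E))\<^sup>2 \<le>
        (opnorm (cols m n) (rows m n) T)\<^sup>2 + tau\<^sup>2 * real (rows m n) + H E"
      "\<forall>\<theta>. 0 \<le> \<theta> \<longrightarrow> \<theta> * tau\<^sup>2 \<le> 1/8 \<longrightarrow> (\<integral>\<^sup>+E. ennreal (exp (\<theta> * H E)) \<partial>gauss I)
      \<le> ennreal (2 * 48^(cols m n) * exp (16 * real (rows m n) * \<theta>\<^sup>2 * tau^4 + 16 * \<theta>\<^sup>2 * tau\<^sup>2 * \<rho>\<^sup>2))"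
      by (elim exE conjE) (rule that)
    have nc: "noise_ctrl (cols m n) \<rho> H" by (rule conv[OF pq rows_cols(3)[OF mn] H(1) H(2)[rule_format] H(4)[rule_format]])
    show ?thesis
      by (intro exI[of _ H] conjI allI) (use nc H(3)[rule_format, unfolded nT] in \<open>simp_all only: p \<rho>_def T_def opnorm_mtrans tq[OF pq rows_cols(3)[OF mn]]\<close>)
  qed
qed

section \<open>Moments, tails and large deviations of the random errors\<close>

lemma pmin_sq: "m \<le> M \<Longrightarrow> n \<le> N \<Longrightarrow> (real (pmin m n))\<^sup>2 \<le> D"
  unfolding rows_cols(1)[of m n, symmetric] power2_eq_square
  by (intro mult_mono) (auto simp: pmin_def)

lemma pmin_le_sqrt: "m \<le> M \<Longrightarrow> n \<le> N \<Longrightarrow> real (pmin m n) \<le> sqrt D"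
  by (intro real_le_rsqrt pmin_sq)

lemma noise_ctrl_meas: "noise_ctrl p \<rho> H \<Longrightarrow> H \<in> borel_measurable (gauss I)"
  and noise_ctrl_nonneg: "noise_ctrl p \<rho> H \<Longrightarrow> 0 \<le> H E"
  unfolding noise_ctrl_def by (elim conjE, assumption) (elim conjE, erule spec)

text \<open>The two conditions on \<open>Q\<close> say that at parameter \<open>p / (8 * Q)\<close>
  each of the two exponents is at most \<open>p / 4\<close>, so the cost \<open>exp (5 * p)\<close>
  of the net dominates.\<close>

lemma noise_ctrl_moment:
  assumes nc: "noise_ctrl p \<rho> H" and p: "1 \<le> p" "(real p)\<^sup>2 \<le> D"
    and Q: "0 < Q" "sig^4 \<le> Q\<^sup>2 * D" "real p * sig\<^sup>2 * \<rho>\<^sup>2 \<le> Q\<^sup>2 * D"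
  shows "(\<integral>\<^sup>+E. ennreal (exp ((real p / (8 * Q)) * H E)) \<partial>gauss I) \<le> ennreal (exp (6 * real p))"
proof -
  define \<theta> where "\<theta> = real p / (8 * Q)"
  have th: "0 \<le> \<theta>" using Q by (simp add: \<theta>_def)
  have "(real p * sig\<^sup>2)\<^sup>2 \<le> (Q * D)\<^sup>2"
  proof -
    have "(real p * sig\<^sup>2)\<^sup>2 = (real p)\<^sup>2 * sig^4" by (simp add: power_mult_distrib flip: power_mult)
    also have "\<dots> \<le> D * (Q\<^sup>2 * D)" by (intro mult_mono p Q) auto
    finally show ?thesis by (simp add: power2_eq_square ac_simps)
  qed
  then have "real p * sig\<^sup>2 \<le> Q * D" by (rule power2_le_imp_le) (use Q in simp)
  then have t8: "\<theta> * (sig\<^sup>2 / D) \<le> 1/8" using Q by (simp add: \<theta>_def field_simps)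
  have "16 * \<theta>\<^sup>2 * (sig^4 / (D * real p)) \<le> real p / 4"
  proof -
    have "16 * \<theta>\<^sup>2 * (sig^4 / (D * real p)) = (real p / 4) * (sig^4 / (Q\<^sup>2 * D))"
      using p Q by (simp add: \<theta>_def power2_eq_square field_simps)
    also have "\<dots> \<le> (real p / 4) * 1" using Q by (intro mult_left_mono) (auto simp: divide_le_eq)
    finally show ?thesis by simp
  qed
  moreover have "16 * \<theta>\<^sup>2 * (sig\<^sup>2 * \<rho>\<^sup>2 / D) \<le> real p / 4"
  proof -
    have "16 * \<theta>\<^sup>2 * (sig\<^sup>2 * \<rho>\<^sup>2 / D) = (real p / 4) * (real p * sig\<^sup>2 * \<rho>\<^sup>2 / (Q\<^sup>2 * D))"
      using p Q by (simp add: \<theta>_def power2_eq_square field_simps)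
    also have "\<dots> \<le> (real p / 4) * 1" using Q by (intro mult_left_mono) (auto simp: divide_le_eq)
    finally show ?thesis by simp
  qed
  ultimately have ex: "16 * \<theta>\<^sup>2 * (sig^4 / (D * real p) + sig\<^sup>2 * \<rho>\<^sup>2 / D) \<le> real p"
    using p by (simp add: distrib_left)
  have "(\<integral>\<^sup>+E. ennreal (exp (\<theta> * H E)) \<partial>gauss I) \<le> ennreal (2 * 48^p * exp (16 * \<theta>\<^sup>2 * (sig^4 / (D * real p) + sig\<^sup>2 * \<rho>\<^sup>2 / D)))"
    using nc[unfolded noise_ctrl_def, THEN conjunct2, THEN conjunct2, rule_format, OF th t8] .
  also have "\<dots> \<le> ennreal (exp (5 * real p) * exp (real p))"
    by (intro ennreal_leI mult_mono two_mult_48_power_le p) (use ex in auto)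
  also have "exp (5 * real p) * exp (real p) = exp (6 * real p)" by (simp flip: exp_add)
  finally show ?thesis unfolding \<theta>_def .
qed

lemma noise_ctrl_expectation:
  assumes nc: "noise_ctrl p \<rho> H" and p: "1 \<le> p" "(real p)\<^sup>2 \<le> D"
    and Q: "0 < Q" "sig^4 \<le> Q\<^sup>2 * D" "real p * sig\<^sup>2 * \<rho>\<^sup>2 \<le> Q\<^sup>2 * D"
  shows "integrable (gauss I) H" "integral\<^sup>L (gauss I) H \<le> 48 * Q"
proof -
  interpret prob_space "gauss I" by (rule prob_space_gauss)
  have th: "0 < real p / (8 * Q)" using p Q by simp
  note e = exp_moment_integral[OF noise_ctrl_meas[OF nc] noise_ctrl_nonneg[OF nc] th noise_ctrl_moment[OF assms]]
  show "integrable (gauss I) H" by (rule e(1))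
  have "6 * real p / (real p / (8 * Q)) = 48 * Q" using p Q by (simp add: field_simps)
  then show "integral\<^sup>L (gauss I) H \<le> 48 * Q" using e(2) by simp
qed

text \<open>Exceeding \<open>K * Q\<close> gains \<open>K * p / 8\<close> in the exponent; from
  \<open>K = 96\<close> on, half of this covers the moment bound \<open>6 * p\<close>. The decay in
  \<open>p\<close> is kept for the union bound.\<close>

lemma noise_ctrl_tail:
  assumes nc: "noise_ctrl p \<rho> H" and p: "1 \<le> p" "(real p)\<^sup>2 \<le> D"
    and Q: "0 < Q" "sig^4 \<le> Q\<^sup>2 * D" "real p * sig\<^sup>2 * \<rho>\<^sup>2 \<le> Q\<^sup>2 * D" and K: "96 \<le> K"
  shows "measure (gauss I) {E\<in>space (gauss I). K * Q \<le> H E} \<le> exp (- (K / 16) * real p)"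
proof -
  interpret prob_space "gauss I" by (rule prob_space_gauss)
  have th: "0 < real p / (8 * Q)" using p Q by simp
  have "prob {E\<in>space (gauss I). K * Q \<le> H E} \<le> exp (6 * real p) * exp (- (real p / (8 * Q)) * (K * Q))"
    by (rule exp_moment_tail[OF noise_ctrl_meas[OF nc] th _ noise_ctrl_moment[OF nc p Q]]) simp
  also have "\<dots> = exp (6 * real p - (K / 8) * real p)" using Q by (simp flip: exp_add)
  also have "\<dots> \<le> exp (- (K / 16) * real p)"
    using mult_right_mono[OF K, of "real p"] by (simp add: algebra_simps)
  finally show ?thesis .
qed

text \<open>Deviations of order \<open>S\<close> are much larger than \<open>Q\<close>, so a bigger
  parameter is affordable: \<open>128 * sqrt D / S\<close> gains \<open>8 * sqrt D\<close>, against
  \<open>5 * sqrt D\<close> for the net and \<open>2^18 + sqrt D\<close> for the two exponents,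
  where \<open>2^18 = 16 * 128^2\<close>. The remaining decay in \<open>sqrt D\<close> beats any
  power of \<open>D\<close>.\<close>

lemma noise_ctrl_large_dev:
  assumes nc: "noise_ctrl p \<rho> H" and p: "1 \<le> p" "(real p)\<^sup>2 \<le> D" and D: "2^20 \<le> D"
    and S: "0 < S" "sig\<^sup>2 \<le> S" "2^18 * (sig * \<rho>)\<^sup>2 \<le> S\<^sup>2 * sqrt D"
  shows "measure (gauss I) {E\<in>space (gauss I). S / 16 \<le> H E} \<le> exp (2^18 - 2 * sqrt D)"
proof -
  interpret prob_space "gauss I" by (rule prob_space_gauss)
  define s where "s = sqrt D"
  have s2: "s * s = D" "0 < s" by (simp_all add: s_def)
  have s10: "1024 \<le> s" using real_sqrt_le_mono[OF D] by (simp add: s_def real_sqrt_power)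
  have ps: "real p \<le> s" unfolding s_def by (rule real_le_rsqrt[OF p(2)])
  define \<theta> where "\<theta> = 128 * s / S"
  have th: "0 < \<theta>" using S s2 by (simp add: \<theta>_def)
  have t8: "\<theta> * (sig\<^sup>2 / D) \<le> 1/8"
  proof -
    have "\<theta> * (sig\<^sup>2 / D) = 128 / s * (sig\<^sup>2 / S)" using s2(2) S unfolding s2(1)[symmetric] by (simp add: \<theta>_def field_simps)
    also have "\<dots> \<le> 128 / s * 1" using S s2 by (intro mult_left_mono) (auto simp: divide_le_eq)
    also have "\<dots> \<le> 1/8" using s10 by (simp add: divide_le_eq)
    finally show ?thesis .
  qed
  have "16 * \<theta>\<^sup>2 * (sig^4 / (D * real p)) \<le> 2^18"
  proof -
    have "16 * \<theta>\<^sup>2 * (sig^4 / (D * real p)) = 2^18 * ((sig\<^sup>2 / S)\<^sup>2 / real p)"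
      using s2(2) S p unfolding s2(1)[symmetric] by (simp add: \<theta>_def field_simps power2_eq_square power4_eq_xxxx)
    also have "\<dots> \<le> 2^18 * (1 / 1)"
      using S p by (intro mult_left_mono frac_le power_le_one) (auto simp: divide_le_eq)
    finally show ?thesis by simp
  qed
  moreover have "16 * \<theta>\<^sup>2 * (sig\<^sup>2 * \<rho>\<^sup>2 / D) \<le> s"
  proof -
    have "16 * \<theta>\<^sup>2 * (sig\<^sup>2 * \<rho>\<^sup>2 / D) = 2^18 * (sig * \<rho>)\<^sup>2 / S\<^sup>2"
      using s2(2) S unfolding s2(1)[symmetric] by (simp add: \<theta>_def field_simps power2_eq_square)
    also have "\<dots> \<le> s" using S by (simp add: divide_le_eq s_def mult.commute)
    finally show ?thesis .
  qed
  ultimately have ex: "16 * \<theta>\<^sup>2 * (sig^4 / (D * real p) + sig\<^sup>2 * \<rho>\<^sup>2 / D) \<le> 2^18 + s"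
    by (simp add: distrib_left)
  define K where "K = 2 * 48^p * exp (16 * \<theta>\<^sup>2 * (sig^4 / (D * real p) + sig\<^sup>2 * \<rho>\<^sup>2 / D))"
  have K: "(\<integral>\<^sup>+E. ennreal (exp (\<theta> * H E)) \<partial>gauss I) \<le> ennreal K"
    unfolding K_def
    using nc[unfolded noise_ctrl_def, THEN conjunct2, THEN conjunct2, rule_format, OF less_imp_le[OF th] t8] .
  have K0: "0 \<le> K" by (simp add: K_def)
  have K2: "K \<le> exp (5 * s) * exp (2^18 + s)"
  proof -
    have "2 * 48^p \<le> exp (5 * real p)" by (rule two_mult_48_power_le[OF p(1)])
    also have "\<dots> \<le> exp (5 * s)" using ps by simp
    finally show ?thesis unfolding K_def using ex by (intro mult_mono) auto
  qed
  have "prob {E\<in>space (gauss I). S / 16 \<le> H E} \<le> K * exp (- \<theta> * (S / 16))"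
    by (rule exp_moment_tail[OF noise_ctrl_meas[OF nc] th K0 K])
  also have "\<dots> \<le> exp (5 * s) * exp (2^18 + s) * exp (- \<theta> * (S / 16))" by (intro mult_right_mono K2) auto
  also have "- \<theta> * (S / 16) = - 8 * s" using S by (simp add: \<theta>_def)
  also have "exp (5 * s) * exp (2^18 + s) * exp (- 8 * s) = exp (2^18 - 2 * s)" by (simp flip: exp_add)
  finally show ?thesis by (simp add: s_def)
qed

end

section \<open>Residuals of the true and of the wrong configurations\<close>

context two_term
begin

text \<open>A lower bound for the noiseless residual of every wrong configuration plus the noise
  energy \<open>sig^2\<close>. The true configuration has \<open>sig^2 + lam2^2\<close> instead, and
  \<open>alpha\<close> is the logarithm of the quotient.\<close>

definition S :: real where "S = sig\<^sup>2 + lam2\<^sup>2 + G"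
definition alpha :: real where "alpha = ln (1 + G / (sig\<^sup>2 + lam2\<^sup>2))"

lemma cfgsW_mem:
  assumes "(m, n) \<in> cfgsW M N m0 n0"
  shows "m \<le> M" "n \<le> N" "(m, n) \<in> cfgs M N"
  using assms by (auto simp: cfgsW_def cfgs_def)

lemma pmin_ge_two:
  assumes "(m, n) \<in> cfgs M N"
  shows "2 \<le> rows m n" "2 \<le> cols m n" "2 \<le> pmin m n"
proof -
  have e: "1 \<le> m + n" "1 \<le> M + N - m - n" using assms by (auto simp: cfgs_def)
  show r: "2 \<le> rows m n" using power_increasing[OF e(1), of "2::nat"] by (simp add: rows_def)
  show c: "2 \<le> cols m n" using power_increasing[OF e(2), of "2::nat"] by (simp add: cols_def)
  show "2 \<le> pmin m n" using r c by (simp add: pmin_def)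
qed

lemma K0_pos: "0 < sig\<^sup>2 + lam2\<^sup>2" using sig by (simp add: add_pos_nonneg)

text \<open>\<open>G\<close> is defined so that \<open>lam1^2 - G\<close> is exactly the bound for a
  linear combination with both norms replaced by their maxima. For configurations in the second
  class the angle is one between row spaces, so the bound is applied to transposes.\<close>

lemma opnorm_X_wrong:
  assumes mn: "(m, n) \<in> cfgsW M N m0 n0"
  shows "(opnorm (rows m n) (cols m n) (rearr M N m n X))\<^sup>2 \<le> lam1\<^sup>2 - G"
proof -
  let ?W = "cfgsW M N m0 n0"
  have fin: "finite ?W" by (rule finite_subset[of _ "{0..M} \<times> {0..N}"]) (auto simp: cfgsW_def cfgs_def)
  define p1 p2 where "p1 = phi M N ?W K1" and "p2 = phi M N ?W K2"
  have ph: "opnorm (rows m n) (cols m n) (rearr M N m n C) \<le> phi M N ?W C" for C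
    unfolding phi_def rows_def cols_def using mn fin by (intro Max_ge finite_imageI) (auto intro!: image_eqI[of _ _ "(m, n)"])
  have Geq: "lam1\<^sup>2 - G = lam1\<^sup>2 * p1\<^sup>2 + lam2\<^sup>2 * p2\<^sup>2 + 2 * lam1 * lam2 * p1 * p2 * xi"
    by (simp add: G_def G_val_def Let_def p1_def p2_def K1_def K2_def algebra_simps)
  have l: "0 \<le> lam1" "0 \<le> lam2" "0 \<le> xi" using lam xi by auto
  show ?thesis
  proof (cases "m + n \<ge> (M - m) + (N - n)")
    case True
    then have "(m, n) \<in> cfgsWA M N m0 n0" using mn by (simp add: cfgsWA_def)
    then have c: "cosTheta (rows m n) (cols m n) (cols m n) (rearr M N m n K1) (rearr M N m n K2) \<le> xi"
      using WA by (auto simp only: K1_def K2_def rows_def cols_def)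
    show ?thesis unfolding Geq rearr_lin p1_def p2_def
      by (rule opnorm_lin_comb_le[OF c l(3,1,2) ph ph])
  next
    case False
    then have "(m, n) \<in> cfgsWB M N m0 n0" using mn by (simp add: cfgsWB_def)
    then have c: "cosTheta (cols m n) (rows m n) (rows m n) (mtrans (rearr M N m n K1)) (mtrans (rearr M N m n K2)) \<le> xi"
      using WB by (auto simp only: K1_def K2_def rows_def cols_def)
    have "(opnorm (cols m n) (rows m n) (\<lambda>i j. lam1 * mtrans (rearr M N m n K1) i j + lam2 * mtrans (rearr M N m n K2) i j))\<^sup>2 \<le> lam1\<^sup>2 - G"
      unfolding Geq p1_def p2_def
      by (rule opnorm_lin_comb_le[OF c l(3,1,2)]) (simp_all only: opnorm_mtrans ph)
    moreover have "(\<lambda>i j. lam1 * mtrans (rearr M N m n K1) i j + lam2 * mtrans (rearr M N m n K2) i j) = mtrans (rearr M N m n X)"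
      by (simp add: mtrans_def rearr_lin)
    ultimately show ?thesis by (simp only: opnorm_mtrans)
  qed
qed

lemma res_eq: "res m n E = frob2 (2^M) (2^N) (plus_noise X E) - (opnorm (rows m n) (cols m n) (rearr M N m n (plus_noise X E)))\<^sup>2"
  by (simp only: res_def resid_def rows_def cols_def)

lemma res_le_frob2: "res m n E \<le> frob2 (2^M) (2^N) (plus_noise X E)"
  unfolding res_eq by simp

text \<open>Testing the operator norm at the vectorised \<open>A1\<close> and \<open>B1\<close>
  gives \<open>z = lam1 + y\<close>. Subtracting \<open>z^2\<close> removes the fluctuation
  \<open>2 * lam1 * y\<close> together with \<open>lam1^2\<close> and leaves the energy of the
  second term plus noise, minus \<open>y^2\<close>. The error is therefore free of
  \<open>lam1\<close>.\<close>

lemma res_true_le: "res m0 n0 E \<le> frob2 (2^M) (2^N) (plus_noise (\<lambda>i j. lam2 * K2 i j) E)"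
proof -
  define P where "P = plus_noise (\<lambda>i j. lam2 * K2 i j) E"
  define a where "a = (\<lambda>r. A1 (r div 2^n0) (r mod 2^n0))"
  define b where "b = (\<lambda>k. B1 (k div 2^(N-n0)) (k mod 2^(N-n0)))"
  have e: "M + N - m0 - n0 = (M - m0) + (N - n0)" using m0 n0 by simp
  have a1: "sqnorm (rows m0 n0) a = 1"
    using sum_div_mod[of "2^n0" "\<lambda>i j. (A1 i j)\<^sup>2" "2^m0"] A_orth(1)
    by (simp add: sqnorm_def a_def rows_def power_add frob_inner_def power2_eq_square)
  have b1: "sqnorm (cols m0 n0) b = 1"
    using sum_div_mod[of "2^(N-n0)" "\<lambda>i j. (B1 i j)\<^sup>2" "2^(M-m0)"] B_orth(1)
    unfolding cols_def e power_add by (simp add: sqnorm_def b_def frob_inner_def power2_eq_square)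
  define z where "z = (\<Sum>i<2^M. \<Sum>j<2^N. K1 i j * plus_noise X E i j)"
  have "z = (\<Sum>r<rows m0 n0. a r * mv (cols m0 n0) (rearr M N m0 n0 (plus_noise X E)) b r)"
  proof -
    have "z = (\<Sum>r<rows m0 n0. \<Sum>k<cols m0 n0. rearr M N m0 n0 K1 r k * rearr M N m0 n0 (plus_noise X E) r k)"
      using sum_rearr[OF m0 n0, of "\<lambda>(i, j). K1 i j * plus_noise X E i j"]
      by (simp only: z_def rearr_ridxc case_prod_unfold fst_conv snd_conv rows_def cols_def)
    also have "\<dots> = (\<Sum>r<rows m0 n0. \<Sum>k<cols m0 n0. a r * (rearr M N m0 n0 (plus_noise X E) r k * b k))"
    proof (intro sum.cong refl)
      fix r k assume "r \<in> {..<rows m0 n0}" "k \<in> {..<cols m0 n0}"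
      then have rk: "r < 2^(m0+n0)" "k < 2^(M+N-m0-n0)" by (auto simp only: rows_def cols_def lessThan_iff)
      show "rearr M N m0 n0 K1 r k * rearr M N m0 n0 (plus_noise X E) r k = a r * (rearr M N m0 n0 (plus_noise X E) r k * b k)"
        unfolding K1_def kterm_def rearr_kron[OF m0 n0 rk] a_def b_def by simp
    qed
    finally show ?thesis by (simp only: mv_def sum_distrib_left)
  qed
  then have z2: "z\<^sup>2 \<le> (opnorm (rows m0 n0) (cols m0 n0) (rearr M N m0 n0 (plus_noise X E)))\<^sup>2"
    using bilinear_le[where u = a and v = b and r = "rows m0 n0" and c = "cols m0 n0" and R = "rearr M N m0 n0 (plus_noise X E)"]
    by (simp only: a1 b1 mult_1_right)
  define y where "y = (\<Sum>i<2^M. \<Sum>j<2^N. K1 i j * P i j)"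
  have Y: "plus_noise X E i j = lam1 * K1 i j + P i j" for i j by (simp add: plus_noise_def X_def P_def)
  have zy: "z = lam1 + y"
  proof -
    have "z = (\<Sum>i<2^M. \<Sum>j<2^N. lam1 * (K1 i j * K1 i j) + K1 i j * P i j)"
      unfolding z_def Y by (intro sum.cong refl) (simp add: algebra_simps)
    also have "\<dots> = lam1 * (\<Sum>i<2^M. \<Sum>j<2^N. K1 i j * K1 i j) + y"
      unfolding y_def by (simp only: sum.distrib sum_distrib_left)
    finally show ?thesis by (simp add: K_sums)
  qed
  have "frob2 (2^M) (2^N) (plus_noise X E) = (\<Sum>i<2^M. \<Sum>j<2^N. lam1\<^sup>2 * (K1 i j * K1 i j) + 2 * lam1 * (K1 i j * P i j) + (P i j)\<^sup>2)"
    unfolding frob2_def Y by (intro sum.cong refl) (simp add: power2_eq_square algebra_simps)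
  also have "\<dots> = lam1\<^sup>2 * (\<Sum>i<2^M. \<Sum>j<2^N. K1 i j * K1 i j) + 2 * lam1 * y + frob2 (2^M) (2^N) P"
    unfolding y_def frob2_def by (simp only: sum.distrib sum_distrib_left)
  finally have "frob2 (2^M) (2^N) (plus_noise X E) = lam1\<^sup>2 + 2 * lam1 * y + frob2 (2^M) (2^N) P" by (simp add: K_sums)
  moreover have "z\<^sup>2 = lam1\<^sup>2 + 2 * lam1 * y + y\<^sup>2" by (simp add: zy power2_sum)
  moreover have "0 \<le> y\<^sup>2" by simp
  ultimately show ?thesis using z2 unfolding res_eq P_def by linarith
qed

lemma plus_noise_meas:
  "(\<lambda>E. plus_noise C E i j) \<in> borel_measurable (gauss I)" if "i < 2^M" "j < 2^N"
  unfolding plus_noise_def using that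
  by (intro borel_measurable_add borel_measurable_times borel_measurable_const measurable_gauss_component) auto

lemma res_meas:
  assumes "m \<le> M" "n \<le> N"
  shows "res m n \<in> borel_measurable (gauss I)"
proof -
  have 1: "(\<lambda>E. frob2 (2^M) (2^N) (plus_noise X E)) \<in> borel_measurable (gauss I)"
    unfolding frob2_def by (intro borel_measurable_sum borel_measurable_power plus_noise_meas) auto
  have 2: "(\<lambda>E. opnorm (rows m n) (cols m n) (rearr M N m n (plus_noise X E))) \<in> borel_measurable (gauss I)"
  proof (rule borel_measurable_opnorm)
    fix r k assume rk: "r < rows m n" "k < cols m n"
    obtain i j where ij: "ridxc M N m n (r, k) = (i, j)" by fastforce
    have "(i, j) \<in> I" unfolding ij[symmetric] ridxc_image[OF assms, symmetric] using rk by (intro imageI) auto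
    then show "(\<lambda>E. rearr M N m n (plus_noise X E) r k) \<in> borel_measurable (gauss I)"
      unfolding rearr_ridxc ij prod.case by (intro plus_noise_meas) auto
  qed
  show ?thesis unfolding res_eq[abs_def] by (intro borel_measurable_diff borel_measurable_power 1 2)
qed

lemma res_rank_one:
  assumes "m \<le> M" "n \<le> N"
  shows "\<exists>s u v. sqnorm (rows m n) u = 1 \<and> sqnorm (cols m n) v = 1 \<and>
    res m n E = frob2 (rows m n) (cols m n) (\<lambda>i j. rearr M N m n (plus_noise X E) i j - s * (u i * v j))"
  using frob2_fit_ex_rank_one[OF assms, of "plus_noise X E"] unfolding res_def rows_def cols_def by blast

lemma res_nonneg: "m \<le> M \<Longrightarrow> n \<le> N \<Longrightarrow> 0 \<le> res m n E"
  unfolding res_def by (rule resid_nonneg)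

lemma res_small_ball:
  assumes "(m, n) \<in> cfgs M N"
  shows "AE E in gauss I. 0 < res m n E"
    "(\<integral>\<^sup>+E. ennreal ((4 * (D * res m n E / sig\<^sup>2)) powr (-1/4)) \<partial>gauss I) \<le> 20"
proof -
  have mn: "m \<le> M" "n \<le> N" using assms by (auto simp: cfgs_def)
  have ex: "\<exists>s u v. res m n E = frob2 (rows m n) (cols m n) (\<lambda>i j. noisy (rearr M N m n X) tau (ridxc M N m n) E i j - s * (u i * v j))" for E
    unfolding noisy_rearr using res_rank_one[OF mn, of E] by blast
  note b = resid_small_ball[OF finite_I pmin_ge_two(1,2)[OF assms] inj_ridxc[OF mn] eq_refl[OF ridxc_image[OF mn]] tau_pos ex]
  show "AE E in gauss I. 0 < res m n E" by (rule b(1))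
  have "4 * res m n E / tau\<^sup>2 = 4 * (D * res m n E / sig\<^sup>2)" for E by (simp add: tau2)
  then show "(\<integral>\<^sup>+E. ennreal ((4 * (D * res m n E / sig\<^sup>2)) powr (-1/4)) \<partial>gauss I) \<le> 20" using b(2) by simp
qed

lemma frob2_plus_noise_expectation:
  shows "integrable (gauss I) (\<lambda>E. frob2 (2^M) (2^N) (plus_noise C E))"
    "(\<integral>E. frob2 (2^M) (2^N) (plus_noise C E) \<partial>gauss I) = frob2 (2^M) (2^N) C + sig\<^sup>2"
proof -
  interpret prob_space "gauss I" by (rule prob_space_gauss)
  have expand: "(plus_noise C E i j)\<^sup>2 = (C i j)\<^sup>2 + 2 * C i j * tau * E (i, j) + tau\<^sup>2 * (E (i, j))\<^sup>2" for E i j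
    by (simp add: plus_noise_def power2_sum power_mult_distrib)
  have i1: "integrable (gauss I) (\<lambda>E. (plus_noise C E i j)\<^sup>2)" "(\<integral>E. (plus_noise C E i j)\<^sup>2 \<partial>gauss I) = (C i j)\<^sup>2 + tau\<^sup>2"
    if "i < 2^M" "j < 2^N" for i j
    using gauss_moments[of "(i, j)" I] that unfolding expand by (simp_all add: prob_space)
  show "integrable (gauss I) (\<lambda>E. frob2 (2^M) (2^N) (plus_noise C E))"
    unfolding frob2_def by (intro Bochner_Integration.integrable_sum i1) auto
  have "(\<integral>E. frob2 (2^M) (2^N) (plus_noise C E) \<partial>gauss I) = (\<Sum>i<2^M. \<Sum>j<2^N. \<integral>E. (plus_noise C E i j)\<^sup>2 \<partial>gauss I)"
    unfolding frob2_def using i1 by (subst Bochner_Integration.integral_sum) (auto intro!: sum.cong Bochner_Integration.integral_sum Bochner_Integration.integrable_sum)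
  also have "\<dots> = (\<Sum>i<(2^M::nat). \<Sum>j<(2^N::nat). (C i j)\<^sup>2 + tau\<^sup>2)" using i1(2) by simp
  also have "\<dots> = frob2 (2^M) (2^N) C + D * tau\<^sup>2" by (simp add: sum.distrib frob2_def D_def power_add)
  finally show "(\<integral>E. frob2 (2^M) (2^N) (plus_noise C E) \<partial>gauss I) = frob2 (2^M) (2^N) C + sig\<^sup>2" by (simp add: tau2)
qed

definition noise_energy :: "(nat \<times> nat \<Rightarrow> real) \<Rightarrow> real" where
  "noise_energy E = frob2 (2^M) (2^N) (plus_noise (\<lambda>_ _. 0) E) / sig\<^sup>2"

lemma noise_energy: "integrable (gauss I) noise_energy" "0 \<le> noise_energy E" "integral\<^sup>L (gauss I) noise_energy \<le> 1"
proof -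
  have z: "frob2 (2^M) (2^N) (\<lambda>_ _. 0) = 0" by (simp add: frob2_def)
  note e = frob2_plus_noise_expectation[of "\<lambda>_ _. 0", unfolded z]
  show "integrable (gauss I) noise_energy" unfolding noise_energy_def[abs_def] using e(1) by simp
  show "0 \<le> noise_energy E" by (simp add: noise_energy_def)
  show "integral\<^sup>L (gauss I) noise_energy \<le> 1" unfolding noise_energy_def[abs_def] using e(2) sig by simp
qed

text \<open>The rank one matrix fitted to the data is used as a competitor for \<open>X\<close>,
  whose best rank one error is at least \<open>lam2^2\<close>; the triangle inequality then bounds
  \<open>lam2^2\<close> by the residual and the noise energy. Thus a small residual is compared with
  \<open>sig^2\<close> alone, and no \<open>lam2 / sig\<close> enters the logarithm.\<close>

lemma res_ratio:
  assumes mn: "(m, n) \<in> cfgsW M N m0 n0" and G: "0 \<le> G" and r: "0 < res m n E"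
  shows "(sig\<^sup>2 + lam2\<^sup>2) / res m n E \<le> 8 + (2 + 4 * noise_energy E) * (sig\<^sup>2 / res m n E)"
proof -
  note mn' = cfgsW_mem[OF mn]
  obtain s u v where uv: "sqnorm (rows m n) u = 1" "sqnorm (cols m n) v = 1"
    "res m n E = frob2 (rows m n) (cols m n) (\<lambda>i j. rearr M N m n (plus_noise X E) i j - s * (u i * v j))"
    using res_rank_one[OF mn'(1,2), of E] by blast
  let ?Z = "rearr M N m n (plus_noise (\<lambda>_ _. 0) E)"
  have "lam2\<^sup>2 \<le> frob2 (2^M) (2^N) X - (opnorm (rows m n) (cols m n) (rearr M N m n X))\<^sup>2"
    using opnorm_X_wrong[OF mn] G by (simp add: frob2_X)
  also have "\<dots> = frob2 (rows m n) (cols m n) (rearr M N m n X) - (opnorm (rows m n) (cols m n) (rearr M N m n X))\<^sup>2"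
    using frob2_rearr[OF mn'(1,2), of X] by (simp only: rows_def cols_def)
  also have "\<dots> \<le> frob2 (rows m n) (cols m n) (\<lambda>i j. rearr M N m n X i j - s * (u i * v j))"
    by (rule frob2_rank_one_diff_ge[OF uv(1,2)])
  also have "\<dots> \<le> 2 * res m n E + 2 * frob2 (rows m n) (cols m n) ?Z"
  proof -
    have eq: "rearr M N m n X i j - s * (u i * v j) = (rearr M N m n (plus_noise X E) i j - s * (u i * v j)) - 1 * ?Z i j" for i j
      by (simp add: rearr_def vecr_def plus_noise_def)
    show ?thesis unfolding uv(3) frob2_def sum_distrib_left sum.distrib[symmetric] eq
      by (intro sum_mono order_trans[OF sq_diff_scaled_le]) auto
  qed
  also have "frob2 (rows m n) (cols m n) ?Z = noise_energy E * sig\<^sup>2"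
    using frob2_rearr[OF mn'(1,2), of "plus_noise (\<lambda>_ _. 0) E"] sig by (simp only: rows_def cols_def noise_energy_def) simp
  finally have le: "sig\<^sup>2 + lam2\<^sup>2 \<le> 8 * res m n E + (2 + 4 * noise_energy E) * sig\<^sup>2"
  proof -
    assume "lam2\<^sup>2 \<le> 2 * res m n E + 2 * (noise_energy E * sig\<^sup>2)"
    moreover have "0 \<le> noise_energy E * sig\<^sup>2" using noise_energy(2) by simp
    moreover have "(2 + 4 * noise_energy E) * sig\<^sup>2 = 2 * sig\<^sup>2 + 4 * (noise_energy E * sig\<^sup>2)"
      by (simp add: algebra_simps)
    ultimately show ?thesis using r zero_le_power2[of sig] by linarith
  qed
  then have "(sig\<^sup>2 + lam2\<^sup>2) / res m n E \<le> (8 * res m n E + (2 + 4 * noise_energy E) * sig\<^sup>2) / res m n E"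
    using r by (intro divide_right_mono) auto
  then show ?thesis using r by (simp add: add_divide_distrib)
qed

lemma res_wrong_ge:
  assumes mn: "(m, n) \<in> cfgsW M N m0 n0"
    and H: "(opnorm (rows m n) (cols m n) (rearr M N m n (plus_noise X E)))\<^sup>2
      \<le> (opnorm (rows m n) (cols m n) (rearr M N m n X))\<^sup>2 + sig\<^sup>2 / real (pmin m n) + h"
    and F: "\<bar>frob2 (2^M) (2^N) (plus_noise X E) - frob2 (2^M) (2^N) X - sig\<^sup>2\<bar> \<le> f"
  shows "S - sig\<^sup>2 / real (pmin m n) - (h + f) \<le> res m n E"
  using opnorm_X_wrong[OF mn] H F unfolding res_eq S_def frob2_X by linarith

text \<open>\<open>D / pmin m n\<close> is the larger of the two dimensions, hence at most their
  sum.\<close>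

lemma penalty_ge:
  assumes "m \<le> M" "n \<le> N" "2 * ln 2 \<le> \<kappa>"
  shows "D * (2 * ln 2 / real (pmin m n)) \<le> \<kappa> * (real (rows m n) + real (cols m n))"
proof -
  have k: "0 \<le> \<kappa>" using assms(3) ln_gt_zero[of "2::real"] by linarith
  have "D / real (pmin m n) \<le> real (rows m n) + real (cols m n)"
    using rows_cols[OF assms(1,2)] by (auto simp: pmin_def min_def field_simps)
  then have "(2 * ln 2) * (D / real (pmin m n)) \<le> \<kappa> * (real (rows m n) + real (cols m n))"
    using assms(3) k by (intro mult_mono) auto
  then show ?thesis by (simp add: mult.commute)
qed

lemma IC_eq: "m \<le> M \<Longrightarrow> n \<le> N \<Longrightarrow> IC \<kappa> M N m n (plus_noise X E) = D * ln (res m n E) + \<kappa> * (real (rows m n) + real (cols m n))"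
  unfolding IC_resid by (simp add: res_def D_def rows_def cols_def)

end

section \<open>Gaps of the information criterion\<close>

lemma sum_exp_minus_le_two: "(\<Sum>k\<le>(K::nat). exp (- real k)) \<le> 2"
proof -
  have "exp (-1) \<le> (1/2::real)"
    using exp_ge_add_one_self[of "1::real"] by (simp add: exp_minus divide_simps)
  then have le: "exp (- real k) \<le> (1/2)^k" for k
    using power_mono[of "exp (-1)" "1/2::real" k] by (simp flip: exp_of_nat_mult)
  have "(\<Sum>k\<le>K. exp (- real k)) \<le> (\<Sum>k\<le>K. (1/2)^k)" by (intro sum_mono le)
  also have "\<dots> = 2 - (1/2)^K" by (induction K) auto
  finally show ?thesis using zero_le_power[of "1/2::real" K] by linarith
qed

context two_term
begin

lemma S_factor: "S = (sig\<^sup>2 + lam2\<^sup>2) * (1 + G / (sig\<^sup>2 + lam2\<^sup>2))"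
proof -
  have "sig\<^sup>2 + lam2\<^sup>2 \<noteq> 0" using K0_pos by linarith
  then show ?thesis by (simp add: S_def distrib_left)
qed

text \<open>The upper bound needs no concentration: \<open>ln x \<le> x - 1\<close> is applied
  relative to \<open>sig^2 + lam2^2\<close>, which is exactly the mean of the dominating
  energy.\<close>

lemma log_residual_expectation_true:
  shows "integrable (gauss I) (\<lambda>E. ln (res m0 n0 E))"
    "(\<integral>E. ln (res m0 n0 E) \<partial>gauss I) \<le> ln (sig\<^sup>2 + lam2\<^sup>2)"
proof -
  interpret prob_space "gauss I" by (rule prob_space_gauss)
  have r0: "0 \<le> res m0 n0 E" for E by (rule res_nonneg[OF m0 n0])
  have s2: "0 < sig\<^sup>2" using sig by simp
  show i: "integrable (gauss I) (\<lambda>E. ln (res m0 n0 E))"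
  \<comment> \<open>Only integrability is taken from the lemma. The constant error
    \<open>sig^2\<close> makes its lower bound on the residual negative, hence trivially
    true.\<close>
  proof (rule expected_ln_residual_lower(1)[where g = 0 and K = "sig\<^sup>2" and S = "sig\<^sup>2" and sv = "sig\<^sup>2" and p = 2 and D = D
        and err = "\<lambda>_. sig\<^sup>2" and ev = "sig\<^sup>2" and b = 1 and Nn = noise_energy and U = "\<lambda>E. frob2 (2^M) (2^N) (plus_noise X E)"])
    show "res m0 n0 \<in> borel_measurable (gauss I)" by (rule res_meas[OF m0 n0])
    show "AE E in gauss I. 0 < res m0 n0 E" by (rule res_small_ball(1)[OF cfg0])
    show "(\<integral>\<^sup>+E. ennreal ((4 * (D * res m0 n0 E / sig\<^sup>2)) powr (-1/4)) \<partial>gauss I) \<le> 20" by (rule res_small_ball(2)[OF cfg0])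
    show "sig\<^sup>2 - sig\<^sup>2 / 2 - sig\<^sup>2 \<le> res m0 n0 E" for E using r0[of E] s2 by linarith
    show "sig\<^sup>2 / res m0 n0 E \<le> 8 + (2 + 4 * noise_energy E) * (sig\<^sup>2 / res m0 n0 E)" if "0 < res m0 n0 E" for E
    proof -
      have "0 \<le> sig\<^sup>2 / res m0 n0 E" using that s2 by simp
      moreover have "0 \<le> noise_energy E * (sig\<^sup>2 / res m0 n0 E)" by (intro mult_nonneg_nonneg noise_energy(2) calculation)
      ultimately show ?thesis unfolding distrib_right by linarith
    qed
    show "res m0 n0 E \<le> frob2 (2^M) (2^N) (plus_noise X E)" for E by (rule res_le_frob2)
    show "integrable (gauss I) (\<lambda>E. frob2 (2^M) (2^N) (plus_noise X E))" by (rule frob2_plus_noise_expectation)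
  qed (use s2 D_ge1 noise_energy prob_le_1 in \<open>auto simp: prob_space\<close>)
  define c where "c = sig\<^sup>2 + lam2\<^sup>2"
  have c: "0 < c" unfolding c_def by (rule K0_pos)
  let ?P = "\<lambda>E. frob2 (2^M) (2^N) (plus_noise (\<lambda>i j. lam2 * K2 i j) E)"
  note P = frob2_plus_noise_expectation[of "\<lambda>i j. lam2 * K2 i j", unfolded frob2_lam2_K2]
  have iP: "integrable (gauss I) (\<lambda>E. ln c + (?P E / c - 1))" using P(1) by simp
  have "(\<integral>E. ln (res m0 n0 E) \<partial>gauss I) \<le> (\<integral>E. ln c + (?P E / c - 1) \<partial>gauss I)"
  proof (rule integral_mono_AE[OF i iP])
    show "AE E in gauss I. ln (res m0 n0 E) \<le> ln c + (?P E / c - 1)"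
      using res_small_ball(1)[OF cfg0]
    proof eventually_elim
      case (elim E)
      have "ln (res m0 n0 E / c) \<le> res m0 n0 E / c - 1" using elim c by (intro ln_le_minus_one) simp
      also have "\<dots> \<le> ?P E / c - 1" using res_true_le[of E] c by (simp add: divide_right_mono)
      finally show ?case using elim c by (simp add: ln_div)
    qed
  qed
  also have "\<dots> = ln c"
  proof -
    have "expectation ?P = c" unfolding c_def P(2) by (rule add.commute)
    then show ?thesis using P(1) c by (simp add: prob_space)
  qed
  finally show "(\<integral>E. ln (res m0 n0 E) \<partial>gauss I) \<le> ln (sig\<^sup>2 + lam2\<^sup>2)" unfolding c_def .
qed

text \<open>The loss \<open>2 * ln 2 / p\<close> in the logarithm is cancelled by the penalty of the
  wrong configuration; the penalty of the true one remains. The constant is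
  \<open>384 = 4 * (48 + 48)\<close>, from the operator norm and the Frobenius norm. One
  \<open>Q\<close> serves all configurations because \<open>p \<le> sqrt D\<close>.\<close>

lemma expectation_gap:
  assumes mn: "(m, n) \<in> cfgsW M N m0 n0" and G: "0 < G" and D20: "2^20 \<le> D" and k: "2 * ln 2 \<le> \<kappa>"
    and dev: "2^18 * (sig * (lam1 + lam2))\<^sup>2 \<le> S\<^sup>2 * sqrt D"
    and Q: "0 < Q" "sig^4 \<le> Q\<^sup>2 * D" "sqrt D * sig\<^sup>2 * (lam1 + lam2)\<^sup>2 \<le> Q\<^sup>2 * D"
  shows "D * (alpha - 384 * Q / S - 2 * exp (2^18 - 2 * sqrt D) * (alpha + D) - (4008 + 3 * (ln (4 * D))\<^sup>2) / D)
      - \<kappa> * (real (rows m0 n0) + real (cols m0 n0))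
    \<le> (\<integral>E. IC \<kappa> M N m n (plus_noise X E) \<partial>gauss I) - (\<integral>E. IC \<kappa> M N m0 n0 (plus_noise X E) \<partial>gauss I)"
proof -
  interpret prob_space "gauss I" by (rule prob_space_gauss)
  note mn' = cfgsW_mem[OF mn]
  define p where "p = pmin m n"
  have p2: "2 \<le> p" unfolding p_def by (rule pmin_ge_two(3)[OF mn'(3)])
  have p1: "1 \<le> p" using p2 by simp
  have pD: "(real p)\<^sup>2 \<le> D" unfolding p_def by (rule pmin_sq[OF mn'(1,2)])
  have pQ: "real p * sig\<^sup>2 * (lam1 + lam2)\<^sup>2 \<le> Q\<^sup>2 * D"
  proof -
    have "real p * sig\<^sup>2 * (lam1 + lam2)\<^sup>2 \<le> sqrt D * sig\<^sup>2 * (lam1 + lam2)\<^sup>2"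
      unfolding p_def by (intro mult_right_mono pmin_le_sqrt mn') auto
    then show ?thesis using Q(3) by linarith
  qed
  have oneQ: "real 1 * sig\<^sup>2 * (lam1 + lam2)\<^sup>2 \<le> Q\<^sup>2 * D"
  proof -
    have "real 1 * sig\<^sup>2 * (lam1 + lam2)\<^sup>2 \<le> sqrt D * sig\<^sup>2 * (lam1 + lam2)\<^sup>2"
      using D_ge1 by (intro mult_right_mono) auto
    then show ?thesis using Q(3) by linarith
  qed
  have oneD: "(real 1)\<^sup>2 \<le> D" using D_ge1 by simp
  note SK = S_factor
  have S0: "0 < S" "sig\<^sup>2 \<le> S" using K0_pos G by (auto simp: S_def)
  from config_noise[OF mn'(1,2), folded p_def] obtain H where H: "noise_ctrl p (lam1 + lam2) H"
    "\<And>E. (opnorm (rows m n) (cols m n) (rearr M N m n (plus_noise X E)))\<^sup>2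
      \<le> (opnorm (rows m n) (cols m n) (rearr M N m n X))\<^sup>2 + sig\<^sup>2 / real p + H E"
    by blast
  obtain F where F: "noise_ctrl 1 (lam1 + lam2) F"
    "\<And>E. \<bar>frob2 (2^M) (2^N) (plus_noise X E) - frob2 (2^M) (2^N) X - sig\<^sup>2\<bar> \<le> F E"
    using frob_noise[OF frob2_X_le] by blast
  define err where "err = (\<lambda>E. H E + F E)"
  have Hm: "H \<in> borel_measurable (gauss I)" and Fm: "F \<in> borel_measurable (gauss I)"
    by (rule noise_ctrl_meas[OF H(1)], rule noise_ctrl_meas[OF F(1)])
  have em: "err \<in> borel_measurable (gauss I)" unfolding err_def by (intro borel_measurable_add Hm Fm)
  note HE = noise_ctrl_expectation[OF H(1) p1 pD Q(1,2) pQ]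
  note FE = noise_ctrl_expectation[OF F(1) order.refl oneD Q(1,2) oneQ]
  define b where "b = 2 * exp (2^18 - 2 * sqrt D)"
  have bd: "prob {E\<in>space (gauss I). S / 8 \<le> err E} \<le> b"
  proof -
    have a: "{E\<in>space (gauss I). S / 16 \<le> H E} \<in> events" "{E\<in>space (gauss I). S / 16 \<le> F E} \<in> events"
      by (rule borel_measurable_le[OF borel_measurable_const Hm], rule borel_measurable_le[OF borel_measurable_const Fm])
    have sub: "{E\<in>space (gauss I). S / 8 \<le> err E} \<subseteq> {E\<in>space (gauss I). S / 16 \<le> H E} \<union> {E\<in>space (gauss I). S / 16 \<le> F E}"
    proof
      fix E assume "E \<in> {E\<in>space (gauss I). S / 8 \<le> err E}"
      then have E: "E \<in> space (gauss I)" "S / 8 \<le> H E + F E" by (simp_all add: err_def)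
      then have "S / 16 \<le> H E \<or> S / 16 \<le> F E" by linarith
      then show "E \<in> {E\<in>space (gauss I). S / 16 \<le> H E} \<union> {E\<in>space (gauss I). S / 16 \<le> F E}" using E(1) by blast
    qed
    have "prob {E\<in>space (gauss I). S / 8 \<le> err E} \<le>
      prob ({E\<in>space (gauss I). S / 16 \<le> H E} \<union> {E\<in>space (gauss I). S / 16 \<le> F E})"
      by (rule finite_measure_mono[OF sub sets.Un[OF a]])
    also have "\<dots> \<le> prob {E\<in>space (gauss I). S / 16 \<le> H E} + prob {E\<in>space (gauss I). S / 16 \<le> F E}"
      by (rule measure_Un_le[OF a])
    also have "\<dots> \<le> exp (2^18 - 2 * sqrt D) + exp (2^18 - 2 * sqrt D)"
      by (intro add_mono noise_ctrl_large_dev[OF H(1) p1 pD D20 S0 dev] noise_ctrl_large_dev[OF F(1) order.refl oneD D20 S0 dev])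
    finally show ?thesis by (simp add: b_def)
  qed
  have key: "integrable (gauss I) (\<lambda>E. ln (res m n E))"
    "ln S - 2 * ln 2 / real p - 4 * (96 * Q) / S - b * (ln (1 + G / (sig\<^sup>2 + lam2\<^sup>2)) + D) - (4008 + 3 * (ln (4 * D))\<^sup>2) / D
      \<le> (\<integral>E. ln (res m n E) \<partial>gauss I)"
  proof -
    note r = expected_ln_residual_lower[where res = "res m n" and err = err and Nn = noise_energy and K = "sig\<^sup>2 + lam2\<^sup>2" and sv = "sig\<^sup>2"
        and p = "real p" and U = "\<lambda>E. frob2 (2^M) (2^N) (plus_noise X E)", OF res_meas[OF mn'(1,2)] em noise_energy K0_pos _ SK _ _ _ D_ge1
         res_small_ball(1)[OF mn'(3)] _ _ _ _ res_ratio[OF mn less_imp_le[OF G]] res_small_ball(2)[OF mn'(3)] res_le_frob2 frob2_plus_noise_expectation(1) bd]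
    have lower: "S - sig\<^sup>2 / real p - err E \<le> res m n E" for E
      unfolding err_def p_def by (rule res_wrong_ge[OF mn H(2)[unfolded p_def] F(2)])
    have e0: "0 \<le> err E" for E unfolding err_def using noise_ctrl_nonneg[OF H(1)] noise_ctrl_nonneg[OF F(1)] by (rule add_nonneg_nonneg)
    have ei: "integrable (gauss I) err" unfolding err_def using HE(1) FE(1) by simp
    have e96: "integral\<^sup>L (gauss I) err \<le> 96 * Q" unfolding err_def using HE FE by simp
    have g: "0 \<le> G / (sig\<^sup>2 + lam2\<^sup>2)" "0 < sig\<^sup>2" "sig\<^sup>2 \<le> sig\<^sup>2 + lam2\<^sup>2" "2 \<le> real p" using G K0_pos sig p2 by auto
    show "integrable (gauss I) (\<lambda>E. ln (res m n E))" by (rule r(1)[OF g lower e0 ei e96])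
    show "ln S - 2 * ln 2 / real p - 4 * (96 * Q) / S - b * (ln (1 + G / (sig\<^sup>2 + lam2\<^sup>2)) + D) - (4008 + 3 * (ln (4 * D))\<^sup>2) / D
      \<le> (\<integral>E. ln (res m n E) \<partial>gauss I)" by (rule r(2)[OF g lower e0 ei e96])
  qed
  have IC: "(\<integral>E. IC \<kappa> M N m' n' (plus_noise X E) \<partial>gauss I) = D * (\<integral>E. ln (res m' n' E) \<partial>gauss I) + \<kappa> * (real (rows m' n') + real (cols m' n'))"
    if "m' \<le> M" "n' \<le> N" "integrable (gauss I) (\<lambda>E. ln (res m' n' E))" for m' n'
    unfolding IC_eq[OF that(1,2)] using that(3) by (simp add: prob_space)
  have lnS: "ln S = ln (sig\<^sup>2 + lam2\<^sup>2) + alpha"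
  proof -
    have "0 \<le> G / (sig\<^sup>2 + lam2\<^sup>2)" using G K0_pos by simp
    then show ?thesis unfolding alpha_def SK using K0_pos by (intro ln_mult_pos) auto
  qed
  define V where "V = alpha - 384 * Q / S - b * (alpha + D) - (4008 + 3 * (ln (4 * D))\<^sup>2) / D"
  have "ln (sig\<^sup>2 + lam2\<^sup>2) + V - 2 * ln 2 / real p \<le> (\<integral>E. ln (res m n E) \<partial>gauss I)"
    using key(2) unfolding lnS alpha_def[symmetric] V_def by simp
  moreover note log_residual_expectation_true(2)
  ultimately have "V - 2 * ln 2 / real p \<le> (\<integral>E. ln (res m n E) \<partial>gauss I) - (\<integral>E. ln (res m0 n0 E) \<partial>gauss I)" by linarith
  then have "D * (V - 2 * ln 2 / real p) \<le> D * ((\<integral>E. ln (res m n E) \<partial>gauss I) - (\<integral>E. ln (res m0 n0 E) \<partial>gauss I))"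
    by (intro mult_left_mono) auto
  then have "D * V - D * (2 * ln 2 / real p) \<le> D * (\<integral>E. ln (res m n E) \<partial>gauss I) - D * (\<integral>E. ln (res m0 n0 E) \<partial>gauss I)"
    by (simp only: right_diff_distrib)
  moreover have "D * (2 * ln 2 / real p) \<le> \<kappa> * (real (rows m n) + real (cols m n))"
    unfolding p_def by (rule penalty_ge[OF mn'(1,2) k])
  ultimately show ?thesis
    unfolding IC[OF mn'(1,2) key(1)] IC[OF m0 n0 log_residual_expectation_true(1)] V_def b_def by linarith
qed

text \<open>The smaller dimension is \<open>2^k\<close>, with \<open>k\<close> the distance of the
  configuration from one of the two corners, and \<open>c * 2^k \<ge> c + k\<close>. This leaves the
  prefactor \<open>exp (- c)\<close> and products of geometric series, whose sums do not depend on
  \<open>M\<close> and \<open>N\<close>; the two corners give \<open>4 + 4\<close>.\<close>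

lemma sum_exp_pmin_le:
  assumes c: "1 \<le> c"
  shows "(\<Sum>(m, n)\<in>cfgsW M N m0 n0. exp (- c * real (pmin m n))) \<le> 8 * exp (- c)"
proof -
  let ?B = "{..M} \<times> {..N}"
  have two: "c + real k \<le> c * 2^k" for k :: nat
  proof -
    have "real k + 1 \<le> 2^k" by (metis Suc_eq_plus1 Suc_leI less_exp of_nat_Suc of_nat_le_iff of_nat_numeral of_nat_power add.commute)
    then have "c * (real k + 1) \<le> c * 2^k" using c by (intro mult_left_mono) auto
    moreover have "real k \<le> c * real k" using c mult_right_mono[of 1 c "real k"] by simp
    ultimately show ?thesis by (simp add: algebra_simps)
  qed
  have pt: "exp (- c * real (pmin m n)) \<le> exp (- c) * (exp (- real m) * exp (- real n)) + exp (- c) * (exp (- real (M - m)) * exp (- real (N - n)))"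
    if "m \<le> M" "n \<le> N" for m n
  proof -
    have cc: "cols m n = 2^((M - m) + (N - n))" using that by (simp add: cols_def)
    have "exp (- c * real (rows m n)) \<le> exp (- c) * (exp (- real m) * exp (- real n))"
      using two[of "m + n"] by (simp add: rows_def flip: exp_add)
    moreover have "exp (- c * real (cols m n)) \<le> exp (- c) * (exp (- real (M - m)) * exp (- real (N - n)))"
      using two[of "(M - m) + (N - n)"] by (simp add: cc flip: exp_add)
    moreover have "exp (- c * real (pmin m n)) = exp (- c * real (rows m n)) \<or> exp (- c * real (pmin m n)) = exp (- c * real (cols m n))"
      by (auto simp: pmin_def min_def)
    moreover have "0 \<le> exp (- c) * (exp (- real m) * exp (- real n))" "0 \<le> exp (- c) * (exp (- real (M - m)) * exp (- real (N - n)))" by simp_all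
    ultimately show ?thesis by linarith
  qed
  have "(\<Sum>(m, n)\<in>cfgsW M N m0 n0. exp (- c * real (pmin m n))) \<le> (\<Sum>(m, n)\<in>?B. exp (- c * real (pmin m n)))"
    by (intro sum_mono2) (auto simp: cfgsW_def cfgs_def)
  also have "\<dots> \<le> (\<Sum>(m, n)\<in>?B. exp (- c) * (exp (- real m) * exp (- real n)) + exp (- c) * (exp (- real (M - m)) * exp (- real (N - n))))"
    by (intro sum_mono) (use pt in auto)
  also have "\<dots> = (\<Sum>m\<le>M. \<Sum>n\<le>N. exp (- c) * (exp (- real m) * exp (- real n)) + exp (- c) * (exp (- real (M - m)) * exp (- real (N - n))))"
    by (rule sum.cartesian_product[symmetric])
  also have "\<dots> = exp (- c) * ((\<Sum>m\<le>M. exp (- real m)) * (\<Sum>n\<le>N. exp (- real n)))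
      + exp (- c) * ((\<Sum>m\<le>M. exp (- real (M - m))) * (\<Sum>n\<le>N. exp (- real (N - n))))"
    by (simp only: sum.distrib sum_distrib_left[symmetric] sum_product)
  also have "(\<Sum>m\<le>M. exp (- real (M - m))) = (\<Sum>m\<le>M. exp (- real m))"
    by (rule sum.reindex_bij_witness[of _ "\<lambda>m. M - m" "\<lambda>m. M - m"]) auto
  also have "(\<Sum>n\<le>N. exp (- real (N - n))) = (\<Sum>n\<le>N. exp (- real n))"
    by (rule sum.reindex_bij_witness[of _ "\<lambda>m. N - m" "\<lambda>m. N - m"]) auto
  also have "exp (- c) * ((\<Sum>m\<le>M. exp (- real m)) * (\<Sum>n\<le>N. exp (- real n)))
      + exp (- c) * ((\<Sum>m\<le>M. exp (- real m)) * (\<Sum>n\<le>N. exp (- real n))) \<le> exp (- c) * (2 * 2) + exp (- c) * (2 * 2)"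
    by (intro add_mono mult_left_mono mult_mono sum_exp_minus_le_two sum_nonneg) auto
  finally show ?thesis by simp
qed

text \<open>The exceptional event collects large operator norm errors of the wrong configurations,
  with total weight 8, and two Frobenius norm errors of weight 1 each: one for the data and one for
  the bound on the true residual. Off this event the comparison is deterministic apart from
  positivity of the residual.\<close>

lemma probability_gap:
  assumes G: "0 < G" and k: "2 * ln 2 \<le> \<kappa>" and K: "96 \<le> K"
    and Q: "0 < Q" "sig^4 \<le> Q\<^sup>2 * D" "sqrt D * sig\<^sup>2 * (lam1 + lam2)\<^sup>2 \<le> Q\<^sup>2 * D"
    and KQ: "16 * (K * Q) \<le> S"
    and gap: "\<kappa> * (real (rows m0 n0) + real (cols m0 n0)) < D * (alpha - 8 * (K * Q) / S - 2 * K / sqrt D)"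
  shows "1 - 10 * exp (- (K / 16)) \<le> measure (gauss I) {E\<in>space (gauss I).
     \<forall>(m, n)\<in>cfgsW M N m0 n0. IC \<kappa> M N m0 n0 (plus_noise X E) < IC \<kappa> M N m n (plus_noise X E)}"
proof -
  interpret prob_space "gauss I" by (rule prob_space_gauss)
  let ?W = "cfgsW M N m0 n0"
  have fin: "finite ?W" by (rule finite_subset[of _ "{0..M} \<times> {0..N}"]) (auto simp: cfgsW_def cfgs_def)
  have oneD: "(real 1)\<^sup>2 \<le> D" using D_ge1 by simp
  have oneQ: "real 1 * sig\<^sup>2 * (lam1 + lam2)\<^sup>2 \<le> Q\<^sup>2 * D"
  proof -
    have "real 1 * sig\<^sup>2 * (lam1 + lam2)\<^sup>2 \<le> sqrt D * sig\<^sup>2 * (lam1 + lam2)\<^sup>2"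
      using D_ge1 by (intro mult_right_mono) auto
    then show ?thesis using Q(3) by linarith
  qed
  have S0: "0 < S" "sig\<^sup>2 \<le> S" using K0_pos G by (auto simp: S_def)
  define c where "c = sig\<^sup>2 + lam2\<^sup>2"
  have c0: "0 < c" unfolding c_def by (rule K0_pos)
  have lnS: "ln S = ln c + alpha"
  proof -
    have "S = c * (1 + G / c)" unfolding c_def by (rule S_factor)
    moreover have "0 \<le> G / c" using G c0 by simp
    ultimately show ?thesis unfolding alpha_def c_def[symmetric] using c0 by (simp only:) (intro ln_mult_pos, auto)
  qed
  have "\<forall>mn\<in>?W. \<exists>H. noise_ctrl (pmin (fst mn) (snd mn)) (lam1 + lam2) H \<and>
    (\<forall>E. (opnorm (rows (fst mn) (snd mn)) (cols (fst mn) (snd mn)) (rearr M N (fst mn) (snd mn) (plus_noise X E)))\<^sup>2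
      \<le> (opnorm (rows (fst mn) (snd mn)) (cols (fst mn) (snd mn)) (rearr M N (fst mn) (snd mn) X))\<^sup>2 + sig\<^sup>2 / real (pmin (fst mn) (snd mn)) + H E)"
  proof
    fix mn assume "mn \<in> ?W"
    then have "(fst mn, snd mn) \<in> ?W" by simp
    show "\<exists>H. noise_ctrl (pmin (fst mn) (snd mn)) (lam1 + lam2) H \<and>
    (\<forall>E. (opnorm (rows (fst mn) (snd mn)) (cols (fst mn) (snd mn)) (rearr M N (fst mn) (snd mn) (plus_noise X E)))\<^sup>2
      \<le> (opnorm (rows (fst mn) (snd mn)) (cols (fst mn) (snd mn)) (rearr M N (fst mn) (snd mn) X))\<^sup>2 + sig\<^sup>2 / real (pmin (fst mn) (snd mn)) + H E)"
      by (rule config_noise[OF cfgsW_mem(1,2)[OF \<open>(fst mn, snd mn) \<in> ?W\<close>]])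
  qed
  from bchoice[OF this] obtain Hf where Hf:
    "\<And>m n. (m, n) \<in> ?W \<Longrightarrow> noise_ctrl (pmin m n) (lam1 + lam2) (Hf (m, n))"
    "\<And>m n E. (m, n) \<in> ?W \<Longrightarrow> (opnorm (rows m n) (cols m n) (rearr M N m n (plus_noise X E)))\<^sup>2
      \<le> (opnorm (rows m n) (cols m n) (rearr M N m n X))\<^sup>2 + sig\<^sup>2 / real (pmin m n) + Hf (m, n) E"
    by fastforce
  obtain F where F: "noise_ctrl 1 (lam1 + lam2) F"
    "\<And>E. \<bar>frob2 (2^M) (2^N) (plus_noise X E) - frob2 (2^M) (2^N) X - sig\<^sup>2\<bar> \<le> F E"
    using frob_noise[OF frob2_X_le] by blast
  obtain F2 where F2: "noise_ctrl 1 lam2 F2"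
    "\<And>E. \<bar>frob2 (2^M) (2^N) (plus_noise (\<lambda>i j. lam2 * K2 i j) E) - lam2\<^sup>2 - sig\<^sup>2\<bar> \<le> F2 E"
    using frob_noise[OF eq_refl[OF frob2_lam2_K2]] unfolding frob2_lam2_K2 by blast
  \<comment> \<open>The bound on the true residual involves only the second term as signal, so this
    scale omits \<open>lam1\<close>; relative to \<open>c\<close> it is at most
    \<open>2 / sqrt D\<close>.\<close>
  define Q2 where "Q2 = (sig\<^sup>2 + sig * lam2) / sqrt D"
  have Q2: "0 < Q2" "sig^4 \<le> Q2\<^sup>2 * D" "real 1 * sig\<^sup>2 * lam2\<^sup>2 \<le> Q2\<^sup>2 * D"
  proof -
    have pos: "0 < sig * lam2" "0 < sig\<^sup>2" using sig lam by auto
    show "0 < Q2" unfolding Q2_def using pos by (intro divide_pos_pos add_pos_pos) auto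
    have eq: "Q2\<^sup>2 * D = (sig\<^sup>2 + sig * lam2)\<^sup>2" by (simp add: Q2_def power_divide)
    have "sig^4 = (sig\<^sup>2)\<^sup>2" by (simp flip: power_mult)
    also have "\<dots> \<le> Q2\<^sup>2 * D" unfolding eq using pos by (intro power_mono) auto
    finally show "sig^4 \<le> Q2\<^sup>2 * D" .
    have "real 1 * sig\<^sup>2 * lam2\<^sup>2 = (sig * lam2)\<^sup>2" by (simp add: power_mult_distrib)
    also have "\<dots> \<le> Q2\<^sup>2 * D" unfolding eq using pos by (intro power_mono) auto
    finally show "real 1 * sig\<^sup>2 * lam2\<^sup>2 \<le> Q2\<^sup>2 * D" .
  qed
  have Q2c: "Q2 \<le> 2 * c / sqrt D"
  proof -
    have "sig * lam2 \<le> c" using sum_squares_bound[of sig lam2] zero_le_power2[of sig] zero_le_power2[of lam2] unfolding c_def by linarith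
    moreover have "a \<le> s + l \<Longrightarrow> 0 \<le> l \<Longrightarrow> s + a \<le> 2 * (s + l)" for a s l :: real by simp
    ultimately have "sig\<^sup>2 + sig * lam2 \<le> 2 * c" unfolding c_def using zero_le_power2 by blast
    then show ?thesis unfolding Q2_def by (intro divide_right_mono) auto
  qed
  define BH where "BH = (\<lambda>mn. {E\<in>space (gauss I). K * Q \<le> Hf mn E})"
  define BF where "BF = {E\<in>space (gauss I). K * Q \<le> F E}"
  define B2 where "B2 = {E\<in>space (gauss I). K * Q2 \<le> F2 E}"
  define A where "A = {E\<in>space (gauss I). \<forall>(m, n)\<in>?W. IC \<kappa> M N m0 n0 (plus_noise X E) < IC \<kappa> M N m n (plus_noise X E)}"
  have BHs: "BH mn \<in> events" if "mn \<in> ?W" for mn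
  proof -
    have "noise_ctrl (pmin (fst mn) (snd mn)) (lam1 + lam2) (Hf mn)" using Hf(1)[of "fst mn" "snd mn"] that by simp
    from borel_measurable_le[OF borel_measurable_const noise_ctrl_meas[OF this]] show ?thesis unfolding BH_def .
  qed
  have BFs: "BF \<in> events" unfolding BF_def by (rule borel_measurable_le[OF borel_measurable_const noise_ctrl_meas[OF F(1)]])
  have B2s: "B2 \<in> events" unfolding B2_def by (rule borel_measurable_le[OF borel_measurable_const noise_ctrl_meas[OF F2(1)]])
  have UNs: "(\<Union>mn\<in>?W. BH mn) \<in> events" using fin BHs by (intro sets.finite_UN) auto
  have ICm: "(\<lambda>E. IC \<kappa> M N m n (plus_noise X E)) \<in> borel_measurable (gauss I)" if "m \<le> M" "n \<le> N" for m n
  proof -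
    have "(\<lambda>E. ln (res m n E)) \<in> borel_measurable (gauss I)"
      by (rule measurable_compose[OF res_meas[OF that]]) measurable
    then show ?thesis unfolding IC_eq[OF that]
      by (intro borel_measurable_add borel_measurable_times borel_measurable_const)
  qed
  have As: "A \<in> events"
  proof -
    have "A = {E\<in>space (gauss I). \<forall>mn\<in>?W. IC \<kappa> M N m0 n0 (plus_noise X E) < IC \<kappa> M N (fst mn) (snd mn) (plus_noise X E)}"
      unfolding A_def by (auto simp: case_prod_unfold)
    also have "\<dots> \<in> events"
    proof (rule sets.sets_Collect_finite_All[OF _ fin])
      fix mn assume "mn \<in> ?W"
      then have "(fst mn, snd mn) \<in> ?W" by simp
      note mn' = cfgsW_mem[OF this]
      show "{E\<in>space (gauss I). IC \<kappa> M N m0 n0 (plus_noise X E) < IC \<kappa> M N (fst mn) (snd mn) (plus_noise X E)} \<in> events"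
        by (rule borel_measurable_less[OF ICm[OF m0 n0] ICm[OF mn'(1,2)]])
    qed
    finally show ?thesis .
  qed
  define B where "B = (\<Union>mn\<in>?W. BH mn) \<union> (BF \<union> B2)"
  have Bs: "B \<in> events" unfolding B_def using UNs BFs B2s by auto
  have PB: "prob B \<le> 10 * exp (- (K / 16))"
  proof -
    have "prob (\<Union>mn\<in>?W. BH mn) \<le> (\<Sum>mn\<in>?W. prob (BH mn))"
      using fin BHs by (intro finite_measure_subadditive_finite) auto
    also have "\<dots> \<le> (\<Sum>mn\<in>?W. exp (- (K / 16) * real (pmin (fst mn) (snd mn))))"
    proof (rule sum_mono)
      fix mn assume mnW: "mn \<in> ?W"
      obtain m n where mn: "mn = (m, n)" by fastforce
      have W: "(m, n) \<in> ?W" using mnW mn by simp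
      note mn' = cfgsW_mem[OF W]
      have p1: "1 \<le> pmin m n" using pmin_ge_two(3)[OF mn'(3)] by simp
      have pQ: "real (pmin m n) * sig\<^sup>2 * (lam1 + lam2)\<^sup>2 \<le> Q\<^sup>2 * D"
      proof -
        have "real (pmin m n) * sig\<^sup>2 * (lam1 + lam2)\<^sup>2 \<le> sqrt D * sig\<^sup>2 * (lam1 + lam2)\<^sup>2"
          by (intro mult_right_mono pmin_le_sqrt mn') auto
        then show ?thesis using Q(3) by linarith
      qed
      show "prob (BH mn) \<le> exp (- (K / 16) * real (pmin (fst mn) (snd mn)))"
        unfolding BH_def mn fst_conv snd_conv
        by (rule noise_ctrl_tail[OF Hf(1)[OF W] p1 pmin_sq[OF mn'(1,2)] Q(1,2) pQ K])
    qed
    also have "\<dots> \<le> 8 * exp (- (K / 16))"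
      using sum_exp_pmin_le[of "K / 16"] K by (simp add: case_prod_unfold)
    finally have 1: "prob (\<Union>mn\<in>?W. BH mn) \<le> 8 * exp (- (K / 16))" .
    have 2: "prob BF \<le> exp (- (K / 16) * real 1)" unfolding BF_def
      by (rule noise_ctrl_tail[OF F(1) order.refl oneD Q(1,2) oneQ K])
    have 3: "prob B2 \<le> exp (- (K / 16) * real 1)" unfolding B2_def
      by (rule noise_ctrl_tail[OF F2(1) order.refl oneD Q2 K])
    have "prob B \<le> prob (\<Union>mn\<in>?W. BH mn) + prob (BF \<union> B2)"
      unfolding B_def using UNs BFs B2s by (intro measure_Un_le) auto
    also have "prob (BF \<union> B2) \<le> prob BF + prob B2" using BFs B2s by (intro measure_Un_le) auto
    finally show ?thesis using 1 2 3 by simp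
  qed
  have incl: "E \<in> A" if E: "E \<in> space (gauss I)" "E \<notin> B" "0 < res m0 n0 E" for E
  proof -
    have "ln (res m0 n0 E) \<le> ln c + 2 * K / sqrt D"
    proof -
      have "F2 E \<le> K * Q2" using E by (auto simp: B_def B2_def)
      also have "\<dots> \<le> K * (2 * c / sqrt D)" using Q2c K by (intro mult_left_mono) auto
      finally have "res m0 n0 E \<le> c + K * (2 * c / sqrt D)" using res_true_le[of E] F2(2)[of E] unfolding c_def by linarith
      then have "res m0 n0 E / c \<le> (c + K * (2 * c / sqrt D)) / c" using c0 by (intro divide_right_mono) auto
      also have "\<dots> = 1 + 2 * K / sqrt D" using c0 by (simp add: add_divide_distrib mult.commute)
      finally have "res m0 n0 E / c - 1 \<le> 2 * K / sqrt D" by simp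
      moreover have "ln (res m0 n0 E / c) \<le> res m0 n0 E / c - 1" using E c0 by (intro ln_le_minus_one) simp
      ultimately show ?thesis using E c0 by (simp add: ln_div)
    qed
    then have up: "D * ln (res m0 n0 E) \<le> D * (ln c + 2 * K / sqrt D)" by (intro mult_left_mono) auto
    have "IC \<kappa> M N m0 n0 (plus_noise X E) < IC \<kappa> M N m n (plus_noise X E)" if W: "(m, n) \<in> ?W" for m n
    proof -
      note mn' = cfgsW_mem[OF W]
      define p where "p = real (pmin m n)"
      have p2: "2 \<le> p" using pmin_ge_two(3)[OF mn'(3)] by (simp add: p_def)
      define e where "e = Hf (m, n) E + F E"
      have "E \<notin> BH (m, n)" "E \<notin> BF" using E W by (auto simp: B_def)
      then have e2: "e \<le> 2 * (K * Q)" using E(1) by (auto simp: BH_def BF_def e_def)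
      have e0: "0 \<le> e" unfolding e_def using noise_ctrl_nonneg[OF Hf(1)[OF W]] noise_ctrl_nonneg[OF F(1)] by (rule add_nonneg_nonneg)
      have e8: "e \<le> S / 8" using e2 KQ by linarith
      have "S - sig\<^sup>2 / p - e \<le> res m n E"
        unfolding e_def p_def by (rule res_wrong_ge[OF W Hf(2)[OF W] F(2)])
      from ln_residual_lower(2)[OF S0(1) zero_le_power2 S0(2) p2 e0 e8 this]
      have "ln S - 2 * ln 2 / p - 4 * e / S \<le> ln (res m n E)" .
      moreover have "4 * e / S \<le> 8 * (K * Q) / S" using e2 S0 by (intro divide_right_mono) auto
      ultimately have "ln c + alpha - 2 * ln 2 / p - 8 * (K * Q) / S \<le> ln (res m n E)" unfolding lnS by linarith
      then have "D * (ln c + alpha - 2 * ln 2 / p - 8 * (K * Q) / S) \<le> D * ln (res m n E)" by (intro mult_left_mono) auto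
      moreover have "D * (2 * ln 2 / p) \<le> \<kappa> * (real (rows m n) + real (cols m n))"
        unfolding p_def by (rule penalty_ge[OF mn'(1,2) k])
      ultimately show ?thesis using up gap unfolding IC_eq[OF mn'(1,2)] IC_eq[OF m0 n0]
        by (simp only: right_diff_distrib distrib_left)
    qed
    then show ?thesis using E(1) by (auto simp: A_def)
  qed
  have "1 - prob B = prob (space (gauss I) - B)" using Bs by (simp add: prob_compl)
  \<comment> \<open>The inclusion holds up to a null set, as it requires the true residual to be
    positive before its logarithm is compared.\<close>
  also have "\<dots> \<le> prob A"
  proof (rule finite_measure_mono_AE[OF _ As])
    show "AE E in gauss I. E \<in> space (gauss I) - B \<longrightarrow> E \<in> A"
      using res_small_ball(1)[OF cfg0] by eventually_elim (use incl in blast)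
  qed
  finally show ?thesis using PB unfolding A_def by linarith
qed

end

section \<open>Asymptotics\<close>

text \<open>The terms of the expectation gap without a factor \<open>alpha\<close>, expressed in
  units of \<open>alpha\<close> at \<open>s = sqrt D\<close>: from \<open>1 \<le> s * alpha\<close>
  follow \<open>D \<le> alpha * s^3\<close> and \<open>1 / D \<le> alpha / s\<close>.\<close>

definition remainder :: "real \<Rightarrow> real" where
  "remainder s = 2 * exp (2^18 - 2 * s) * (1 + s^3) + (4008 + 3 * (ln (4 * s\<^sup>2))\<^sup>2) / s"

lemma remainder_tendsto: "(remainder \<longlongrightarrow> 0) at_top"
  unfolding remainder_def by real_asymp

context two_term
begin

text \<open>The choice of \<open>Q\<close>: its second summand meets the requirement from the noise
  squared, its first the one from the cross term at the worst dimension
  \<open>p = sqrt D\<close>.\<close>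

definition noise_scale :: real where
  "noise_scale = (lam1 + lam2) * sig / 2 powr (real (M + N) / 4) + sig\<^sup>2 / sqrt D"

lemma noise_scale:
  shows "0 < noise_scale" "sig^4 \<le> noise_scale\<^sup>2 * D" "sqrt D * sig\<^sup>2 * (lam1 + lam2)\<^sup>2 \<le> noise_scale\<^sup>2 * D"
    and quarter_root: "(2 powr (real (M + N) / 4))\<^sup>2 = sqrt D"
proof -
  define r where "r = 2 powr (real (M + N) / 4)"
  have r: "0 < r" by (simp add: r_def)
  have "r\<^sup>2 = 2 powr (real (M + N) / 2)" unfolding r_def power2_eq_square powr_add[symmetric] by simp
  also have "\<dots> = sqrt (2 powr real (M + N))" by (simp add: powr_half_sqrt[symmetric] powr_powr)
  also have "2 powr real (M + N) = D" by (simp only: D_def powr_realpow zero_less_numeral)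
  finally show r2: "(2 powr (real (M + N) / 4))\<^sup>2 = sqrt D" by (simp only: r_def)
  have pos: "0 < (lam1 + lam2) * sig / r" "0 < sig\<^sup>2 / sqrt D" using lam sig r by auto
  have q: "noise_scale = (lam1 + lam2) * sig / r + sig\<^sup>2 / sqrt D" by (simp add: noise_scale_def r_def)
  show "0 < noise_scale" unfolding q using pos by linarith
  have "sig^4 = (sig\<^sup>2 / sqrt D)\<^sup>2 * D" by (simp add: power_divide flip: power_mult)
  also have "\<dots> \<le> noise_scale\<^sup>2 * D" unfolding q using pos by (intro mult_right_mono power_mono) auto
  finally show "sig^4 \<le> noise_scale\<^sup>2 * D" .
  have "sqrt D * sig\<^sup>2 * (lam1 + lam2)\<^sup>2 = ((lam1 + lam2) * sig / r)\<^sup>2 * D"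
  proof -
    have "((lam1 + lam2) * sig / r)\<^sup>2 * D = (lam1 + lam2)\<^sup>2 * sig\<^sup>2 * (D / sqrt D)"
      unfolding power_divide r2[folded r_def] by (simp add: power_mult_distrib)
    then show ?thesis by (simp add: real_div_sqrt)
  qed
  also have "\<dots> \<le> noise_scale\<^sup>2 * D" unfolding q using pos by (intro mult_right_mono power_mono) auto
  finally show "sqrt D * sig\<^sup>2 * (lam1 + lam2)\<^sup>2 \<le> noise_scale\<^sup>2 * D" .
qed

text \<open>With \<open>g = G / (sig^2 + lam2^2)\<close> this is
  \<open>ln (1 + g) \<ge> g / (1 + g)\<close>, whose right side is \<open>G / S\<close>. It converts
  errors relative to \<open>S\<close> into errors relative to \<open>alpha\<close>.\<close>

lemma alpha_ge:
  assumes "0 < G"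
  shows "G / S \<le> alpha" "0 < alpha" "0 < S" "G \<le> S"
proof -
  have c: "0 < sig\<^sup>2 + lam2\<^sup>2" by (rule K0_pos)
  have g: "0 < G / (sig\<^sup>2 + lam2\<^sup>2)" using assms c by simp
  show S: "0 < S" "G \<le> S" using assms c by (auto simp: S_def)
  have "ln (inverse (1 + G / (sig\<^sup>2 + lam2\<^sup>2))) \<le> inverse (1 + G / (sig\<^sup>2 + lam2\<^sup>2)) - 1"
    using g by (intro ln_le_minus_one) (simp add: add_pos_pos)
  then have "1 - inverse (1 + G / (sig\<^sup>2 + lam2\<^sup>2)) \<le> alpha" using g by (simp add: alpha_def ln_inverse)
  moreover have "inverse (1 + G / (sig\<^sup>2 + lam2\<^sup>2)) = (sig\<^sup>2 + lam2\<^sup>2) / S"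
  proof -
    have "inverse a = k / (k * a)" if "k \<noteq> 0" for k a :: real using that by (simp add: inverse_eq_divide)
    moreover have "sig\<^sup>2 + lam2\<^sup>2 \<noteq> 0" using c by linarith
    ultimately show ?thesis unfolding S_factor .
  qed
  moreover have "1 - (sig\<^sup>2 + lam2\<^sup>2) / S = G / S" using S(1) by (simp add: S_def field_simps)
  ultimately show "G / S \<le> alpha" by simp
  then show "0 < alpha" using divide_pos_pos[OF assms S(1)] by linarith
qed

lemma noise_scale_over_S:
  assumes "0 < G" "noise_scale \<le> \<delta> * G"
  shows "noise_scale / S \<le> \<delta> * alpha" "noise_scale \<le> \<delta> * S"
proof -
  have "0 < \<delta> * G" using assms noise_scale(1) by linarith
  then have d: "0 \<le> \<delta>" using assms(1) by (simp add: zero_less_mult_iff)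
  have "noise_scale / S \<le> \<delta> * (G / S)" using assms alpha_ge[OF assms(1)] by (simp add: divide_right_mono)
  also have "\<dots> \<le> \<delta> * alpha" using d alpha_ge[OF assms(1)] by (intro mult_left_mono)
  finally show "noise_scale / S \<le> \<delta> * alpha" .
  show "noise_scale \<le> \<delta> * S" using assms(2) mult_left_mono[OF alpha_ge(4)[OF assms(1)] d] by linarith
qed

lemma expectation_gap_asymp:
  assumes mn: "(m, n) \<in> cfgsW M N m0 n0" and G: "0 < G" and D20: "2^20 \<le> D" and k: "2 * ln 2 \<le> \<kappa>"
    and \<delta>: "noise_scale \<le> \<delta> * G" and dev: "2^9 * (sig * (lam1 + lam2)) \<le> 2 powr (real (M + N) / 4) * G"
    and sa: "1 \<le> sqrt D * alpha" and \<epsilon>: "\<kappa> * (real (rows m0 n0) + real (cols m0 n0)) = \<epsilon> * (D * alpha)"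
  shows "D * alpha * (1 + - (384 * \<delta> + remainder (sqrt D) + \<epsilon>))
    \<le> (\<integral>E. IC \<kappa> M N m n (plus_noise X E) \<partial>gauss I) - (\<integral>E. IC \<kappa> M N m0 n0 (plus_noise X E) \<partial>gauss I)"
proof -
  define s where "s = sqrt D"
  have s: "0 < s" "s\<^sup>2 = D" by (simp_all add: s_def)
  note a = alpha_ge[OF G]
  \<comment> \<open>The threshold \<open>2^9\<close> in the hypothesis is the square root of the
    constant in the large deviation bound; \<open>G \<le> S\<close> weakens the right side.\<close>
  have dev': "2^18 * (sig * (lam1 + lam2))\<^sup>2 \<le> S\<^sup>2 * sqrt D"
  proof -
    have "(2^9 * (sig * (lam1 + lam2)))\<^sup>2 \<le> (2 powr (real (M + N) / 4) * G)\<^sup>2"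
      using sig lam by (intro power_mono dev) auto
    also have "\<dots> = sqrt D * G\<^sup>2" by (simp only: power_mult_distrib quarter_root)
    also have "\<dots> \<le> sqrt D * S\<^sup>2" using G a by (intro mult_left_mono power_mono) auto
    finally show ?thesis by (simp add: power_mult_distrib mult.commute)
  qed
  have 1: "384 * noise_scale / S \<le> 384 * \<delta> * alpha" using noise_scale_over_S(1)[OF G \<delta>] by simp
  have one: "1 \<le> s * alpha" using sa by (simp add: s_def)
  have 2: "2 * exp (2^18 - 2 * sqrt D) * (alpha + D) \<le> alpha * (2 * exp (2^18 - 2 * s) * (1 + s^3))"
  proof -
    have "D * 1 \<le> D * (s * alpha)" using one by (intro mult_left_mono) auto
    also have "\<dots> = alpha * s^3" unfolding s(2)[symmetric] by (simp add: power2_eq_square power3_eq_cube)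
    finally have "alpha + D \<le> alpha * (1 + s^3)" by (simp add: distrib_left)
    then have "2 * exp (2^18 - 2 * s) * (alpha + D) \<le> 2 * exp (2^18 - 2 * s) * (alpha * (1 + s^3))" by (intro mult_left_mono) auto
    then show ?thesis by (simp add: s_def ac_simps)
  qed
  have 3: "(4008 + 3 * (ln (4 * D))\<^sup>2) / D \<le> alpha * ((4008 + 3 * (ln (4 * s\<^sup>2))\<^sup>2) / s)"
  proof -
    have "1 / D \<le> alpha / s" unfolding s(2)[symmetric] using one s(1) by (simp add: power2_eq_square field_simps)
    then have "(4008 + 3 * (ln (4 * D))\<^sup>2) * (1 / D) \<le> (4008 + 3 * (ln (4 * D))\<^sup>2) * (alpha / s)"
      by (intro mult_left_mono) auto
    then show ?thesis unfolding s(2) by (simp add: mult.commute)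
  qed
  have r: "alpha * remainder s = alpha * (2 * exp (2^18 - 2 * s) * (1 + s^3)) + alpha * ((4008 + 3 * (ln (4 * s\<^sup>2))\<^sup>2) / s)"
    unfolding remainder_def by (rule distrib_left)
  have "alpha - 384 * \<delta> * alpha - alpha * remainder s \<le> alpha - 384 * noise_scale / S - 2 * exp (2^18 - 2 * sqrt D) * (alpha + D) - (4008 + 3 * (ln (4 * D))\<^sup>2) / D"
    using 1 2 3 r by linarith
  then have "D * (alpha - 384 * \<delta> * alpha - alpha * remainder s) \<le> D * (alpha - 384 * noise_scale / S - 2 * exp (2^18 - 2 * sqrt D) * (alpha + D) - (4008 + 3 * (ln (4 * D))\<^sup>2) / D)"
    by (intro mult_left_mono) auto
  moreover have "D * alpha * (1 + - (384 * \<delta> + remainder (sqrt D) + \<epsilon>)) = D * (alpha - 384 * \<delta> * alpha - alpha * remainder s) - \<epsilon> * (D * alpha)"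
    by (simp add: s_def algebra_simps)
  ultimately show ?thesis using expectation_gap[OF mn G D20 k dev' noise_scale(1-3)] unfolding \<epsilon> by linarith
qed

lemma probability_gap_asymp:
  assumes G: "0 < G" and k: "2 * ln 2 \<le> \<kappa>" and K: "96 \<le> K"
    and \<delta>: "noise_scale \<le> \<delta> * G" and \<epsilon>: "\<kappa> * (real (rows m0 n0) + real (cols m0 n0)) = \<epsilon> * (D * alpha)"
    and small: "16 * K * \<delta> \<le> 1" "\<epsilon> + 8 * K * \<delta> + 2 * K / (sqrt D * alpha) < 1"
  shows "1 - 10 * exp (- (K / 16)) \<le> measure (gauss I) {E\<in>space (gauss I).
     \<forall>(m, n)\<in>cfgsW M N m0 n0. IC \<kappa> M N m0 n0 (plus_noise X E) < IC \<kappa> M N m n (plus_noise X E)}"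
proof (rule probability_gap[OF G k K noise_scale(1-3)])
  note a = alpha_ge[OF G]
  note ns = noise_scale_over_S[OF G \<delta>]
  have "16 * K * noise_scale \<le> 16 * K * (\<delta> * S)" using ns(2) K by (intro mult_left_mono) auto
  also have "\<dots> = (16 * K * \<delta>) * S" by simp
  also have "\<dots> \<le> 1 * S" using small a by (intro mult_right_mono) auto
  finally show "16 * (K * noise_scale) \<le> S" by simp
  have "8 * (K * noise_scale) / S \<le> 8 * K * (\<delta> * alpha)"
    using mult_left_mono[OF ns(1), of "8 * K"] K by simp
  moreover have "2 * K / sqrt D = 2 * K / (sqrt D * alpha) * alpha" using a by simp
  moreover have "(\<epsilon> + 8 * K * \<delta> + 2 * K / (sqrt D * alpha)) * alpha < 1 * alpha"
    using small(2) a by (intro mult_strict_right_mono)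
  ultimately have "\<epsilon> * alpha < alpha - 8 * (K * noise_scale) / S - 2 * K / sqrt D"
    by (simp only: distrib_right mult.assoc mult_1_left)
  then have "D * (\<epsilon> * alpha) < D * (alpha - 8 * (K * noise_scale) / S - 2 * K / sqrt D)"
    by (intro mult_strict_left_mono) auto
  then show "\<kappa> * (real (rows m0 n0) + real (cols m0 n0)) < D * (alpha - 8 * (K * noise_scale) / S - 2 * K / sqrt D)"
    unfolding \<epsilon> by (simp only: mult.left_commute)
qed

end

section \<open>From the growth conditions to the sizes of the errors\<close>

context two_term
begin

lemma rows_plus_cols: "real (rows m0 n0) + real (cols m0 n0) = 2^(m0+n0) + 2^(M+N-m0-n0)"
  by (simp only: rows_def cols_def of_nat_power of_nat_numeral)

text \<open>By the arithmetic-geometric mean inequality the true configuration has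
  \<open>rows + cols \<ge> 2 sqrt D\<close>, so the first signal-to-noise condition also dominates the noise level.\<close>
lemma scale_facts:
  assumes a2: "a2 = 2 powr (real (M + N) / 4) * (G / ((lam1 + lam2) * sig))" "2^9 \<le> a2"
    and a1: "a1 = D / (real (rows m0 n0) + real (cols m0 n0)) * (G / (sig\<^sup>2 + lam2\<^sup>2))" "0 < a1"
  shows "0 < G" "noise_scale \<le> (1 / a2 + 1 / a1) * G"
    "2^9 * (sig * (lam1 + lam2)) \<le> 2 powr (real (M + N) / 4) * G"
    "min a1 (sqrt D) / 2 \<le> sqrt D * alpha"
proof -
  define r s P c where "r = 2 powr (real (M + N) / 4)" and "s = sqrt D"
    and "P = real (rows m0 n0) + real (cols m0 n0)" and "c = sig\<^sup>2 + lam2\<^sup>2"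
  have r: "0 < r" "0 < (lam1 + lam2) * sig" using lam sig by (auto simp: r_def)
  have s: "0 < s" "D = s\<^sup>2" by (simp_all add: s_def)
  have c: "0 < c" "sig\<^sup>2 \<le> c" using K0_pos by (auto simp: c_def)
  have "(2 * s)\<^sup>2 \<le> P\<^sup>2"
  proof -
    have "0 \<le> (real (rows m0 n0) - real (cols m0 n0))\<^sup>2" by simp
    then have "4 * (real (rows m0 n0) * real (cols m0 n0)) \<le> P\<^sup>2"
      by (simp add: P_def power2_sum power2_diff)
    then show ?thesis by (simp only: rows_cols(1)[OF m0 n0] s(2) power_mult_distrib) simp
  qed
  then have P2: "2 * s \<le> P" by (rule power2_le_imp_le) (simp add: P_def)
  then have P: "0 < P" using s by linarith
  have ra: "r * G = a2 * ((lam1 + lam2) * sig)" 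
  proof -
    have "a * G = a * (G / h) * h" if "0 < h" for a h :: real using that by simp
    then show ?thesis unfolding a2(1) r_def[symmetric] using r(2) .
  qed
  have a20: "0 < a2" using a2(2) by (rule less_le_trans[rotated]) simp
  have "0 < r * G" unfolding ra using a20 r by simp
  then show G: "0 < G" using r(1) by (simp add: zero_less_mult_iff)
  have "2^9 * ((lam1 + lam2) * sig) \<le> a2 * ((lam1 + lam2) * sig)" by (rule mult_right_mono[OF a2(2)]) (use r in simp)
  then show "2^9 * (sig * (lam1 + lam2)) \<le> 2 powr (real (M + N) / 4) * G"
    unfolding r_def[symmetric] ra by (simp only: mult.commute)
  have 1: "(lam1 + lam2) * sig / r = 1 / a2 * G" using ra a20 r(1) by (simp add: field_simps)
  have a1': "a1 = s\<^sup>2 / P * (G / c)" unfolding a1(1) s(2)[symmetric] P_def c_def ..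
  have 2: "sig\<^sup>2 / s \<le> 1 / a1 * G"
  proof -
    have "1 / a1 * G = c * P / s\<^sup>2" unfolding a1' using G c P s by (simp add: field_simps)
    also have "\<dots> \<ge> c * (2 * s) / s\<^sup>2" using P2 c s by (intro divide_right_mono mult_left_mono) auto
    finally have "c * (2 * s) / s\<^sup>2 \<le> 1 / a1 * G" .
    moreover have "c * (2 * s) / s\<^sup>2 = 2 * c / s" using s by (simp add: power2_eq_square)
    moreover have "sig\<^sup>2 / s \<le> 2 * c / s" using c s by (intro divide_right_mono) auto
    ultimately show ?thesis by linarith
  qed
  show "noise_scale \<le> (1 / a2 + 1 / a1) * G"
    unfolding noise_scale_def r_def[symmetric] s_def[symmetric] 1 using 2 by (simp only: distrib_right add_left_mono)
  define g where "g = G / c"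
  have g: "0 < g" using G c by (simp add: g_def)
  have sg: "a1 \<le> s * g"
  proof -
    have "s\<^sup>2 / P \<le> s\<^sup>2 / (2 * s)" using P2 s P by (intro divide_left_mono) auto
    also have "\<dots> \<le> s" using s by (simp add: power2_eq_square)
    finally show ?thesis unfolding a1' g_def[symmetric] using g by (intro mult_right_mono) auto
  qed
  have al: "g / (1 + g) \<le> alpha"
  proof -
    have "G / S = g / (1 + g)" unfolding S_factor c_def[symmetric] g_def using c by simp
    then show ?thesis using alpha_ge(1)[OF G] by simp
  qed
  \<comment> \<open>For \<open>g \<le> 1\<close> the bound \<open>alpha \<ge> g / 2\<close> meets
    \<open>sqrt D * g \<ge> a1\<close>; for larger \<open>g\<close> simply
    \<open>alpha \<ge> 1/2\<close>. The minimum covers both cases.\<close>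
  show "min a1 (sqrt D) / 2 \<le> sqrt D * alpha" unfolding s_def[symmetric]
  proof (cases "g \<le> 1")
    case True
    have "g / 2 \<le> g / (1 + g)" using True g by (intro divide_left_mono) auto
    then have "g / 2 \<le> alpha" using al by (rule order_trans)
    then have "s * (g / 2) \<le> s * alpha" using s by (intro mult_left_mono) auto
    then have "s * g / 2 \<le> s * alpha" by simp
    then show "min a1 s / 2 \<le> s * alpha" using sg min.cobounded1[of a1 s] by linarith
  next
    case False
    have "1 / 2 \<le> g / (1 + g)" using False g by (simp add: field_simps)
    then have "1 / 2 \<le> alpha" using al by (rule order_trans)
    then have "s * (1 / 2) \<le> s * alpha" using s by (intro mult_left_mono) auto
    then show "min a1 s / 2 \<le> s * alpha" using min.cobounded2[of a1 s] by simp
  qed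
qed

end

text \<open>The factor \<open>1 + o(1)\<close> is a single null sequence \<open>r\<close> common to
  all wrong configurations, and both minima are expressed by quantifying over the
  configurations.\<close>

theorem theorem5:
  fixes M N m0 n0 :: "nat \<Rightarrow> nat"
    and lam1 lam2 sig kappa :: "nat \<Rightarrow> real"
    and A1 A2 B1 B2 :: "nat \<Rightarrow> rmat"
    and xi :: real
  defines "Y \<equiv> \<lambda>t. model_Y (M t) (N t) (m0 t) (n0 t) (lam1 t) (lam2 t) (sig t)
                      (A1 t) (B1 t) (A2 t) (B2 t)"
    and "G \<equiv> \<lambda>t. G_val (M t) (N t) (m0 t) (n0 t) (lam1 t) (lam2 t) xi
                      (A1 t) (B1 t) (A2 t) (B2 t)"
    and "alpha \<equiv> \<lambda>t. ln (1 + G_val (M t) (N t) (m0 t) (n0 t) (lam1 t) (lam2 t) xi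
                      (A1 t) (B1 t) (A2 t) (B2 t) / ((sig t)^2 + (lam2 t)^2))"
  assumes lam_order: "\<And>t. lam1 t \<ge> lam2 t"
    and lam2_pos: "\<And>t. lam2 t > 0"
    and sigma_pos: "\<And>t. sig t > 0"
    and m0_le: "\<And>t. m0 t \<le> M t"
    and n0_le: "\<And>t. n0 t \<le> N t"
    and A_orth: "\<And>t. frob_inner (2^m0 t) (2^n0 t) (A1 t) (A1 t) = 1"
                "\<And>t. frob_inner (2^m0 t) (2^n0 t) (A2 t) (A2 t) = 1"
                "\<And>t. frob_inner (2^m0 t) (2^n0 t) (A1 t) (A2 t) = 0"
    and B_orth: "\<And>t. frob_inner (2^(M t - m0 t)) (2^(N t - n0 t)) (B1 t) (B1 t) = 1"
                "\<And>t. frob_inner (2^(M t - m0 t)) (2^(N t - n0 t)) (B2 t) (B2 t) = 1"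
                "\<And>t. frob_inner (2^(M t - m0 t)) (2^(N t - n0 t)) (B1 t) (B2 t) = 0"
    and MN_lim: "filterlim (\<lambda>t. M t + N t) at_top sequentially"
    and A1_cond: "filterlim (\<lambda>t. real (m0 t + n0 t) / ln (ln (real (M t * N t))))
                    at_top sequentially"
                 "filterlim (\<lambda>t. real ((M t - m0 t) + (N t - n0 t)) / ln (ln (real (M t * N t))))
                    at_top sequentially"
    and xi_bounds: "0 < xi" "xi < 1"
    and A4_WA: "\<And>t. \<forall>(m,n)\<in>cfgsWA (M t) (N t) (m0 t) (n0 t).
                  cosTheta (2^(m+n)) (2^(M t + N t - m - n)) (2^(M t + N t - m - n))
                    (rearr (M t) (N t) m n (kterm (M t) (N t) (m0 t) (n0 t) (A1 t) (B1 t)))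
                    (rearr (M t) (N t) m n (kterm (M t) (N t) (m0 t) (n0 t) (A2 t) (B2 t))) \<le> xi"
    and A4_WB: "\<And>t. \<forall>(m,n)\<in>cfgsWB (M t) (N t) (m0 t) (n0 t).
                  cosTheta (2^(M t + N t - m - n)) (2^(m+n)) (2^(m+n))
                    (mtrans (rearr (M t) (N t) m n (kterm (M t) (N t) (m0 t) (n0 t) (A1 t) (B1 t))))
                    (mtrans (rearr (M t) (N t) m n (kterm (M t) (N t) (m0 t) (n0 t) (A2 t) (B2 t))))
                  \<le> xi"
    and A6: "filterlim (\<lambda>t. (2::real)^(M t + N t)
                 / ((2::real)^(m0 t + n0 t) + 2^((M t - m0 t) + (N t - n0 t)))
                 * (G t / ((sig t)^2 + (lam2 t)^2))) at_top sequentially"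
            "filterlim (\<lambda>t. 2 powr (real (M t + N t) / 4)
                 * (G t / ((lam1 t + lam2 t) * sig t))) at_top sequentially"
    and kappa_lb: "\<And>t. kappa t \<ge> 2 * ln 2"
    and kappa_small: "kappa \<in> o[sequentially](\<lambda>t. (2::real)^(M t + N t) * alpha t
                 / ((2::real)^(m0 t + n0 t) + 2^(M t + N t - m0 t - n0 t)))"
  shows "(\<exists>r :: nat \<Rightarrow> real. r \<longlonglongrightarrow> 0 \<and>
            (\<forall>\<^sub>F t in sequentially. \<forall>(m,n)\<in>cfgsW (M t) (N t) (m0 t) (n0 t).
               (\<integral>E. IC (kappa t) (M t) (N t) m n (Y t E) \<partial>gauss_mat (M t) (N t))
               - (\<integral>E. IC (kappa t) (M t) (N t) (m0 t) (n0 t) (Y t E) \<partial>gauss_mat (M t) (N t))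
               \<ge> (2::real)^(M t + N t) * alpha t * (1 + r t)))
       \<and> (\<lambda>t. measure (gauss_mat (M t) (N t))
               {E \<in> space (gauss_mat (M t) (N t)). \<forall>(m,n)\<in>cfgsW (M t) (N t) (m0 t) (n0 t).
                  IC (kappa t) (M t) (N t) (m0 t) (n0 t) (Y t E)
                    < IC (kappa t) (M t) (N t) m n (Y t E)}) \<longlonglongrightarrow> 1"
proof -
  let ?D = "\<lambda>t. (2::real)^(M t + N t)"
  let ?P = "\<lambda>t. (2::real)^(m0 t + n0 t) + 2^(M t + N t - m0 t - n0 t)"
  define a1 where "a1 = (\<lambda>t. ?D t / ((2::real)^(m0 t + n0 t) + 2^((M t - m0 t) + (N t - n0 t))) * (G t / ((sig t)^2 + (lam2 t)^2)))"
  define a2 where "a2 = (\<lambda>t. 2 powr (real (M t + N t) / 4) * (G t / ((lam1 t + lam2 t) * sig t)))"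
  define s where "s = (\<lambda>t. sqrt (?D t))"
  define \<delta> where "\<delta> = (\<lambda>t. 1 / a2 t + 1 / a1 t)"
  define \<epsilon> where "\<epsilon> = (\<lambda>t. kappa t / (?D t * alpha t / ?P t))"
  have a1_lim: "filterlim a1 at_top sequentially" unfolding a1_def by (rule A6(1))
  have a2_lim: "filterlim a2 at_top sequentially" unfolding a2_def by (rule A6(2))
  have s_lim: "filterlim s at_top sequentially"
  proof -
    have "filterlim (\<lambda>n::nat. sqrt (2^n)) at_top sequentially" by real_asymp
    from filterlim_compose[OF this MN_lim] show ?thesis unfolding s_def .
  qed
  have \<delta>_lim: "\<delta> \<longlonglongrightarrow> 0"
    unfolding \<delta>_def using tendsto_add[OF tendsto_divide_0[OF tendsto_const filterlim_at_top_imp_at_infinity[OF a2_lim]]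
      tendsto_divide_0[OF tendsto_const filterlim_at_top_imp_at_infinity[OF a1_lim]], of 1 1] by simp
  have \<epsilon>_lim: "\<epsilon> \<longlonglongrightarrow> 0" unfolding \<epsilon>_def by (rule smalloD_tendsto[OF kappa_small])
  have min_lim: "filterlim (\<lambda>t. min (a1 t) (s t) / 2) at_top sequentially"
    unfolding filterlim_at_top
  proof
    fix Z :: real
    have "\<forall>\<^sub>F t in sequentially. 2 * Z \<le> a1 t" "\<forall>\<^sub>F t in sequentially. 2 * Z \<le> s t"
      using filterlim_at_top[THEN iffD1, rule_format, OF a1_lim] filterlim_at_top[THEN iffD1, rule_format, OF s_lim] .
    then show "\<forall>\<^sub>F t in sequentially. Z \<le> min (a1 t) (s t) / 2" by eventually_elim simp
  qed
  have inter: "\<forall>\<^sub>F t in sequentially. two_term (M t) (N t) (m0 t) (n0 t) (lam1 t) (lam2 t) (sig t) xi (A1 t) (B1 t) (A2 t) (B2 t)"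
  proof -
    \<comment> \<open>A quotient of at least 1 has a nonzero numerator, so the true configuration is
      neither of the two excluded corners.\<close>
    have "\<forall>\<^sub>F t in sequentially. 1 \<le> real (m0 t + n0 t) / ln (ln (real (M t * N t)))"
      "\<forall>\<^sub>F t in sequentially. 1 \<le> real ((M t - m0 t) + (N t - n0 t)) / ln (ln (real (M t * N t)))"
      using filterlim_at_top[THEN iffD1, rule_format, OF A1_cond(1)] filterlim_at_top[THEN iffD1, rule_format, OF A1_cond(2)] .
    then show ?thesis
    proof eventually_elim
      case (elim t)
      have "m0 t + n0 t \<noteq> 0" using elim(1) by (intro notI) (simp only: of_nat_0 div_0)
      moreover have "(M t - m0 t) + (N t - n0 t) \<noteq> 0" using elim(2) by (intro notI) (simp only: of_nat_0 div_0)
      ultimately have "(m0 t, n0 t) \<in> cfgs (M t) (N t)" using m0_le[of t] n0_le[of t] by (auto simp: cfgs_def)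
      then show ?case
        by (intro two_term.intro lam_order lam2_pos sigma_pos m0_le n0_le A_orth B_orth xi_bounds A4_WA A4_WB)
    qed
  qed
  have base: "\<forall>\<^sub>F t in sequentially. 2^9 \<le> a2 t \<and> 0 < a1 t \<and> 1 \<le> min (a1 t) (s t) / 2 \<and> 2^10 \<le> s t"
  proof -
    note ge = filterlim_at_top[THEN iffD1, rule_format]
    have "\<forall>\<^sub>F t in sequentially. 0 < a1 t"
      using a1_lim unfolding filterlim_at_top_dense by blast
    with ge[OF a2_lim, of "2^9"] ge[OF min_lim, of 1] ge[OF s_lim, of "2^10"]
    show ?thesis by eventually_elim blast
  qed
  have facts: "\<forall>\<^sub>F t in sequentially.
     (\<forall>(m,n)\<in>cfgsW (M t) (N t) (m0 t) (n0 t).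
         ?D t * alpha t * (1 + - (384 * \<delta> t + remainder (s t) + \<epsilon> t))
        \<le> (\<integral>E. IC (kappa t) (M t) (N t) m n (Y t E) \<partial>gauss_mat (M t) (N t))
           - (\<integral>E. IC (kappa t) (M t) (N t) (m0 t) (n0 t) (Y t E) \<partial>gauss_mat (M t) (N t))) \<and>
     min (a1 t) (s t) / 2 \<le> s t * alpha t \<and>
     (\<forall>K\<ge>96. 16 * K * \<delta> t \<le> 1 \<longrightarrow> \<epsilon> t + 8 * K * \<delta> t + 2 * K / (s t * alpha t) < 1 \<longrightarrow>
       1 - 10 * exp (- (K / 16)) \<le> measure (gauss_mat (M t) (N t))
               {E \<in> space (gauss_mat (M t) (N t)). \<forall>(m,n)\<in>cfgsW (M t) (N t) (m0 t) (n0 t).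
                  IC (kappa t) (M t) (N t) (m0 t) (n0 t) (Y t E) < IC (kappa t) (M t) (N t) m n (Y t E)})"
    using inter base
  proof eventually_elim
    case (elim t)
    interpret T: two_term "M t" "N t" "m0 t" "n0 t" "lam1 t" "lam2 t" "sig t" xi "A1 t" "B1 t" "A2 t" "B2 t"
      by (rule elim(1))
    have D: "T.D = ?D t" by (rule T.D_def)
    have s: "sqrt T.D = s t" by (simp only: D s_def)
    have G: "T.G = G t" by (simp only: T.G_def G_def)
    have al: "T.alpha = alpha t" by (simp only: T.alpha_def T.G_def alpha_def)
    have e: "M t + N t - m0 t - n0 t = (M t - m0 t) + (N t - n0 t)" using m0_le[of t] n0_le[of t] by simp
    have a2: "a2 t = 2 powr (real (M t + N t) / 4) * (T.G / ((lam1 t + lam2 t) * sig t))" by (simp only: a2_def G)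
    have a1: "a1 t = T.D / (real (T.rows (m0 t) (n0 t)) + real (T.cols (m0 t) (n0 t))) * (T.G / ((sig t)\<^sup>2 + (lam2 t)\<^sup>2))"
      by (simp only: a1_def G D T.rows_plus_cols e)
    have b: "2^9 \<le> a2 t" "0 < a1 t" "1 \<le> min (a1 t) (s t) / 2" "2^10 \<le> s t" using elim(2) by auto
    note f = T.scale_facts[OF a2 b(1) a1 b(2)]
    have f2: "T.noise_scale \<le> \<delta> t * T.G" using f(2) by (simp only: \<delta>_def)
    have f4: "min (a1 t) (s t) / 2 \<le> s t * alpha t" using f(4) by (simp only: s al)
    have sa: "1 \<le> sqrt T.D * T.alpha" using f4 b(3) unfolding s al by linarith
    have D20: "2^20 \<le> T.D"
    proof -
      have "(2^10)\<^sup>2 \<le> (sqrt T.D)\<^sup>2" unfolding s using b(4) by (intro power_mono) auto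
      then show ?thesis by simp
    qed
    have eps: "kappa t * (real (T.rows (m0 t) (n0 t)) + real (T.cols (m0 t) (n0 t))) = \<epsilon> t * (T.D * T.alpha)"
    proof -
      have "0 < ?P t" by (intro add_pos_pos) auto
      moreover have "0 < ?D t * alpha t" using T.alpha_ge(2)[OF f(1)] unfolding al by simp
      moreover have "k * p = k / (x / p) * x" if "0 < p" "0 < x" for k p x :: real using that by simp
      ultimately show ?thesis unfolding T.rows_plus_cols D al \<epsilon>_def by blast
    qed
    have gm: "gauss_mat (M t) (N t) = gauss T.I" by (rule gauss_mat_eq)
    have Y: "Y t E = T.plus_noise T.X E" for E unfolding Y_def by (rule T.model_Y_eq)
    show ?case
    proof (intro conjI allI impI)
      show "\<forall>(m,n)\<in>cfgsW (M t) (N t) (m0 t) (n0 t).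
         ?D t * alpha t * (1 + - (384 * \<delta> t + remainder (s t) + \<epsilon> t))
        \<le> (\<integral>E. IC (kappa t) (M t) (N t) m n (Y t E) \<partial>gauss_mat (M t) (N t))
           - (\<integral>E. IC (kappa t) (M t) (N t) (m0 t) (n0 t) (Y t E) \<partial>gauss_mat (M t) (N t))"
        using T.expectation_gap_asymp[OF _ f(1) D20 kappa_lb f2 f(3) sa eps] unfolding gm Y D[symmetric] al[symmetric] s[symmetric] by blast
      show "min (a1 t) (s t) / 2 \<le> s t * alpha t" by (rule f4)
      fix K :: real assume K: "96 \<le> K" "16 * K * \<delta> t \<le> 1" "\<epsilon> t + 8 * K * \<delta> t + 2 * K / (s t * alpha t) < 1"
      show "1 - 10 * exp (- (K / 16)) \<le> measure (gauss_mat (M t) (N t))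
               {E \<in> space (gauss_mat (M t) (N t)). \<forall>(m,n)\<in>cfgsW (M t) (N t) (m0 t) (n0 t).
                  IC (kappa t) (M t) (N t) (m0 t) (n0 t) (Y t E) < IC (kappa t) (M t) (N t) m n (Y t E)}"
        unfolding gm Y by (rule T.probability_gap_asymp[OF f(1) kappa_lb K(1) f2 eps K(2)]) (use K(3) in \<open>simp only: s al\<close>)
    qed
  qed
  show ?thesis
  proof (intro conjI exI)
    \<comment> \<open>The three summands stem from the random errors, from the terms without factor
      \<open>alpha\<close>, and from the penalty of the true configuration.\<close>
    show "(\<lambda>t. - (384 * \<delta> t + remainder (s t) + \<epsilon> t)) \<longlonglongrightarrow> 0"
      using tendsto_minus[OF tendsto_add[OF tendsto_add[OF tendsto_mult_right_zero[OF \<delta>_lim, of 384] filterlim_compose[OF remainder_tendsto s_lim]] \<epsilon>_lim]]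
      by simp
    show "\<forall>\<^sub>F t in sequentially. \<forall>(m,n)\<in>cfgsW (M t) (N t) (m0 t) (n0 t).
               (\<integral>E. IC (kappa t) (M t) (N t) m n (Y t E) \<partial>gauss_mat (M t) (N t))
               - (\<integral>E. IC (kappa t) (M t) (N t) (m0 t) (n0 t) (Y t E) \<partial>gauss_mat (M t) (N t))
               \<ge> (2::real)^(M t + N t) * alpha t * (1 + - (384 * \<delta> t + remainder (s t) + \<epsilon> t))"
      using facts by (rule eventually_mono) (elim conjE, assumption)
    let ?m = "\<lambda>t. measure (gauss_mat (M t) (N t))
               {E \<in> space (gauss_mat (M t) (N t)). \<forall>(m,n)\<in>cfgsW (M t) (N t) (m0 t) (n0 t).
                  IC (kappa t) (M t) (N t) (m0 t) (n0 t) (Y t E) < IC (kappa t) (M t) (N t) m n (Y t E)}"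
    show "?m \<longlonglongrightarrow> 1"
    proof (rule order_tendstoI)
      fix a :: real assume "1 < a"
      moreover have "?m t \<le> 1" for t
        unfolding gauss_mat_eq by (rule prob_space.prob_le_1[OF prob_space_gauss])
      ultimately show "\<forall>\<^sub>F t in sequentially. ?m t < a" by (intro always_eventually allI) (rule le_less_trans)
    next
      \<comment> \<open>The level \<open>K\<close> is fixed before \<open>t\<close> grows: the
        failure bound \<open>10 * exp (- (K / 16))\<close> does not involve \<open>t\<close>, and
        for fixed \<open>K\<close> the smallness conditions hold eventually.\<close>
      fix a :: real assume a: "a < 1"
      have "((\<lambda>K::real. 10 * exp (- (K / 16))) \<longlongrightarrow> 0) at_top" by real_asymp
      from order_tendstoD(2)[OF this, of "1 - a"] a have "\<forall>\<^sub>F K in at_top. 10 * exp (- (K / 16)) < 1 - a" by simp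
      with eventually_ge_at_top[of "96::real"] have "\<forall>\<^sub>F K in at_top. 96 \<le> K \<and> 10 * exp (- (K / 16)) < 1 - a"
        by eventually_elim blast
      then obtain K where K: "96 \<le> K" "10 * exp (- (K / 16)) < 1 - a"
        using eventually_happens'[OF trivial_limit_at_top_linorder] by blast
      have l1: "(\<lambda>t. 16 * K * \<delta> t) \<longlonglongrightarrow> 0" using \<delta>_lim by (rule tendsto_mult_right_zero)
      \<comment> \<open>The divergent lower bound of \<open>s t * alpha t\<close> stands in its
        place, since only an upper estimate of the quotient is needed.\<close>
      have l2: "(\<lambda>t. \<epsilon> t + 8 * K * \<delta> t + 2 * K / (min (a1 t) (s t) / 2)) \<longlonglongrightarrow> 0"
        using tendsto_add[OF tendsto_add[OF \<epsilon>_lim tendsto_mult_right_zero[OF \<delta>_lim, of "8 * K"]]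
          tendsto_divide_0[OF tendsto_const filterlim_at_top_imp_at_infinity[OF min_lim], of "2 * K"]] by simp
      have "\<forall>\<^sub>F t in sequentially. 16 * K * \<delta> t < 1" by (rule order_tendstoD(2)[OF l1]) simp
      moreover have "\<forall>\<^sub>F t in sequentially. \<epsilon> t + 8 * K * \<delta> t + 2 * K / (min (a1 t) (s t) / 2) < 1"
        by (rule order_tendstoD(2)[OF l2]) simp
      ultimately show "\<forall>\<^sub>F t in sequentially. a < ?m t"
        using facts base
      proof eventually_elim
        case (elim t)
        have "2 * K / (s t * alpha t) \<le> 2 * K / (min (a1 t) (s t) / 2)"
        proof (rule divide_left_mono)
          show le: "min (a1 t) (s t) / 2 \<le> s t * alpha t" by (rule elim(3)[THEN conjunct2, THEN conjunct1])
          show "0 \<le> 2 * K" using K(1) by simp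
          show "0 < s t * alpha t * (min (a1 t) (s t) / 2)" 
          using le elim(4)[THEN conjunct2, THEN conjunct2, THEN conjunct1] by (intro mult_pos_pos[of "s t * alpha t"]) linarith+
        qed
        then have "\<epsilon> t + 8 * K * \<delta> t + 2 * K / (s t * alpha t) < 1" using elim(2) by linarith
        then have "1 - 10 * exp (- (K / 16)) \<le> ?m t" 
          using elim(3)[THEN conjunct2, THEN conjunct2, rule_format, OF K(1) less_imp_le[OF elim(1)]] by blast
        then show "a < ?m t" using K(2) by linarith
      qed
    qed
  qed
qed

end
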